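(* Let $F$ be a field of characteristic different from $2$. Let $K/F$ be a finite field extension with $[K:F]\leq 8$ and let $Q$ be a $K$-quaternion algebra. Then there exists a $2$-extension $F'/F$ with $[F':F]\leq 2^{[K:F]}$ such that $Q_{KF'}$ is split.
   Context: A separable finite field extension $F'/F$ is called a $2$-extension if the degree of its normal closure over $F$ is a power of $2$; equivalently, if $F'$ can be obtained from $F$ by a finite (possibly empty) sequence of separable quadratic extensions. A quaternion algebra over a field is a central simple algebra of degree two (i.e. of dimension four); it is split if it is isomorphic to a $(2\times 2)$-matrix algebra over its center. For a central simple $K$-algebra $A$ and a field extension $M/K$, $A_M=A\otimes_K M$. The composite field $KF'$ is formed inside a common algebraic closure (the extension $F'/F$ being found inside a fixed algebraic closure of $K$). *)

theory Defs
  imports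
    "HOL-Algebra.Algebraic_Closure"
    "HOL-Algebra.Free_Abelian_Groups"
    "HOL-Algebra.Generated_Fields"
    "HOL-Algebra.Module"
begin

section \<open>Field extensions inside a fixed algebraically closed field\<close>

definition ring_char :: "('a, 'm) ring_scheme \<Rightarrow> nat" where
  "ring_char R =
    (if \<exists>n::nat. 0 < n \<and> [n] \<cdot>\<^bsub>R\<^esub> \<one>\<^bsub>R\<^esub> = \<zero>\<^bsub>R\<^esub>
     then LEAST n. 0 < n \<and> [n] \<cdot>\<^bsub>R\<^esub> \<one>\<^bsub>R\<^esub> = \<zero>\<^bsub>R\<^esub> else 0)"

text \<open>Throughout, \<open>L\<close> plays the role of an algebraically closed field and \<open>F\<close>, \<open>E\<close>, \<open>N\<close>, \<open>M\<close>, \<open>K\<close>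
  are (carrier sets of) subfields of \<open>L\<close>; the field with carrier \<open>K\<close> is \<open>L\<lparr>carrier := K\<rparr>\<close>.\<close>

definition finite_field_extension :: "('a, 'm) ring_scheme \<Rightarrow> 'a set \<Rightarrow> 'a set \<Rightarrow> bool" where
  "finite_field_extension L F E \<longleftrightarrow>
     subfield F L \<and> subfield E L \<and> F \<subseteq> E \<and> ring.finite_dimension L F E"

text \<open>An element is separable over \<open>F\<close> if its minimal polynomial has no multiple root in the
  algebraically closed overfield \<open>L\<close>.\<close>

definition separable_extension :: "('a, 'm) ring_scheme \<Rightarrow> 'a set \<Rightarrow> 'a set \<Rightarrow> bool" where
  "separable_extension L F E \<longleftrightarrow>
     (\<forall>x\<in>E. ring.algebraic L F x \<and>
        (\<forall>a\<in>carrier L. ring.alg_mult L (ring.Irr L F x) a \<le> 1))"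

text \<open>As \<open>L\<close> is algebraically closed, a polynomial splits over \<open>N\<close> iff all its roots in \<open>L\<close> lie in
  \<open>N\<close>. (The library's \<open>splitted_on\<close> cannot be used here: it is based on \<open>mset_set N\<close>, which is
  empty for infinite \<open>N\<close>.)\<close>

definition normal_extension :: "('a, 'm) ring_scheme \<Rightarrow> 'a set \<Rightarrow> 'a set \<Rightarrow> bool" where
  "normal_extension L F N \<longleftrightarrow>
     subfield N L \<and> F \<subseteq> N \<and> (\<forall>x\<in>N. ring.algebraic L F x) \<and>
     (\<forall>p\<in>carrier (univ_poly L F). pirreducible\<^bsub>L\<^esub> F p \<longrightarrow>
        (\<exists>x\<in>N. ring.eval L p x = \<zero>\<^bsub>L\<^esub>) \<longrightarrow>
        (\<forall>x\<in>carrier L. ring.eval L p x = \<zero>\<^bsub>L\<^esub> \<longrightarrow> x \<in> N))"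

definition normal_closure :: "('a, 'm) ring_scheme \<Rightarrow> 'a set \<Rightarrow> 'a set \<Rightarrow> 'a set" where
  "normal_closure L F E = \<Inter>{N. normal_extension L F N \<and> E \<subseteq> N}"

definition two_extension :: "('a, 'm) ring_scheme \<Rightarrow> 'a set \<Rightarrow> 'a set \<Rightarrow> bool" where
  "two_extension L F E \<longleftrightarrow>
     finite_field_extension L F E \<and> separable_extension L F E \<and>
     (\<exists>n. ring.dimension L (2 ^ n) F (normal_closure L F E))"


section \<open>Central simple algebras\<close>

text \<open>The library's locale \<^locale>\<open>algebra\<close> only covers commutative algebras.\<close>

locale assoc_algebra = module + ring M +
  assumes smult_assoc_left:
      "\<lbrakk>a \<in> carrier R; x \<in> carrier M; y \<in> carrier M\<rbrakk> \<Longrightarrow>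
      (a \<odot>\<^bsub>M\<^esub> x) \<otimes>\<^bsub>M\<^esub> y = a \<odot>\<^bsub>M\<^esub> (x \<otimes>\<^bsub>M\<^esub> y)"
    and smult_assoc_right:
      "\<lbrakk>a \<in> carrier R; x \<in> carrier M; y \<in> carrier M\<rbrakk> \<Longrightarrow>
      x \<otimes>\<^bsub>M\<^esub> (a \<odot>\<^bsub>M\<^esub> y) = a \<odot>\<^bsub>M\<^esub> (x \<otimes>\<^bsub>M\<^esub> y)"

definition ring_center :: "('a, 'm) ring_scheme \<Rightarrow> 'a set" where
  "ring_center A = {z \<in> carrier A. \<forall>a\<in>carrier A. z \<otimes>\<^bsub>A\<^esub> a = a \<otimes>\<^bsub>A\<^esub> z}"

text \<open>The image \<open>K \<cdot> 1\<close> of the base field in the algebra. For a nonzero algebra it is a subfield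
  isomorphic to \<open>K\<close>, acting by left multiplication as \<open>K\<close> does, so the library's notion of
  dimension over a subfield applies to it.\<close>

definition scalars :: "('k, 'm) ring_scheme \<Rightarrow> ('k, 'a, 'n) module_scheme \<Rightarrow> 'a set" where
  "scalars K A = (\<lambda>k. k \<odot>\<^bsub>A\<^esub> \<one>\<^bsub>A\<^esub>) ` carrier K"

definition simple_ring :: "('a, 'm) ring_scheme \<Rightarrow> bool" where
  "simple_ring A \<longleftrightarrow>
     ring A \<and> carrier A \<noteq> {\<zero>\<^bsub>A\<^esub>} \<and> (\<forall>I. ideal I A \<longrightarrow> I = {\<zero>\<^bsub>A\<^esub>} \<or> I = carrier A)"

definition central_simple_algebra ::
    "('k, 'm) ring_scheme \<Rightarrow> ('k, 'a, 'n) module_scheme \<Rightarrow> bool" where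
  "central_simple_algebra K A \<longleftrightarrow>
     field K \<and> assoc_algebra K A \<and> simple_ring A \<and> ring_center A = scalars K A \<and>
     ring.finite_dimension A (scalars K A) (carrier A)"

definition quaternion_algebra ::
    "('k, 'm) ring_scheme \<Rightarrow> ('k, 'a, 'n) module_scheme \<Rightarrow> bool" where
  "quaternion_algebra K A \<longleftrightarrow>
     central_simple_algebra K A \<and> ring.dimension A 4 (scalars K A) (carrier A)"


section \<open>Tensor products and extension of scalars\<close>

text \<open>The integral monoid ring of \<open>G\<close>: the free abelian group on \<open>G\<close>, with the multiplication of
  \<open>G\<close> extended bilinearly.\<close>

definition int_monoid_ring :: "('g, 'm) monoid_scheme \<Rightarrow> ('g \<Rightarrow>\<^sub>0 int) ring" where
  "int_monoid_ring G =
     \<lparr>carrier = carrier (free_Abelian_group (carrier G)),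
      monoid.mult = (\<lambda>f g. frag_extend (\<lambda>x. frag_extend (\<lambda>y. frag_of (x \<otimes>\<^bsub>G\<^esub> y)) g) f),
      one = frag_of \<one>\<^bsub>G\<^esub>, ring.zero = 0, add = (+)\<rparr>"

definition tensor_relations ::
    "('k, 'm) ring_scheme \<Rightarrow> ('k, 'a, 'n) module_scheme \<Rightarrow> ('k, 'b, 'o) module_scheme
     \<Rightarrow> ('a \<times> 'b \<Rightarrow>\<^sub>0 int) set" where
  "tensor_relations K A B =
     {frag_of (a \<oplus>\<^bsub>A\<^esub> a', b) - frag_of (a, b) - frag_of (a', b) | a a' b.
        a \<in> carrier A \<and> a' \<in> carrier A \<and> b \<in> carrier B} \<union>
     {frag_of (a, b \<oplus>\<^bsub>B\<^esub> b') - frag_of (a, b) - frag_of (a, b') | a b b'.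
        a \<in> carrier A \<and> b \<in> carrier B \<and> b' \<in> carrier B} \<union>
     {frag_of (k \<odot>\<^bsub>A\<^esub> a, b) - frag_of (a, k \<odot>\<^bsub>B\<^esub> b) | k a b.
        k \<in> carrier K \<and> a \<in> carrier A \<and> b \<in> carrier B}"

text \<open>For \<open>K\<close>-algebras \<open>A\<close> and \<open>B\<close> this is the usual construction of \<open>A \<otimes>\<^sub>K B\<close> as the free abelian
  group on \<open>A \<times> B\<close> modulo the bilinear, \<open>K\<close>-balanced relations, with multiplication
  \<open>(a \<otimes> b)(a' \<otimes> b') = aa' \<otimes> bb'\<close>. The additive subgroup generated by the relations is stable under
  multiplication by every \<open>(a, b)\<close> on either side, hence equals the ideal they generate.\<close>

definition tensor_ideal ::
    "('k, 'm) ring_scheme \<Rightarrow> ('k, 'a, 'n) module_scheme \<Rightarrow> ('k, 'b, 'o) module_scheme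
     \<Rightarrow> ('a \<times> 'b \<Rightarrow>\<^sub>0 int) set" where
  "tensor_ideal K A B = Idl\<^bsub>int_monoid_ring (A \<times>\<times> B)\<^esub> (tensor_relations K A B)"

definition tensor_product ::
    "('k, 'm) ring_scheme \<Rightarrow> ('k, 'a, 'n) module_scheme \<Rightarrow> ('k, 'b, 'o) module_scheme
     \<Rightarrow> ('a \<times> 'b \<Rightarrow>\<^sub>0 int) set ring" where
  "tensor_product K A B = int_monoid_ring (A \<times>\<times> B) Quot tensor_ideal K A B"

definition pure_tensor ::
    "('k, 'm) ring_scheme \<Rightarrow> ('k, 'a, 'n) module_scheme \<Rightarrow> ('k, 'b, 'o) module_scheme
     \<Rightarrow> 'a \<Rightarrow> 'b \<Rightarrow> ('a \<times> 'b \<Rightarrow>\<^sub>0 int) set" where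
  "pure_tensor K A B a b =
     tensor_ideal K A B +>\<^bsub>int_monoid_ring (A \<times>\<times> B)\<^esub> frag_of (a, b)"

text \<open>The subfield \<open>M\<close> of \<open>L\<close>, regarded as an algebra over any of its subfields.\<close>

definition subfield_algebra :: "('a, 'm) ring_scheme \<Rightarrow> 'a set \<Rightarrow> ('a, 'a) module" where
  "subfield_algebra L M =
     \<lparr>carrier = M, monoid.mult = monoid.mult L, one = \<one>\<^bsub>L\<^esub>,
      ring.zero = \<zero>\<^bsub>L\<^esub>, add = add L, smult = monoid.mult L\<rparr>"

text \<open>For subfields \<open>K \<subseteq> M\<close> of \<open>L\<close> and a \<open>K\<close>-algebra \<open>A\<close>, the \<open>M\<close>-algebra \<open>A \<otimes>\<^sub>K M\<close>.\<close>

definition scalar_extension ::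
    "('a, 'm) ring_scheme \<Rightarrow> 'a set \<Rightarrow> ('a, 'b, 'n) module_scheme \<Rightarrow> 'a set
     \<Rightarrow> ('a, ('b \<times> 'a \<Rightarrow>\<^sub>0 int) set) module" where
  "scalar_extension L K A M =
     (let K' = L\<lparr>carrier := K\<rparr>; B = subfield_algebra L M; T = tensor_product K' A B
      in \<lparr>carrier = carrier T, monoid.mult = monoid.mult T, one = \<one>\<^bsub>T\<^esub>,
          ring.zero = \<zero>\<^bsub>T\<^esub>, add = add T,
          smult = (\<lambda>m t. pure_tensor K' A B \<one>\<^bsub>A\<^esub> m \<otimes>\<^bsub>T\<^esub> t)\<rparr>)"


section \<open>Split quaternion algebras\<close>

definition matrix_algebra :: "('a, 'm) ring_scheme \<Rightarrow> nat \<Rightarrow> ('a, nat \<Rightarrow> nat \<Rightarrow> 'a) module" where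
  "matrix_algebra R n =
     \<lparr>carrier = {..<n} \<rightarrow>\<^sub>E ({..<n} \<rightarrow>\<^sub>E carrier R),
      monoid.mult = (\<lambda>A B. \<lambda>i\<in>{..<n}. \<lambda>j\<in>{..<n}. \<Oplus>\<^bsub>R\<^esub>k\<in>{..<n}. A i k \<otimes>\<^bsub>R\<^esub> B k j),
      one = (\<lambda>i\<in>{..<n}. \<lambda>j\<in>{..<n}. if i = j then \<one>\<^bsub>R\<^esub> else \<zero>\<^bsub>R\<^esub>),
      ring.zero = (\<lambda>i\<in>{..<n}. \<lambda>j\<in>{..<n}. \<zero>\<^bsub>R\<^esub>),
      add = (\<lambda>A B. \<lambda>i\<in>{..<n}. \<lambda>j\<in>{..<n}. A i j \<oplus>\<^bsub>R\<^esub> B i j),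
      smult = (\<lambda>r A. \<lambda>i\<in>{..<n}. \<lambda>j\<in>{..<n}. r \<otimes>\<^bsub>R\<^esub> A i j)\<rparr>"

definition algebra_iso ::
    "('k, 'm) ring_scheme \<Rightarrow> ('k, 'a, 'n) module_scheme \<Rightarrow> ('k, 'b, 'o) module_scheme
     \<Rightarrow> ('a \<Rightarrow> 'b) set" where
  "algebra_iso K A B =
     {h \<in> ring_iso A B. \<forall>k\<in>carrier K. \<forall>x\<in>carrier A. h (k \<odot>\<^bsub>A\<^esub> x) = k \<odot>\<^bsub>B\<^esub> h x}"

definition split_quaternion_algebra ::
    "('k, 'm) ring_scheme \<Rightarrow> ('k, 'a, 'n) module_scheme \<Rightarrow> bool" where
  "split_quaternion_algebra K A \<longleftrightarrow> algebra_iso K A (matrix_algebra K 2) \<noteq> {}"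

end

theory Submission
  imports
    Defs
    "HOL-Computational_Algebra.Primes"
begin

text \<open>Write \<open>Q = (a, b)\<close> over \<open>K\<close>. It suffices to find \<open>F'\<close> such that \<open>b\<close> is a norm \<open>u\<^sup>2 - a v\<^sup>2\<close> over
  \<open>KF'\<close>, since this makes the matrices of \<open>i\<close> and \<open>j\<close> explicit. Let \<open>n = [K : F]\<close> and let \<open>U\<close> be the
  \<open>F\<close>-span of \<open>1/a, a, 1\<close>. Modulo \<open>U\<close> the form \<open>f(z, y) = b z\<^sup>2 - a b y\<^sup>2\<close> on \<open>K \<times> K\<close> is a system of
  \<open>r = n - 3\<close> quadratic forms in \<open>2 n > r (r + 1) / 2\<close> variables over \<open>F\<close> (this is where \<open>n \<le> 8\<close> enters), and
  such a system has a nontrivial common zero over a tower of \<open>r\<close> quadratic extensions. Indeed, take any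
  \<open>v \<noteq> 0\<close> with \<open>f v \<notin> U\<close>, restrict to the vectors polar to \<open>v\<close> modulo \<open>U\<close>, find there by induction a zero \<open>t\<close>
  modulo \<open>U + F f(v)\<close>, say \<open>f t \<in> g f(v) + U\<close>, and adjoin \<open>e\<close> with \<open>e\<^sup>2 = -g\<close>; then \<open>t + e v\<close> and \<open>t - e v\<close>
  are zeros modulo \<open>U\<close> and not both vanish. Three further square roots write the value in \<open>U\<close> as
  \<open>e\<^sup>2 - a x\<^sup>2\<close>, and dividing by \<open>z\<^sup>2 - a y\<^sup>2\<close> shows that \<open>b\<close> is a norm.

  Towers of quadratic extensions are \<open>2\<close>-extensions because they embed into normal ones, obtained by
  adjoining the square roots of all conjugates at each stage.\<close>

section \<open>Quadratic towers\<close>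

text \<open>The shape of \<open>U\<close> comes from the square of x = p + q/a: since a x^2 = p^2 a
  + 2 p q + q^2/a, the values e^2 - a x^2 reach every element of \<open>U\<close> at the cost of one
  root per dimension. Together with the r = n - 3 roots for the common zero this makes n roots,
  whence 2^n. If 1/a, a, 1 are dependent over F, then a is quadratic over F or lies in F; a root of
  the discriminant and a root of a then turn a into a square, for which the norm form represents
  everything.

  The obstacle is that K and the tower need not be linearly disjoint: a formal zero with
  coefficients in the tower could collapse to 0 in L. All vectors therefore live in L \<times> L,
  where t + e v and t - e v add up to 2 t \<noteq> 0. The counting stays over F; only the zero
  itself is sought in the span over the tower.

  The tensor product is a quotient of a free abelian group. Its splitting is proved by computing the
  kernel of a map into matrices, with four coordinates in KF' as normal form of a tensor.\<close>

context field
begin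

lemma diff_zeroI:
  "\<lbrakk>a \<ominus> b = \<zero>; a \<in> carrier R; b \<in> carrier R\<rbrakk> \<Longrightarrow> a = b"
  by (metis r_right_minus_eq)

text \<open>The rule that generates \<open>simple_extension\<close> preserves the form u s + v,
  because (u s + v) s + k = v s + (u s^2 + k) and s^2 \<in> E. The line extension carries the
  dimension count, the simple extension the field structure.\<close>

lemma quadratic_extension_eq:
  assumes E: "subfield E R" and s: "s \<in> carrier R" "s \<otimes> s \<in> E"
  shows "line_extension E s E = simple_extension E s"
proof
  have sub: "subring (simple_extension E s) R"
    using simple_extension_is_subring[OF subfieldE(1)[OF E] s(1)] .
  show "line_extension E s E \<subseteq> simple_extension E s"
  proof
    fix x assume "x \<in> line_extension E s E"
    then obtain u v where "u \<in> E" "v \<in> E" "x = u \<otimes> s \<oplus> v"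
      unfolding line_extension_mem_iff by auto
    then show "x \<in> simple_extension E s"
      using simple_extension_incl[OF subfieldE(3)[OF E] s(1)] simple_extension.lin by auto
  qed
  show "simple_extension E s \<subseteq> line_extension E s E"
  proof
    fix x assume "x \<in> simple_extension E s"
    then show "x \<in> line_extension E s E"
    proof (induction rule: simple_extension.induct)
      case zero
      have "\<zero> = \<zero> \<otimes> s \<oplus> \<zero>" using s(1) by simp
      then show ?case unfolding line_extension_mem_iff using subringE(2)[OF subfieldE(1)[OF E]] by blast
    next
      case (lin x k)
      then obtain u v where uv: "u \<in> E" "v \<in> E" "x = u \<otimes> s \<oplus> v"
        unfolding line_extension_mem_iff by auto
      have c: "u \<in> carrier R" "v \<in> carrier R" "k \<in> carrier R"
        using uv lin(2) subfieldE(3)[OF E] by auto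
      have "x \<otimes> s \<oplus> k = v \<otimes> s \<oplus> (u \<otimes> (s \<otimes> s) \<oplus> k)"
        unfolding uv(3) using c s(1) by algebra
      moreover have "u \<otimes> (s \<otimes> s) \<oplus> k \<in> E"
        using subringE(6,7)[OF subfieldE(1)[OF E]] uv s lin(2) by auto
      ultimately show ?case unfolding line_extension_mem_iff using uv by blast
    qed
  qed
qed

lemma square_root_algebraic:
  assumes E: "subfield E R" and s: "s \<in> carrier R" "s \<otimes> s \<in> E"
  shows "(algebraic over E) s"
proof (rule algebraicI)
  show "[\<one>, \<zero>, \<ominus> (s \<otimes> s)] \<in> carrier (E[X])"
    unfolding univ_poly_carrier[symmetric] polynomial_def
    using subringE(2,3,5)[OF subfieldE(1)[OF E]] s by auto
  show "eval [\<one>, \<zero>, \<ominus> (s \<otimes> s)] s = \<zero>"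
    using s(1) by (simp add: numeral_2_eq_2 r_neg)
qed auto

lemma quadratic_extension_subfield:
  assumes "subfield E R" "s \<in> carrier R" "s \<otimes> s \<in> E"
  shows "subfield (line_extension E s E) R"
  using simple_extension_is_subfield[of E s] square_root_algebraic assms quadratic_extension_eq by auto

lemma quadratic_extension_incl:
  assumes "subfield E R" "s \<in> carrier R" "s \<otimes> s \<in> E"
  shows "E \<subseteq> line_extension E s E" "s \<in> line_extension E s E"
  using simple_extension_incl[OF subfieldE(3)] simple_extension_mem[OF subfieldE(1)] assms
  by (auto simp: quadratic_extension_eq)

lemma quadratic_extension_minimal:
  assumes "subring M R" "E \<subseteq> M" "s \<in> M"
  shows "line_extension E s E \<subseteq> M"
  using subringE(6,7)[OF assms(1)] assms(2,3) unfolding line_extension_mem_iff subset_iff by blast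

lemma dimension_quadratic_extension:
  assumes E: "subfield E R" and s: "s \<in> carrier R" "s \<otimes> s \<in> E"
  shows "dimension (if s \<in> E then 1 else 2) E (line_extension E s E)"
proof (cases "s \<in> E")
  case True
  have "line_extension E s E = E"
    using quadratic_extension_minimal[OF subfieldE(1)[OF E] subset_refl True]
      quadratic_extension_incl(1)[OF E s] by auto
  then show ?thesis using True dimension_one[OF E] by simp
next
  case False
  then show ?thesis using Suc_dim[OF s(1) False dimension_one[OF E]] by (simp add: numeral_2_eq_2)
qed

text \<open>A step may be trivial: s is allowed to lie in E already. The counter is the number of
  adjoined roots and bounds the exponent of the degree, so roots can be adjoined without deciding
  whether they are new.\<close>

inductive quadratic_tower :: "'a set \<Rightarrow> nat \<Rightarrow> 'a set \<Rightarrow> bool" for F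
  where
    tower_base: "quadratic_tower F 0 F"
  | tower_step: "\<lbrakk>quadratic_tower F n E; s \<in> carrier R; s \<otimes> s \<in> E\<rbrakk>
      \<Longrightarrow> quadratic_tower F (Suc n) (line_extension E s E)"

lemma quadratic_tower_subfield:
  assumes "quadratic_tower F n E" "subfield F R"
  shows "subfield E R" "F \<subseteq> E"
  using assms by (induction) (auto intro: quadratic_extension_subfield dest: quadratic_extension_incl)

lemma quadratic_tower_dimension:
  assumes "quadratic_tower F n E" "subfield F R"
  shows "\<exists>k\<le>n. dimension (2 ^ k) F E"
  using assms
proof (induction)
  case tower_base
  then show ?case using dimension_one[of F] by auto
next
  case (tower_step n E s)
  then obtain k where k: "k \<le> n" "dimension (2 ^ k) F E" by auto
  have E: "subfield E R" using quadratic_tower_subfield tower_step by auto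
  have "dimension (2 ^ k * (if s \<in> E then 1 else 2)) F (line_extension E s E)"
    using telescopic_base[OF tower_step(5) E k(2)]
      dimension_quadratic_extension[OF E tower_step(2,3)] .
  moreover have "2 ^ k * (if s \<in> E then 1 else 2::nat) = 2 ^ (if s \<in> E then k else Suc k)" by simp
  ultimately have "dimension (2 ^ (if s \<in> E then k else Suc k)) F (line_extension E s E)" by metis
  then show ?case using k(1) by (intro exI[of _ "if s \<in> E then k else Suc k"]) auto
qed

lemma quadratic_tower_trans:
  assumes "quadratic_tower E n N" "quadratic_tower F m E"
  shows "quadratic_tower F (m + n) N"
  using assms by (induction) (auto intro: tower_step)

text \<open>The last clause, that N is generated as a ring by E and S, is what makes a homomorphism
  controllable on N: it suffices to know where E and S go.\<close>

lemma quadratic_tower_adjoin_set: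
  assumes E: "subfield E R" and "finite S" "S \<subseteq> carrier R" "\<And>s. s \<in> S \<Longrightarrow> s \<otimes> s \<in> E"
  shows "\<exists>n N. quadratic_tower E n N \<and> S \<subseteq> N \<and> (\<forall>M. subring M R \<longrightarrow> E \<union> S \<subseteq> M \<longrightarrow> N \<subseteq> M)"
  using assms(2-4)
proof (induction S)
  case empty
  then show ?case using tower_base by auto
next
  case (insert s S)
  then obtain n N where N: "quadratic_tower E n N" "S \<subseteq> N"
    and min: "\<And>M. \<lbrakk>subring M R; E \<union> S \<subseteq> M\<rbrakk> \<Longrightarrow> N \<subseteq> M" by auto
  have sub: "subfield N R" "E \<subseteq> N" using quadratic_tower_subfield[OF N(1) E] by auto
  have s: "s \<in> carrier R" "s \<otimes> s \<in> N" using insert(4,5) sub by auto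
  have "quadratic_tower E (Suc n) (line_extension N s N)" using tower_step[OF N(1) s] .
  moreover have "insert s S \<subseteq> line_extension N s N"
    using quadratic_extension_incl[OF sub(1) s] N(2) by auto
  moreover have "line_extension N s N \<subseteq> M" if "subring M R" "E \<union> insert s S \<subseteq> M" for M
    using quadratic_extension_minimal[OF that(1)] min[OF that(1)] that(2) by auto
  ultimately show ?case by blast
qed

section \<open>Extending field homomorphisms along towers\<close>

lemma hom_subring_simps:
  assumes "\<phi> \<in> ring_hom (R\<lparr>carrier := A\<rparr>) R"
  shows "\<And>x. x \<in> A \<Longrightarrow> \<phi> x \<in> carrier R"
    "\<And>x y. \<lbrakk>x \<in> A; y \<in> A\<rbrakk> \<Longrightarrow> \<phi> (x \<otimes> y) = \<phi> x \<otimes> \<phi> y"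
    "\<And>x y. \<lbrakk>x \<in> A; y \<in> A\<rbrakk> \<Longrightarrow> \<phi> (x \<oplus> y) = \<phi> x \<oplus> \<phi> y"
    "\<phi> \<one> = \<one>"
  using ring_hom_memE[OF assms] by auto

lemma hom_subring_zero:
  assumes "\<phi> \<in> ring_hom (R\<lparr>carrier := A\<rparr>) R" "subring A R"
  shows "\<phi> \<zero> = \<zero>"
proof -
  note h = hom_subring_simps[OF assms(1)]
  have z: "\<zero> \<in> A" using subringE(2)[OF assms(2)] .
  have "\<phi> \<zero> \<oplus> \<phi> \<zero> = \<phi> \<zero>" using h(3)[OF z z] by simp
  then show ?thesis using h(1)[OF z] by (simp add: add.l_cancel_one)
qed

lemma hom_subring_minus:
  assumes h: "\<phi> \<in> ring_hom (R\<lparr>carrier := A\<rparr>) R" and A: "subring A R" and "x \<in> A"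
  shows "\<phi> (\<ominus> x) = \<ominus> \<phi> x"
proof -
  have m: "\<ominus> x \<in> A" "x \<in> carrier R" using subringE(1,5)[OF A] assms(3) by auto
  have "\<phi> (\<ominus> x) \<oplus> \<phi> x = \<phi> (\<ominus> x \<oplus> x)" using hom_subring_simps(3)[OF h m(1) assms(3)] by simp
  also have "\<dots> = \<zero>" using m hom_subring_zero[OF h A] by (simp add: l_neg)
  finally show ?thesis using m hom_subring_simps(1)[OF h] assms(3)
    by (metis minus_equality)
qed

text \<open>The extension is u s + v |-> \<phi>(u) t + \<phi>(v): the coefficients are unique when s
  \<notin> A, and t^2 = \<phi>(s^2) makes the map multiplicative. If s \<in> A, the map \<phi>
  itself serves; then \<phi>(s) is t or -t, which is why the value at s is left out of the
  conclusion.\<close>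

lemma extend_hom_quadratic:
  assumes A: "subfield A R" and h: "\<phi> \<in> ring_hom (R\<lparr>carrier := A\<rparr>) R"
    and s: "s \<in> carrier R" "s \<otimes> s \<in> A"
    and t: "t \<in> carrier R" "t \<otimes> t = \<phi> (s \<otimes> s)"
  shows "\<exists>\<tau> \<in> ring_hom (R\<lparr>carrier := line_extension A s A\<rparr>) R. \<forall>x\<in>A. \<tau> x = \<phi> x"
proof (cases "s \<in> A")
  case True
  have "line_extension A s A = A"
    using quadratic_extension_minimal[OF subfieldE(1)[OF A] subset_refl True]
      quadratic_extension_incl(1)[OF A s] by auto
  then show ?thesis using h by auto
next
  case False
  have Asub: "A \<subseteq> carrier R" using subfieldE(3)[OF A] .
  have Ar: "subring A R" using subfieldE(1)[OF A] .
  note sh = hom_subring_simps[OF h]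
  have uniq: "u = u' \<and> v = v'" if "u \<in> A" "v \<in> A" "u' \<in> A" "v' \<in> A"
    and eq: "u \<otimes> s \<oplus> v = u' \<otimes> s \<oplus> v'" for u v u' v'
  proof -
    have c[simp]: "u \<in> carrier R" "v \<in> carrier R" "u' \<in> carrier R" "v' \<in> carrier R"
      using that Asub by auto
    have d: "(u \<ominus> u') \<otimes> s = v' \<ominus> v"
    proof -
      have "(u \<ominus> u') \<otimes> s = (u \<otimes> s \<oplus> v) \<ominus> v \<ominus> u' \<otimes> s" using s c by algebra
      also have "\<dots> = v' \<ominus> v" unfolding eq using s c by algebra
      finally show ?thesis .
    qed
    have "u \<ominus> u' = \<zero>"
    proof (rule ccontr)
      assume n: "u \<ominus> u' \<noteq> \<zero>"
      have m: "u \<ominus> u' \<in> A - {\<zero>}"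
        using n that subringE(5,7)[OF Ar] by (simp add: a_minus_def)
      have "s = inv (u \<ominus> u') \<otimes> (v' \<ominus> v)"
      proof -
        have "u \<ominus> u' \<in> Units R" using n field_Units by simp
        then show ?thesis unfolding d[symmetric] using s by (simp add: m_assoc[symmetric])
      qed
      moreover have "v' \<ominus> v \<in> A" using that subringE(5,7)[OF Ar] by (simp add: a_minus_def)
      ultimately show False using False subfield_m_inv(1)[OF A m] subringE(6)[OF Ar] by auto
    qed
    then have u: "u = u'" by (simp add: r_right_minus_eq)
    then show ?thesis using eq s by auto
  qed
  define \<tau> where "\<tau> x = (THE y. \<exists>u\<in>A. \<exists>v\<in>A. x = u \<otimes> s \<oplus> v \<and> y = \<phi> u \<otimes> t \<oplus> \<phi> v)" for x
  have tau: "\<tau> (u \<otimes> s \<oplus> v) = \<phi> u \<otimes> t \<oplus> \<phi> v" if "u \<in> A" "v \<in> A" for u v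
    unfolding \<tau>_def using that uniq by (intro the_equality) blast+
  have z: "\<zero> \<in> A" "\<one> \<in> A" using subringE[OF Ar] by auto
  have tA: "\<tau> x = \<phi> x" if "x \<in> A" for x
  proof -
    have "x = \<zero> \<otimes> s \<oplus> x" using that Asub s by auto
    then have "\<tau> x = \<phi> \<zero> \<otimes> t \<oplus> \<phi> x" using tau[OF z(1) that] by simp
    then show ?thesis using hom_subring_zero[OF h Ar] t sh(1)[OF that] by simp
  qed
  have "\<tau> \<in> ring_hom (R\<lparr>carrier := line_extension A s A\<rparr>) R"
  proof (rule ring_hom_memI; simp)
    fix x assume "x \<in> line_extension A s A"
    then show "\<tau> x \<in> carrier R" using tau sh(1) t(1) unfolding line_extension_mem_iff by auto
  next
    fix x y assume "x \<in> line_extension A s A" "y \<in> line_extension A s A"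
    then obtain u v u' v' where A4: "u \<in> A" "v \<in> A" "u' \<in> A" "v' \<in> A"
      and xy: "x = u \<otimes> s \<oplus> v" "y = u' \<otimes> s \<oplus> v'"
      unfolding line_extension_mem_iff by auto
    have c: "u \<in> carrier R" "v \<in> carrier R" "u' \<in> carrier R" "v' \<in> carrier R"
      using A4 Asub by auto
    have c': "\<phi> u \<in> carrier R" "\<phi> v \<in> carrier R" "\<phi> u' \<in> carrier R" "\<phi> v' \<in> carrier R"
      using A4 sh(1) by auto
    note cl = subringE(6,7)[OF Ar]
    have "x \<oplus> y = (u \<oplus> u') \<otimes> s \<oplus> (v \<oplus> v')" unfolding xy using c s by algebra
    then have "\<tau> (x \<oplus> y) = \<phi> (u \<oplus> u') \<otimes> t \<oplus> \<phi> (v \<oplus> v')" using tau A4 cl by simp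
    also have "\<dots> = (\<phi> u \<otimes> t \<oplus> \<phi> v) \<oplus> (\<phi> u' \<otimes> t \<oplus> \<phi> v')"
      unfolding sh(3)[OF A4(1,3)] sh(3)[OF A4(2,4)] using c' t(1) by algebra
    finally show "\<tau> (x \<oplus> y) = \<tau> x \<oplus> \<tau> y" unfolding xy using tau A4 by simp
    have "x \<otimes> y = (u \<otimes> v' \<oplus> v \<otimes> u') \<otimes> s \<oplus> (u \<otimes> u' \<otimes> (s \<otimes> s) \<oplus> v \<otimes> v')"
      unfolding xy using c s by algebra
    then have "\<tau> (x \<otimes> y) = \<phi> (u \<otimes> v' \<oplus> v \<otimes> u') \<otimes> t \<oplus> \<phi> (u \<otimes> u' \<otimes> (s \<otimes> s) \<oplus> v \<otimes> v')"
      using tau A4 cl s by simp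
    also have "\<dots> = (\<phi> u \<otimes> \<phi> v' \<oplus> \<phi> v \<otimes> \<phi> u') \<otimes> t \<oplus> (\<phi> u \<otimes> \<phi> u' \<otimes> (t \<otimes> t) \<oplus> \<phi> v \<otimes> \<phi> v')"
      using A4 cl s by (simp add: sh t(2))
    also have "\<dots> = (\<phi> u \<otimes> t \<oplus> \<phi> v) \<otimes> (\<phi> u' \<otimes> t \<oplus> \<phi> v')"
      using c' t(1) by algebra
    finally show "\<tau> (x \<otimes> y) = \<tau> x \<otimes> \<tau> y" unfolding xy using tau A4 by simp
  next
    show "\<tau> \<one> = \<one>" using tA[OF z(2)] sh(4) by simp
  qed
  then show ?thesis using tA by blast
qed

end

context algebraically_closed
begin

lemma exists_square_root:
  assumes "d \<in> carrier L"
  obtains t where "t \<in> carrier L" "t \<otimes> t = d"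
proof -
  let ?p = "[\<one>, \<zero>, \<ominus> d]"
  have p: "?p \<in> carrier (poly_ring L)"
    unfolding univ_poly_carrier[symmetric] polynomial_def using assms by auto
  then have "size (roots ?p) = 2" using roots_over_carrier[OF p] unfolding splitted_def by simp
  then obtain t where "t \<in># roots ?p" by (metis multiset_nonemptyE size_empty zero_neq_numeral)
  then have "is_root ?p t" using roots_mem_iff_is_root[OF p] by auto
  then have t: "t \<in> carrier L" "eval ?p t = \<zero>" unfolding is_root_def by auto
  have "t \<otimes> t \<ominus> d = \<zero>" using t assms by (simp add: numeral_2_eq_2 a_minus_def)
  then have "t \<otimes> t = d" by (rule diff_zeroI) (use t assms in auto)
  then show thesis using that t by auto
qed

text \<open>The roots that build N over F are adjoined to A instead, and A need not be comparable
  with N. At each step the image of s^2 has a square root in L, which is where algebraic closedness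
  enters.\<close>

lemma extend_hom_tower:
  assumes "quadratic_tower F n N" "subfield F L" "subfield A L" "F \<subseteq> A"
    and "\<phi> \<in> ring_hom (L\<lparr>carrier := A\<rparr>) L"
  shows "\<exists>B \<tau>. subfield B L \<and> A \<union> N \<subseteq> B \<and> \<tau> \<in> ring_hom (L\<lparr>carrier := B\<rparr>) L \<and> (\<forall>x\<in>A. \<tau> x = \<phi> x)"
  using assms(1)
proof (induction)
  case tower_base
  then show ?case using assms by auto
next
  case (tower_step n E s)
  then obtain B \<tau> where B: "subfield B L" "A \<union> E \<subseteq> B" "\<tau> \<in> ring_hom (L\<lparr>carrier := B\<rparr>) L"
    "\<forall>x\<in>A. \<tau> x = \<phi> x" by auto
  have s: "s \<in> carrier L" "s \<otimes> s \<in> B" using tower_step B by auto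
  obtain t where t: "t \<in> carrier L" "t \<otimes> t = \<tau> (s \<otimes> s)"
    using exists_square_root hom_subring_simps(1)[OF B(3) s(2)] by auto
  obtain \<rho> where r: "\<rho> \<in> ring_hom (L\<lparr>carrier := line_extension B s B\<rparr>) L" "\<forall>x\<in>B. \<rho> x = \<tau> x"
    using extend_hom_quadratic[OF B(1,3) s t] by auto
  have sub: "subfield (line_extension B s B) L" using quadratic_extension_subfield[OF B(1) s] .
  have inc: "B \<subseteq> line_extension B s B" "s \<in> line_extension B s B"
    by (rule quadratic_extension_incl[OF B(1) s])+
  have "line_extension E s E \<subseteq> line_extension B s B"
    by (rule quadratic_extension_minimal[OF subfieldE(1)[OF sub]]) (use inc B(2) in blast)+
  then show ?case using sub inc r B
    by (intro exI[of _ "line_extension B s B"] exI[of _ \<rho>]) auto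
qed

end

section \<open>Conjugate roots, formal derivatives and separability\<close>

context domain
begin

text \<open>The polynomial p is not assumed monic, so it need not equal \<open>Irr F x\<close>;
  irreducibility makes the two associated, and hence they have the same roots.\<close>

lemma conjugate_root_Irr:
  assumes F: "subfield F R" and p: "p \<in> carrier (F[X])" "pirreducible F p"
    and x: "x \<in> carrier R" "eval p x = \<zero>" and y: "y \<in> carrier R" "eval p y = \<zero>"
  shows "eval (Irr F x) y = \<zero>"
proof -
  have pn: "p \<noteq> []" using pirreducibleE(1)[OF subfieldE(1)[OF F] p] .
  have alg: "(algebraic over F) x" using algebraicI[OF p(1) pn x(2)] .
  note I = IrrE[OF F x(1) alg]
  have "Irr F x divides\<^bsub>F[X]\<^esub> p"
    using Irr_minimal[OF F x(1) alg p(1) x(2)] pdivides_iff_shell[OF F I(1) p(1)] by simp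
  then have "Irr F x \<in> Units (F[X]) \<or> Irr F x \<sim>\<^bsub>F[X]\<^esub> p"
    using divides_pirreducible_condition[OF p(2) I(1)] by auto
  then have "p divides\<^bsub>F[X]\<^esub> Irr F x"
    using pirreducibleE(2)[OF subfieldE(1)[OF F] I(1,2)] unfolding associated_def by auto
  then have "p pdivides Irr F x" using pdivides_iff_shell[OF F p(1) I(1)] by simp
  then show ?thesis
    using pdivides_imp_root_sharing[OF _ _ y(1) y(2)] carrier_polynomial_shell[OF subfieldE(1)[OF F] p(1)]
    by auto
qed

text \<open>The map is q(x) |-> q(y) for polynomials q over F. It is well defined because q(x) =
  r(x) makes q - r a multiple of the minimal polynomial of x, which vanishes at y as well.\<close>

lemma exists_conjugation_hom:
  assumes F: "subfield F R" and p: "p \<in> carrier (F[X])" "pirreducible F p"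
    and x: "x \<in> carrier R" "eval p x = \<zero>" and y: "y \<in> carrier R" "eval p y = \<zero>"
  shows "\<exists>\<phi> \<in> ring_hom (R\<lparr>carrier := simple_extension F x\<rparr>) R. \<phi> x = y \<and> (\<forall>k\<in>F. \<phi> k = k)"
proof -
  have Fr: "subring F R" using subfieldE(1)[OF F] .
  have alg: "(algebraic over F) x"
    using algebraicI[OF p(1) _ x(2)] pirreducibleE(1)[OF Fr p] by auto
  interpret UP: domain "F[X]" using univ_poly_is_domain[OF Fr] .
  interpret Ex: ring_hom_ring "F[X]" R "\<lambda>q. eval q x" using eval_ring_hom[OF Fr x(1)] .
  interpret Ey: ring_hom_ring "F[X]" R "\<lambda>q. eval q y" using eval_ring_hom[OF Fr y(1)] .
  have img: "simple_extension F x = (\<lambda>q. eval q x) ` carrier (F[X])"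
    using simple_extension_as_eval_img[OF subringE(1)[OF Fr] x(1)] .
  have uniq: "eval q y = eval r y"
    if q: "q \<in> carrier (F[X])" and r: "r \<in> carrier (F[X])" and eq: "eval q x = eval r x" for q r
  proof -
    have d: "q \<ominus>\<^bsub>F[X]\<^esub> r \<in> carrier (F[X])" using q r by simp
    have "eval (q \<ominus>\<^bsub>F[X]\<^esub> r) x = eval q x \<ominus> eval r x" using q r by (simp add: a_minus_def)
    then have "eval (q \<ominus>\<^bsub>F[X]\<^esub> r) x = \<zero>" using eq Ex.hom_closed[OF r] by (simp add: r_neg a_minus_def)
    then have "Irr F x pdivides (q \<ominus>\<^bsub>F[X]\<^esub> r)" using Irr_minimal[OF F x(1) alg d] by simp
    then have "eval (q \<ominus>\<^bsub>F[X]\<^esub> r) y = \<zero>"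
      using pdivides_imp_root_sharing[OF _ _ y(1) conjugate_root_Irr[OF F p x y]]
        carrier_polynomial_shell[OF Fr IrrE(1)[OF F x(1) alg]] by auto
    then have "eval q y \<ominus> eval r y = \<zero>" using q r by (simp add: a_minus_def)
    then show ?thesis using Ey.hom_closed[OF q] Ey.hom_closed[OF r] by simp
  qed
  define \<phi> where "\<phi> z = (THE w. \<exists>q\<in>carrier (F[X]). z = eval q x \<and> w = eval q y)" for z
  have phi: "\<phi> (eval q x) = eval q y" if "q \<in> carrier (F[X])" for q
    unfolding \<phi>_def
  proof (rule the_equality)
    show "\<exists>r\<in>carrier (F[X]). eval q x = eval r x \<and> eval q y = eval r y" using that by blast
    fix w assume "\<exists>r\<in>carrier (F[X]). eval q x = eval r x \<and> w = eval r y"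
    then obtain r where r: "r \<in> carrier (F[X])" "eval q x = eval r x" "w = eval r y" by blast
    show "w = eval q y" unfolding r(3) using uniq[OF that r(1,2)] by simp
  qed
  have "\<phi> \<in> ring_hom (R\<lparr>carrier := simple_extension F x\<rparr>) R"
  proof (rule ring_hom_memI; simp)
    fix z assume "z \<in> simple_extension F x"
    then show "\<phi> z \<in> carrier R" unfolding img using phi Ey.hom_closed by auto
  next
    fix z w assume "z \<in> simple_extension F x" "w \<in> simple_extension F x"
    then obtain q r where qr: "q \<in> carrier (F[X])" "r \<in> carrier (F[X])" "z = eval q x" "w = eval r x"
      unfolding img by auto
    show "\<phi> (z \<otimes> w) = \<phi> z \<otimes> \<phi> w"
      unfolding qr(3,4) Ex.hom_mult[OF qr(1,2), symmetric] phi[OF UP.m_closed[OF qr(1,2)]]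
        phi[OF qr(1)] phi[OF qr(2)] Ey.hom_mult[OF qr(1,2)] ..
    show "\<phi> (z \<oplus> w) = \<phi> z \<oplus> \<phi> w"
      unfolding qr(3,4) Ex.hom_add[OF qr(1,2), symmetric] phi[OF UP.a_closed[OF qr(1,2)]]
        phi[OF qr(1)] phi[OF qr(2)] Ey.hom_add[OF qr(1,2)] ..
  next
    show "\<phi> \<one> = \<one>" using phi[OF UP.one_closed] Ex.hom_one Ey.hom_one by simp
  qed
  moreover have "\<phi> x = y"
    using phi[OF var_closed(1)[OF Fr]] eval_var x(1) y(1) by simp
  moreover have "\<phi> k = k" if "k \<in> F" for k
  proof (cases "k = \<zero>")
    case True
    then show ?thesis using phi[OF UP.zero_closed] Ex.hom_zero Ey.hom_zero by simp
  next
    case False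
    have kc: "k \<in> carrier R" using that subringE(1)[OF Fr] by auto
    have "[k] \<in> carrier (F[X])"
      unfolding univ_poly_carrier[symmetric] using that False by auto
    from phi[OF this] show ?thesis using kc x(1) y(1) by simp
  qed
  ultimately show ?thesis by blast
qed

text \<open>The leading coefficient comes first, so the head of a # p has degree
  \<open>length p\<close>. Leading zeros are kept, and in positive characteristic they can arise;
  hence the rules below are stated for values at a point rather than for polynomials.\<close>

fun derivative :: "'a list \<Rightarrow> 'a list"
  where
    "derivative [] = []"
  | "derivative (a # p) = (if p = [] then [] else ([length p] \<cdot> a) # derivative p)"

lemma derivative_closed:
  assumes "set p \<subseteq> carrier R" shows "set (derivative p) \<subseteq> carrier R"
  using assms by (induction p) auto

lemma derivative_in_subring:
  assumes "subring F R" "set p \<subseteq> F" shows "set (derivative p) \<subseteq> F"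
proof -
  have "[n] \<cdot> a \<in> F" if "a \<in> F" for a and n :: nat
    by (induction n) (use that subringE(1,2,7)[OF assms(1)] in \<open>auto simp: subsetD\<close>)
  then show ?thesis using assms(2) by (induction p) auto
qed

lemma length_derivative [simp]: "length (derivative p) = length p - 1"
  by (induction p) auto

lemma eval_derivative_Cons:
  assumes "set (a # p) \<subseteq> carrier R" "y \<in> carrier R"
  shows "eval (derivative (a # p)) y =
    ([length p] \<cdot> a) \<otimes> y [^] (length p - 1) \<oplus> eval (derivative p) y"
  using assms by auto

lemma eval_derivative_closed:
  assumes "set p \<subseteq> carrier R" "y \<in> carrier R"
  shows "eval (derivative p) y \<in> carrier R"
  using assms derivative_closed eval_in_carrier by blast

text \<open>Sums of lists of different length are formed by padding with leading zeros, and
  normalisation removes such zeros; this invariance reduces both to the case of equal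
  length.\<close>

lemma eval_derivative_replicate:
  assumes "set p \<subseteq> carrier R" "y \<in> carrier R"
  shows "eval (derivative (replicate n \<zero> @ p)) y = eval (derivative p) y"
proof (induction n)
  case (Suc n)
  have "set (replicate n \<zero> @ p) \<subseteq> carrier R" using assms by auto
  then show ?case
    using eval_derivative_Cons[of \<zero> "replicate n \<zero> @ p" y] Suc assms
      eval_derivative_closed[OF assms] by (simp del: derivative.simps)
qed simp

lemma eval_derivative_normalize:
  assumes "set p \<subseteq> carrier R" "y \<in> carrier R"
  shows "eval (derivative (normalize p)) y = eval (derivative p) y"
  using eval_derivative_replicate[OF normalize_in_carrier[OF assms(1)] assms(2)] normalize_def'[of p]
  by metis

lemma set_map2_add_closed:
  "\<lbrakk>set p \<subseteq> carrier R; set q \<subseteq> carrier R\<rbrakk> \<Longrightarrow> set (map2 (\<oplus>) p q) \<subseteq> carrier R"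
  by (fastforce dest: set_zip_leftD set_zip_rightD)

lemma eval_derivative_map2:
  assumes "length p = length q" "set p \<subseteq> carrier R" "set q \<subseteq> carrier R" "y \<in> carrier R"
  shows "eval (derivative (map2 (\<oplus>) p q)) y = eval (derivative p) y \<oplus> eval (derivative q) y"
  using assms
proof (induction p q rule: list_induct2)
  case (Cons a p b q)
  have c: "a \<in> carrier R" "b \<in> carrier R" "set p \<subseteq> carrier R" "set q \<subseteq> carrier R"
    using Cons by auto
  have m: "set (map2 (\<oplus>) p q) \<subseteq> carrier R" by (rule set_map2_add_closed[OF c(3,4)])
  note d = eval_derivative_closed[OF c(3) Cons(5)] eval_derivative_closed[OF c(4) Cons(5)]
  have n: "[length q] \<cdot> (a \<oplus> b) = [length q] \<cdot> a \<oplus> [length q] \<cdot> b"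
    using c by (simp add: add.nat_pow_distrib)
  have "eval (derivative (map2 (\<oplus>) (a # p) (b # q))) y
    = ([length q] \<cdot> (a \<oplus> b)) \<otimes> y [^] (length q - 1) \<oplus> (eval (derivative p) y \<oplus> eval (derivative q) y)"
    using eval_derivative_Cons[of "a \<oplus> b" "map2 (\<oplus>) p q" y] Cons(1,2,5) c m
    by (simp del: derivative.simps)
  also have "\<dots> = (([length q] \<cdot> a) \<otimes> y [^] (length q - 1) \<oplus> eval (derivative p) y)
     \<oplus> (([length q] \<cdot> b) \<otimes> y [^] (length q - 1) \<oplus> eval (derivative q) y)"
    unfolding n using c d Cons(5) by (simp add: l_distr a_ac)
  finally show ?case
    using eval_derivative_Cons[of a p y] eval_derivative_Cons[of b q y] Cons(1,5) c
    by (simp del: derivative.simps)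
qed simp

lemma eval_derivative_add:
  assumes "set p \<subseteq> carrier R" "set q \<subseteq> carrier R" "y \<in> carrier R"
  shows "eval (derivative (poly_add p q)) y = eval (derivative p) y \<oplus> eval (derivative q) y"
proof -
  have *: "eval (derivative (poly_add p q)) y = eval (derivative p) y \<oplus> eval (derivative q) y"
    if "length q \<le> length p" "set p \<subseteq> carrier R" "set q \<subseteq> carrier R" for p q
  proof -
    let ?q = "replicate (length p - length q) \<zero> @ q"
    have q: "set ?q \<subseteq> carrier R" "length p = length ?q" using that by auto
    have m: "set (map2 (\<oplus>) p ?q) \<subseteq> carrier R" by (rule set_map2_add_closed[OF that(2) q(1)])
    show ?thesis
      using that(1) eval_derivative_normalize[OF m assms(3)] eval_derivative_map2[OF q(2) that(2) q(1) assms(3)]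
        eval_derivative_replicate[OF that(3) assms(3)] by simp
  qed
  show ?thesis
  proof (cases "length q \<le> length p")
    case False
    then have "poly_add p q = poly_add q p" by simp
    then show ?thesis using *[of p q] False assms eval_derivative_closed a_comm by (metis "*" nat_le_linear)
  qed (use * assms in auto)
qed

lemma eval_derivative_scale:
  assumes "set p \<subseteq> carrier R" "y \<in> carrier R" "c \<in> carrier R"
  shows "eval (derivative (map ((\<otimes>) c) p)) y = c \<otimes> eval (derivative p) y"
  using assms(1)
proof (induction p)
  case (Cons a p)
  have s: "set p \<subseteq> carrier R" "a \<in> carrier R" "set (map ((\<otimes>) c) p) \<subseteq> carrier R" using Cons assms by auto
  note d = eval_derivative_closed[OF s(1) assms(2)]
  have n: "[length p] \<cdot> (c \<otimes> a) = c \<otimes> ([length p] \<cdot> a)"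
    using add_pow_rdistr[OF assms(3) s(2)] by simp
  have "eval (derivative (map ((\<otimes>) c) (a # p))) y
     = (c \<otimes> ([length p] \<cdot> a)) \<otimes> y [^] (length p - 1) \<oplus> c \<otimes> eval (derivative p) y"
    using eval_derivative_Cons[of "c \<otimes> a" "map ((\<otimes>) c) p" y] s assms Cons(1)[OF s(1)] n
    by (simp del: derivative.simps)
  also have "\<dots> = c \<otimes> (([length p] \<cdot> a) \<otimes> y [^] (length p - 1) \<oplus> eval (derivative p) y)"
    using s d assms by (simp add: r_distr m_assoc)
  finally show ?case using eval_derivative_Cons[of a p y] s assms by (simp del: derivative.simps)
qed (use assms in simp)

text \<open>Appending \<zero> multiplies by X, so this is the rule (X p)' = X p' + p at the point
  y.\<close>

lemma eval_derivative_shift: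
  assumes "set p \<subseteq> carrier R" "y \<in> carrier R"
  shows "eval (derivative (p @ [\<zero>])) y = y \<otimes> eval (derivative p) y \<oplus> eval p y"
  using assms(1)
proof (induction p)
  case (Cons a p)
  have s: "set p \<subseteq> carrier R" "a \<in> carrier R" using Cons assms by auto
  note d = eval_derivative_closed[OF s(1) assms(2)] eval_in_carrier[OF s(1) assms(2)]
  have m: "([length p] \<cdot> a) \<otimes> y [^] length p = y \<otimes> (([length p] \<cdot> a) \<otimes> y [^] (length p - 1))"
    using s assms by (cases "length p") (auto simp: m_ac simp del: add.nat_pow_Suc)
  have "eval (derivative ((a # p) @ [\<zero>])) y
    = ([length p] \<cdot> a \<oplus> a) \<otimes> y [^] length p \<oplus> (y \<otimes> eval (derivative p) y \<oplus> eval p y)"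
    using eval_derivative_Cons[of a "p @ [\<zero>]" y] s assms Cons(1)[OF s(1)]
    by (simp del: derivative.simps)
  also have "\<dots> = y \<otimes> (([length p] \<cdot> a) \<otimes> y [^] (length p - 1) \<oplus> eval (derivative p) y)
       \<oplus> (a \<otimes> y [^] length p \<oplus> eval p y)"
    using s d assms by (simp add: l_distr r_distr m a_ac)
  finally show ?case using eval_derivative_Cons[of a p y] s assms by (simp del: derivative.simps)
qed (use assms in simp)

text \<open>At y the term (X - y) g' of the product rule vanishes and leaves g(y). This is the case
  of the product rule from which multiple roots are read off.\<close>

lemma eval_derivative_linear_mult:
  assumes g: "set g \<subseteq> carrier R" and y: "y \<in> carrier R"
  shows "eval (derivative (poly_mult [\<one>, \<ominus> y] g)) y = eval g y"
proof -
  have one: "map ((\<otimes>) \<one>) g = g" using g by (induction g) auto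
  have sc: "set (map ((\<otimes>) (\<ominus> y)) g) \<subseteq> carrier R" using g y by auto
  have sh: "set (g @ [\<zero>]) \<subseteq> carrier R" using g by auto
  let ?h = "poly_add (map ((\<otimes>) (\<ominus> y)) g) []"
  have h: "set ?h \<subseteq> carrier R" using poly_add_in_carrier[OF sc, of "[]"] by simp
  have dh: "eval (derivative ?h) y = \<ominus> y \<otimes> eval (derivative g) y"
    using eval_derivative_add[OF sc _ y, of "[]"] eval_derivative_scale[OF g y] y
      eval_derivative_closed[OF g y] by (simp del: poly_add.simps)
  have "poly_mult [\<one>, \<ominus> y] g = poly_add (g @ [\<zero>]) ?h"
    using one by (simp del: poly_add.simps)
  then have "eval (derivative (poly_mult [\<one>, \<ominus> y] g)) y
     = (y \<otimes> eval (derivative g) y \<oplus> eval g y) \<oplus> \<ominus> y \<otimes> eval (derivative g) y"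
    using eval_derivative_add[OF sh h y] eval_derivative_shift[OF g y] dh by simp
  then show ?thesis using y eval_derivative_closed[OF g y] eval_in_carrier[OF g y] by algebra
qed

text \<open>If (X - y)^2 divides p, then p = (X - y) g with g(y) = 0.\<close>

lemma double_root_derivative:
  assumes p: "p \<in> carrier (poly_ring R)" and y: "y \<in> carrier R" and m: "alg_mult p y > 1"
  shows "eval (derivative p) y = \<zero>"
proof -
  interpret UP: domain "poly_ring R" using univ_poly_is_domain[OF carrier_is_subring] .
  let ?l = "[\<one>, \<ominus> y]"
  have l: "?l \<in> carrier (poly_ring R)"
    unfolding univ_poly_carrier[symmetric] polynomial_def using y by auto
  have "(?l [^]\<^bsub>poly_ring R\<^esub> (2::nat)) pdivides p"
    using le_alg_mult_imp_pdivides[OF y p, of 2] m by simp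
  then obtain r where r: "r \<in> carrier (poly_ring R)"
    "p = (?l [^]\<^bsub>poly_ring R\<^esub> (2::nat)) \<otimes>\<^bsub>poly_ring R\<^esub> r"
    unfolding pdivides_def factor_def by auto
  let ?g = "?l \<otimes>\<^bsub>poly_ring R\<^esub> r"
  have g: "?g \<in> carrier (poly_ring R)" using l r by simp
  have "p = ?l \<otimes>\<^bsub>poly_ring R\<^esub> ?g"
    unfolding r(2) numeral_2_eq_2 using l r(1) by (simp add: UP.m_assoc)
  then have "eval (derivative p) y = eval ?g y"
    using eval_derivative_linear_mult[OF _ y, of ?g] g
    by (simp add: univ_poly_mult univ_poly_carrier[symmetric] polynomial_incl)
  also have "\<dots> = eval ?l y \<otimes> eval r y"
    using ring_hom_memE(2)[OF eval_is_hom[OF carrier_is_subring y] l r(1)] .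
  also have "\<dots> = \<zero>"
    using y eval_poly_in_carrier[OF carrier_is_subring _ y, of r] r(1) by (simp add: univ_poly_carrier r_neg)
  finally show ?thesis .
qed

text \<open>The minimal polynomial is monic, so the leading coefficient of its derivative is the
  degree times 1. If this is nonzero, the derivative is a nonzero polynomial of smaller degree; at a
  multiple root y it would vanish, and the minimal polynomial would have to divide it.\<close>

lemma separable_of_degree:
  assumes F: "subfield F R" and x: "x \<in> carrier R" "(algebraic over F) x"
    and deg: "[degree (Irr F x)] \<cdot> \<one> \<noteq> \<zero>" and y: "y \<in> carrier R"
  shows "alg_mult (Irr F x) y \<le> 1"
proof (rule ccontr)
  assume m: "\<not> alg_mult (Irr F x) y \<le> 1"
  have Fr: "subring F R" using subfieldE(1)[OF F] .
  let ?p = "Irr F x"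
  note I = IrrE[OF F x]
  have pR: "?p \<in> carrier (poly_ring R)" using carrier_polynomial_shell[OF Fr I(1)] .
  have d0: "eval (derivative ?p) y = \<zero>" using double_root_derivative[OF pR y] m by auto
  have "is_root ?p y" using alg_mult_gt_zero_iff_is_root[OF pR, of y] m by auto
  then have r: "eval ?p y = \<zero>" unfolding is_root_def by auto
  have dp: "degree ?p \<ge> 1" using pirreducible_degree[OF F I(1,2)] .
  then obtain b q where bq: "?p = \<one> # b # q" using I(3)
    by (cases ?p; cases "tl ?p") auto
  let ?d = "derivative ?p"
  have "set ?p \<subseteq> F" using I(1) univ_poly_carrier[of R F] polynomial_incl by metis
  then have "set ?d \<subseteq> F" by (rule derivative_in_subring[OF Fr])
  moreover have "lead_coeff ?d \<noteq> \<zero>" using deg unfolding bq by simp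
  ultimately have dF: "?d \<in> carrier (F[X])" unfolding univ_poly_carrier[symmetric] polynomial_def by auto
  have dn: "?d \<noteq> []" unfolding bq by simp
  have pn: "?p \<noteq> []" unfolding bq by simp
  have alg: "(algebraic over F) y" using algebraicI[OF I(1) pn r] .
  \<comment> \<open>The root y of the monic irreducible polynomial has the same minimal polynomial
    as x, so minimality can be applied at y, where the derivative vanishes.\<close>
  have "Irr F y = ?p"
    using minimal_polynomial_is_unique[OF F y alg] IrrE[OF F y alg] I r by metis
  then have "?p pdivides ?d" using Irr_minimal[OF F y alg dF d0] by simp
  then have "degree ?p \<le> degree ?d" using pdivides_imp_degree_le[OF Fr I(1) dF dn] by simp
  then show False using dp by simp
qed

end

section \<open>Intermediate fields of extensions of 2-power degree\<close>

context field
begin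

lemma eval_hom_subfield:
  assumes B: "subring B R" and h: "\<phi> \<in> ring_hom (R\<lparr>carrier := B\<rparr>) R"
    and F: "F \<subseteq> B" "\<And>k. k \<in> F \<Longrightarrow> \<phi> k = k" and q: "set q \<subseteq> F" and z: "z \<in> B"
  shows "eval q z \<in> B" "\<phi> (eval q z) = eval q (\<phi> z)"
proof -
  note sh = hom_subring_simps[OF h]
  have pow: "z [^] n \<in> B \<and> \<phi> (z [^] n) = \<phi> z [^] n" for n :: nat
    by (induction n) (use z sh subringE[OF B] in auto)
  have "eval q z \<in> B \<and> \<phi> (eval q z) = eval q (\<phi> z)" using q
  proof (induction q)
    case Nil
    then show ?case using hom_subring_zero[OF h B] subringE(2)[OF B] by simp
  next
    case (Cons a q)
    have a: "a \<in> B" "\<phi> a = a" using Cons(2) F by auto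
    have t: "a \<otimes> z [^] length q \<in> B" using a pow subringE(6)[OF B] by auto
    show ?case using Cons a pow t sh(2)[OF a(1), of "z [^] length q"] sh(3)[OF t, of "eval q z"]
        subringE(7)[OF B] by simp
  qed
  then show "eval q z \<in> B" "\<phi> (eval q z) = eval q (\<phi> z)" by auto
qed

lemma finite_square_roots: "finite {t \<in> carrier R. t \<otimes> t = r}" if "r \<in> carrier R"
proof -
  let ?p = "[\<one>, \<zero>, \<ominus> r]"
  have "?p \<in> carrier (poly_ring R)"
    unfolding univ_poly_carrier[symmetric] polynomial_def using that by auto
  then have "finite {t. is_root ?p t}" by (rule finite_number_of_roots)
  moreover have "{t \<in> carrier R. t \<otimes> t = r} \<subseteq> {t. is_root ?p t}"
    using that unfolding is_root_def by (auto simp: numeral_2_eq_2 r_neg)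
  ultimately show ?thesis using finite_subset by blast
qed

lemma set_subset_of_poly: "p \<in> carrier (F[X]) \<Longrightarrow> set p \<subseteq> F"
  using univ_poly_carrier polynomial_incl by metis

text \<open>A list spanning N over F also spans N over A, so both degrees in F \<subseteq> A
  \<subseteq> N are finite and the degree formula applies.\<close>

lemma finite_dimension_upper:
  assumes F: "subfield F R" and A: "subfield A R" "F \<subseteq> A" and N: "subfield N R" "A \<subseteq> N"
    and d: "dimension n F N"
  shows "\<exists>m k. dimension m F A \<and> n = m * k"
proof -
  have "subalgebra F A R"
  proof (unfold_locales)
    show "A \<subseteq> carrier (add_monoid R)" using subfieldE(3)[OF A(1)] by simp
  qed (use subringE[OF subfieldE(1)[OF A(1)]] A(2) in \<open>auto simp: a_inv_def[symmetric]\<close>)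
  then have fA: "finite_dimension F A"
    using subalbegra_incl_imp_finite_dimension[OF F finite_dimensionI[OF d] _ N(2)] by simp
  obtain Us where Us: "set Us \<subseteq> carrier R" "Span F Us = N" using exists_base[OF F d] by auto
  have UsN: "set Us \<subseteq> N" using Span_base_incl[OF F Us(1)] Us(2) by simp
  have "subalgebra A N R"
  proof (unfold_locales)
    show "N \<subseteq> carrier (add_monoid R)" using subfieldE(3)[OF N(1)] by simp
  qed (use subringE[OF subfieldE(1)[OF N(1)]] N(2) in \<open>auto simp: a_inv_def[symmetric]\<close>)
  then have "Span A Us \<subseteq> N" using subalgebra_Span_incl[OF A(1) _ UsN] by simp
  moreover have "N \<subseteq> Span A Us"
  proof
    fix x assume "x \<in> N"
    then obtain Ks where "set Ks \<subseteq> F" "x = combine Ks Us"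
      using Span_eq_combine_set[OF F Us(1)] Us(2) by auto
    then show "x \<in> Span A Us" using Span_eq_combine_set[OF A(1) Us(1)] A(2) by auto
  qed
  ultimately have "finite_dimension A N" using Span_finite_dimension[OF A(1) Us(1)] by simp
  then have "(dim over F) N = (dim over F) A * (dim over A) N"
    using telescopic_base_dim(2)[OF F A(1) fA] by simp
  moreover have "(dim over F) N = n" using dimI[OF F d] .
  ultimately show ?thesis using finite_dimensionE[OF F fA] by auto
qed

lemma two_power_subfield:
  assumes "subfield F R" "subfield A R" "F \<subseteq> A" "subfield N R" "A \<subseteq> N" "dimension (2 ^ k) F N"
  shows "\<exists>j. dimension (2 ^ j) F A"
proof -
  obtain m l where "dimension m F A" "2 ^ k = m * l" using finite_dimension_upper[OF assms] by auto
  moreover from this have "m dvd 2 ^ k" by simp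
  ultimately show ?thesis using divides_primepow_nat[OF two_is_prime_nat, of m k] by auto
qed

text \<open>For a degree 2^j this rewrites the multiple of 1 in the separability criterion as a
  power of \<one> \<oplus> \<one>, which is nonzero in a field where 2 is.\<close>

lemma add_pow_two_power: "[((2::nat) ^ j)] \<cdot> \<one> = (\<one> \<oplus> \<one>) [^] j"
proof (induction j)
  case (Suc j)
  have "[((2::nat) ^ Suc j)] \<cdot> \<one> = [((2::nat) ^ j)] \<cdot> \<one> \<oplus> [((2::nat) ^ j)] \<cdot> \<one>"
    by (simp add: add.nat_pow_mult mult_2)
  also have "\<dots> = (\<one> \<oplus> \<one>) [^] j \<otimes> (\<one> \<oplus> \<one>)" unfolding Suc by (simp add: r_distr)
  finally show ?case by simp
qed simp

end

section \<open>Normal towers and 2-extensions\<close>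

context algebraically_closed
begin

text \<open>A conjugation homomorphism fixes F pointwise, so a root in F of an irreducible
  polynomial is its only root.\<close>

lemma normal_extension_refl:
  assumes F: "subfield F L" shows "normal_extension L F F"
  unfolding normal_extension_def
proof (intro conjI ballI impI)
  fix p x y assume p: "p \<in> carrier (F[X])" "pirreducible F p" and "\<exists>x\<in>F. eval p x = \<zero>"
    and y: "y \<in> carrier L" "eval p y = \<zero>"
  then obtain x where x: "x \<in> F" "eval p x = \<zero>" by auto
  have xc: "x \<in> carrier L" using x subfieldE(3)[OF F] by auto
  obtain \<phi> where "\<phi> x = y" "\<forall>k\<in>F. \<phi> k = k"
    using exists_conjugation_hom[OF F p xc x(2) y] by auto
  then show "y \<in> F" using x by auto
next
  fix x assume "x \<in> F"
  then show "algebraic F x" using algebraic_self[OF subfieldE(1)[OF F]] unfolding over_def by auto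
qed (use F in auto)

text \<open>Adjoining s alone may destroy normality, so all square roots of all conjugates of s^2
  are adjoined together. To see that the result N' is normal, a conjugation x |-> y is extended to a
  homomorphism defined on N'. It maps N into N because N is normal, and it maps the adjoined set
  into itself because it fixes the coefficients of the minimal polynomial of s^2. Hence it maps N'
  into N', and y lies in N'.\<close>

lemma normal_extension_adjoin_square_root:
  assumes F: "subfield F L" and tower: "quadratic_tower F m N" and nN: "normal_extension L F N"
    and s: "s \<in> carrier L" "s \<otimes> s \<in> N"
  shows "\<exists>k N'. quadratic_tower F k N' \<and> N \<subseteq> N' \<and> s \<in> N' \<and> normal_extension L F N'"
proof -
  have N: "subfield N L" "F \<subseteq> N" using quadratic_tower_subfield[OF tower F] by auto
  have Nc: "N \<subseteq> carrier L" using subfieldE(3)[OF N(1)] .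
  have conj: "y \<in> N" if "p \<in> carrier (F[X])" "pirreducible F p" "x \<in> N" "eval p x = \<zero>"
    "y \<in> carrier L" "eval p y = \<zero>" for p x y
    using nN that unfolding normal_extension_def by blast
  have algN: "(algebraic over F) x" if "x \<in> N" for x
    using nN that unfolding normal_extension_def over_def by blast
  define h where "h = Irr F (s \<otimes> s)"
  have dc: "s \<otimes> s \<in> carrier L" using s by auto
  note h = IrrE[OF F dc algN[OF s(2)], folded h_def]
  have hL: "h \<in> carrier (poly_ring L)" using carrier_polynomial_shell[OF subfieldE(1)[OF F] h(1)] .
  have hn: "h \<noteq> []" using pirreducibleE(1)[OF subfieldE(1)[OF F] h(1,2)] .
  \<comment> \<open>The roots of h(T^2), where h is the minimal polynomial of s^2 over F.\<close>
  define S where "S = {t \<in> carrier L. eval h (t \<otimes> t) = \<zero>}"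
  have "S \<subseteq> (\<Union>r\<in>{r. is_root h r}. {t \<in> carrier L. t \<otimes> t = r})"
    unfolding S_def is_root_def using hn by auto
  moreover have "finite (\<Union>r\<in>{r. is_root h r}. {t \<in> carrier L. t \<otimes> t = r})"
    using finite_number_of_roots[OF hL] finite_square_roots by (auto simp: is_root_def)
  ultimately have fS: "finite S" using finite_subset by blast
  have Sc: "S \<subseteq> carrier L" unfolding S_def by auto
  \<comment> \<open>The square of t is a conjugate of s^2 \<in> N, so normality of N keeps it in
    N.\<close>
  have SN: "t \<otimes> t \<in> N" if "t \<in> S" for t
    by (rule conj[OF h(1,2) s(2) h(4)]) (use that in \<open>auto simp: S_def\<close>)
  obtain k N' where N': "quadratic_tower N k N'" "S \<subseteq> N'"
    and min: "\<And>M. \<lbrakk>subring M L; N \<union> S \<subseteq> M\<rbrakk> \<Longrightarrow> N' \<subseteq> M"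
    using quadratic_tower_adjoin_set[OF N(1) fS Sc SN] by auto
  have tower': "quadratic_tower F (m + k) N'" using quadratic_tower_trans[OF N'(1) tower] .
  have N's: "subfield N' L" "N \<subseteq> N'" using quadratic_tower_subfield[OF N'(1) N(1)] by auto
  have sS: "s \<in> S" unfolding S_def using s h(4) by auto
  have "normal_extension L F N'"
    unfolding normal_extension_def
  proof (intro conjI ballI impI)
    fix x assume "x \<in> N'"
    obtain d where "dimension d F N'" using quadratic_tower_dimension[OF tower' F] by auto
    then show "algebraic F x"
      using finite_dimension_imp_algebraic[OF F subfieldE(1)[OF N's(1)] finite_dimensionI \<open>x \<in> N'\<close>]
      unfolding over_def by auto
  next
    fix p y assume p: "p \<in> carrier (F[X])" "pirreducible F p" and "\<exists>x\<in>N'. eval p x = \<zero>"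
      and y: "y \<in> carrier L" "eval p y = \<zero>"
    then obtain x where x: "x \<in> N'" "eval p x = \<zero>" by auto
    have xc: "x \<in> carrier L" using x subfieldE(3)[OF N's(1)] by auto
    have pn: "p \<noteq> []" using pirreducibleE(1)[OF subfieldE(1)[OF F] p] .
    let ?A = "simple_extension F x"
    obtain \<phi> where phi: "\<phi> \<in> ring_hom (L\<lparr>carrier := ?A\<rparr>) L" "\<phi> x = y" "\<forall>k\<in>F. \<phi> k = k"
      using exists_conjugation_hom[OF F p xc x(2) y] by auto
    have A: "subfield ?A L" "F \<subseteq> ?A" "x \<in> ?A"
      using simple_extension_is_subfield[OF F xc] algebraicI[OF p(1) pn x(2)]
        simple_extension_incl[OF subfieldE(3)[OF F] xc] simple_extension_mem[OF subfieldE(1)[OF F] xc]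
      by auto
    \<comment> \<open>The conjugation is defined on F(x) only, while the argument needs its effect
      on all of N'.\<close>
    obtain B \<tau> where B: "subfield B L" "?A \<union> N' \<subseteq> B" and \<tau>: "\<tau> \<in> ring_hom (L\<lparr>carrier := B\<rparr>) L"
      and ext: "\<forall>x\<in>?A. \<tau> x = \<phi> x"
      using extend_hom_tower[OF tower' F A(1,2) phi(1)] by blast
    have Br: "subring B L" using subfieldE(1)[OF B(1)] .
    have FB: "F \<subseteq> B" using A(2) B(2) by auto
    have fixF: "\<tau> k = k" if "k \<in> F" for k using that ext phi(3) A(2) by auto
    note sh = hom_subring_simps[OF \<tau>]
    \<comment> \<open>The preimage of N' under \<tau>. Being a subring, it contains N' as soon as it
      contains N and S.\<close>
    define M where "M = {z \<in> B. \<tau> z \<in> N'}"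
    have N'r: "subring N' L" using subfieldE(1)[OF N's(1)] .
    have M: "subring M L"
    proof (rule subringI)
      show "M \<subseteq> carrier L" unfolding M_def using subringE(1)[OF Br] by auto
      show "\<one> \<in> M" unfolding M_def using subringE(3)[OF Br] subringE(3)[OF N'r] sh(4) by auto
    next
      fix z assume "z \<in> M" then show "\<ominus> z \<in> M"
        unfolding M_def using hom_subring_minus[OF \<tau> Br] subringE(5)[OF Br] subringE(5)[OF N'r] by auto
    next
      fix z w assume zw: "z \<in> M" "w \<in> M"
      show "z \<otimes> w \<in> M" using zw unfolding M_def using sh(2) subringE(6)[OF Br] subringE(6)[OF N'r] by auto
      show "z \<oplus> w \<in> M" using zw unfolding M_def using sh(3) subringE(7)[OF Br] subringE(7)[OF N'r] by auto
    qed
    have NM: "z \<in> M" if z: "z \<in> N" for z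
    proof -
      have zB: "z \<in> B" using z N's(2) B(2) by auto
      have zc: "z \<in> carrier L" using z Nc by auto
      note I = IrrE[OF F zc algN[OF z]]
      have "eval (Irr F z) (\<tau> z) = \<tau> (eval (Irr F z) z)"
        using eval_hom_subfield(2)[OF Br \<tau> FB fixF set_subset_of_poly[OF I(1)] zB] by simp
      also have "\<dots> = \<zero>" using I(4) hom_subring_zero[OF \<tau> Br] by simp
      finally have "\<tau> z \<in> N" using conj[OF I(1,2) z I(4) sh(1)[OF zB]] by simp
      then show ?thesis unfolding M_def using zB N's(2) by auto
    qed
    have SM: "t \<in> M" if t: "t \<in> S" for t
    proof -
      have tB: "t \<in> B" using t N'(2) B(2) by auto
      have ttB: "t \<otimes> t \<in> B" using subringE(6)[OF Br tB tB] .
      have "eval h (\<tau> t \<otimes> \<tau> t) = \<tau> (eval h (t \<otimes> t))"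
        using eval_hom_subfield(2)[OF Br \<tau> FB fixF set_subset_of_poly[OF h(1)] ttB] sh(2)[OF tB tB] by simp
      also have "\<dots> = \<zero>" using t hom_subring_zero[OF \<tau> Br] unfolding S_def by simp
      finally have "\<tau> t \<in> S" unfolding S_def using sh(1)[OF tB] by simp
      then show ?thesis unfolding M_def using tB N'(2) by auto
    qed
    have "N' \<subseteq> M" using min[OF M] NM SM by blast
    then have "\<tau> x \<in> N'" using x(1) unfolding M_def by auto
    then show "y \<in> N'" using ext A(3) phi(2) by auto
  qed (use N's N(2) in auto)
  then show ?thesis using tower' N's(2) N'(2) sS by blast
qed

text \<open>The normal field is itself a tower, hence of 2-power degree. Its length is not
  controlled; the degree bound of the theorem concerns E.\<close>

lemma normal_tower_exists:
  assumes "quadratic_tower F n E" "subfield F L"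
  shows "\<exists>m N. quadratic_tower F m N \<and> E \<subseteq> N \<and> normal_extension L F N"
  using assms
proof (induction)
  case tower_base
  then show ?case using normal_extension_refl quadratic_tower.tower_base by blast
next
  case (tower_step n E s)
  then obtain m N where N: "quadratic_tower F m N" "E \<subseteq> N" "normal_extension L F N" by auto
  have "s \<otimes> s \<in> N" using N(2) tower_step(3) by auto
  then obtain k N' where N': "quadratic_tower F k N'" "N \<subseteq> N'" "s \<in> N'" "normal_extension L F N'"
    using normal_extension_adjoin_square_root[OF tower_step(5) N(1,3) tower_step(2)] by auto
  have "subring N' L" using quadratic_tower_subfield(1)[OF N'(1) tower_step(5)] subfieldE(1) by auto
  then have "line_extension E s E \<subseteq> N'"
    by (rule quadratic_extension_minimal) (use N N' in auto)
  then show ?case using N' by blast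
qed

text \<open>The degree of x divides the 2-power degree of E over F, so it is a power of 2 and thus
  nonzero as an element of the field.\<close>

lemma quadratic_tower_separable:
  assumes tower: "quadratic_tower F n E" and F: "subfield F L" and two: "\<one> \<oplus> \<one> \<noteq> \<zero>"
  shows "separable_extension L F E"
  unfolding separable_extension_def
proof (intro ballI conjI)
  fix x assume x: "x \<in> E"
  have E: "subfield E L" "F \<subseteq> E" using quadratic_tower_subfield[OF tower F] by auto
  obtain k where k: "dimension (2 ^ k) F E" using quadratic_tower_dimension[OF tower F] by auto
  have xc: "x \<in> carrier L" using x subfieldE(3)[OF E(1)] by auto
  have alg: "(algebraic over F) x"
    using finite_dimension_imp_algebraic[OF F subfieldE(1)[OF E(1)] finite_dimensionI[OF k] x] .
  then show "algebraic F x" unfolding over_def .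
  fix y assume y: "y \<in> carrier L"
  let ?A = "simple_extension F x"
  have A: "subfield ?A L" "F \<subseteq> ?A" "?A \<subseteq> E"
    using simple_extension_is_subfield[OF F xc] alg simple_extension_incl[OF subfieldE(3)[OF F] xc]
      simple_extension_subring_incl[OF subfieldE(1)[OF E(1)] E(2) x] by auto
  obtain j where "dimension (2 ^ j) F ?A" using two_power_subfield[OF F A(1,2) E(1) A(3) k] by auto
  then have "degree (Irr F x) = 2 ^ j"
    using dimension_is_inj[OF F] dimension_simple_extension[OF F xc alg] by blast
  moreover have "(\<one> \<oplus> \<one>) [^] j \<noteq> \<zero>" using two
    by (induction j) (auto simp: integral_iff)
  ultimately have "[(degree (Irr F x))] \<cdot> \<one> \<noteq> \<zero>" using add_pow_two_power by simp
  then show "alg_mult (Irr F x) y \<le> 1" using separable_of_degree[OF F xc alg _ y] by simp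
qed

text \<open>The normal closure is an intersection of normal extensions, hence a field between F and
  a normal tower N, so its degree divides a power of 2.\<close>

lemma quadratic_tower_two_extension:
  assumes tower: "quadratic_tower F n E" and F: "subfield F L" and two: "\<one> \<oplus> \<one> \<noteq> \<zero>"
  shows "two_extension L F E"
proof -
  have E: "subfield E L" "F \<subseteq> E" using quadratic_tower_subfield[OF tower F] by auto
  obtain k where "dimension (2 ^ k) F E" using quadratic_tower_dimension[OF tower F] by auto
  then have fin: "finite_field_extension L F E"
    unfolding finite_field_extension_def using F E finite_dimensionI by auto
  obtain m N where N: "quadratic_tower F m N" "E \<subseteq> N" "normal_extension L F N"
    using normal_tower_exists[OF tower F] by auto
  have Ns: "subfield N L" using quadratic_tower_subfield[OF N(1) F] by auto
  obtain l where l: "dimension (2 ^ l) F N" using quadratic_tower_dimension[OF N(1) F] by auto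
  define S where "S = {N. normal_extension L F N \<and> E \<subseteq> N}"
  have NS: "N \<in> S" unfolding S_def using N by auto
  have SS: "subfield M L" if "M \<in> S" for M using that unfolding S_def normal_extension_def by auto
  have "subring (\<Inter>S) L" by (rule subring_Inter) (use NS SS subfieldE(1) in auto)
  then have "subfield (\<Inter>S) L"
  proof (rule subfieldI')
    fix k assume k: "k \<in> \<Inter>S - {\<zero>}"
    show "inv k \<in> \<Inter>S" using k subfield_m_inv(1)[OF SS] by auto
  qed
  moreover have "F \<subseteq> \<Inter>S" using E(2) unfolding S_def by auto
  moreover have "\<Inter>S \<subseteq> N" using NS by auto
  ultimately have "\<exists>j. dimension (2 ^ j) F (\<Inter>S)" using two_power_subfield[OF F _ _ Ns _ l] by auto
  then show ?thesis
    unfolding two_extension_def normal_closure_def S_def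
    using fin quadratic_tower_separable[OF assms] by auto
qed

lemma quadratic_tower_dim:
  assumes "quadratic_tower F n E" "subfield F L" "n \<le> m"
  shows "dim F E \<le> 2 ^ m"
proof -
  obtain k where k: "k \<le> n" "dimension (2 ^ k) F E" using quadratic_tower_dimension assms by blast
  then have "dim F E = 2 ^ k" using dimI[OF assms(2) k(2)] by (simp add: over_def)
  then show ?thesis using k(1) assms(3) by (simp add: power_increasing)
qed

end

section \<open>Common zeros of quadratic forms\<close>

context field
begin

text \<open>The two variables (z, y) of the form are treated as one vector of L \<times> L.
  Subspaces are taken over the small field F, while coordinates may range over all of L.\<close>

definition pair_add :: "'a \<times> 'a \<Rightarrow> 'a \<times> 'a \<Rightarrow> 'a \<times> 'a"
  where "pair_add v w = (fst v \<oplus> fst w, snd v \<oplus> snd w)"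

definition pair_smult :: "'a \<Rightarrow> 'a \<times> 'a \<Rightarrow> 'a \<times> 'a"
  where "pair_smult k v = (k \<otimes> fst v, k \<otimes> snd v)"

definition pair_subspace :: "'a set \<Rightarrow> ('a \<times> 'a) set \<Rightarrow> bool"
  where "pair_subspace F W \<longleftrightarrow> W \<subseteq> carrier R \<times> carrier R \<and> (\<zero>, \<zero>) \<in> W \<and>
    (\<forall>v\<in>W. \<forall>w\<in>W. pair_add v w \<in> W) \<and> (\<forall>k\<in>F. \<forall>w\<in>W. pair_smult k w \<in> W)"

lemma pair_subspaceD:
  assumes "pair_subspace F W"
  shows "\<And>v w. \<lbrakk>v \<in> W; w \<in> W\<rbrakk> \<Longrightarrow> pair_add v w \<in> W"
    and "\<And>k w. \<lbrakk>k \<in> F; w \<in> W\<rbrakk> \<Longrightarrow> pair_smult k w \<in> W"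
  using assms unfolding pair_subspace_def by auto

text \<open>A strictly increasing chain of n + 1 subspaces ending in W, that is, dim W \<ge> n over
  F. The counting argument runs on such lower bounds, and chains provide them without choosing
  bases.\<close>

fun has_chain :: "'a set \<Rightarrow> nat \<Rightarrow> ('a \<times> 'a) set \<Rightarrow> bool"
  where
    "has_chain F 0 W = pair_subspace F W"
  | "has_chain F (Suc n) W = (pair_subspace F W \<and> (\<exists>V. V \<subset> W \<and> has_chain F n V))"

lemma has_chain_subspace: "has_chain F n W \<Longrightarrow> pair_subspace F W"
  by (cases n) auto

lemma has_chain_mono:
  assumes "has_chain F n V" "V \<subseteq> W" "pair_subspace F W" shows "has_chain F n W"
proof (cases n)
  case (Suc m)
  then obtain U where "U \<subset> V" "has_chain F m U" using assms(1) by auto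
  then show ?thesis using assms(2,3) Suc by (simp, meson psubset_subset_trans)
qed (use assms in simp)

lemma has_chain_le: "has_chain F (n + m) W \<Longrightarrow> has_chain F n W"
proof (induction m)
  case (Suc m)
  then obtain V where "V \<subset> W" "has_chain F (n + m) V" "pair_subspace F W" by auto
  then show ?case using Suc(1) has_chain_mono by (metis psubset_imp_subset)
qed simp

lemma has_chain_nonzero:
  assumes "has_chain F (Suc n) W" obtains w where "w \<in> W" "w \<noteq> (\<zero>, \<zero>)"
proof -
  obtain V where V: "V \<subset> W" "has_chain F n V" using assms by auto
  then have "(\<zero>, \<zero>) \<in> V" using has_chain_subspace unfolding pair_subspace_def by blast
  then show thesis using that V(1) by blast
qed

text \<open>The map \<mu> induces a functional from W to (F k + V)/V, so its kernel has codimension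
  at most one. For chains: if the next smaller subspace U is not contained in the kernel, some u
  \<in> U has \<mu>(u) \<notin> V, and a vector w \<in> W outside U can be corrected by a multiple
  of u to lie in the kernel. It stays outside U, so the inclusion of kernels is again
  strict.\<close>

lemma has_chain_cut:
  assumes F: "subfield F R" and V: "subalgebra F V R" and k: "k \<in> carrier R"
    and closed: "\<And>v. v \<in> carrier R \<times> carrier R \<Longrightarrow> \<mu> v \<in> carrier R"
    and add: "\<And>v w. \<lbrakk>v \<in> carrier R \<times> carrier R; w \<in> carrier R \<times> carrier R\<rbrakk>
      \<Longrightarrow> \<mu> (pair_add v w) = \<mu> v \<oplus> \<mu> w"
    and smult: "\<And>c v. \<lbrakk>c \<in> F; v \<in> carrier R \<times> carrier R\<rbrakk> \<Longrightarrow> \<mu> (pair_smult c v) = c \<otimes> \<mu> v"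
    and chain: "has_chain F (Suc n) W" and img: "\<And>w. w \<in> W \<Longrightarrow> \<mu> w \<in> line_extension F k V"
  shows "has_chain F n {w \<in> W. \<mu> w \<in> V}"
  using chain img
proof (induction n arbitrary: W)
  let ?cut = "\<lambda>W. {w \<in> W. \<mu> w \<in> V}"
  have Vr: "V \<subseteq> carrier R" "\<zero> \<in> V" "\<And>x y. \<lbrakk>x \<in> V; y \<in> V\<rbrakk> \<Longrightarrow> x \<oplus> y \<in> V"
    "\<And>c x. \<lbrakk>c \<in> F; x \<in> V\<rbrakk> \<Longrightarrow> c \<otimes> x \<in> V"
    using subalgebra_in_carrier[OF V] subgroup.one_closed[OF subalgebra.axioms(1)[OF V]]
      subgroup.m_closed[OF subalgebra.axioms(1)[OF V]] subalgebra.smult_closed[OF V] by auto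
  have Fr: "subring F R" using subfieldE(1)[OF F] .
  have cut: "pair_subspace F (?cut W)" if W: "pair_subspace F W" for W
  proof -
    have Wc: "W \<subseteq> carrier R \<times> carrier R" and z: "(\<zero>, \<zero>) \<in> W" using W unfolding pair_subspace_def by auto
    have "\<mu> (\<zero>, \<zero>) \<oplus> \<mu> (\<zero>, \<zero>) = \<mu> (\<zero>, \<zero>)"
      using add[of "(\<zero>, \<zero>)" "(\<zero>, \<zero>)"] unfolding pair_add_def by simp
    then have "\<mu> (\<zero>, \<zero>) \<in> V" using closed[of "(\<zero>, \<zero>)"] Vr(2) by (simp add: add.l_cancel_one)
    then show ?thesis using W add smult Vr Wc unfolding pair_subspace_def
      by (auto simp: subset_iff)
  qed
  {
    case 0
    then have W: "pair_subspace F W" by simp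
    show ?case using cut[OF W] by simp
  next
    case (Suc n)
    have W: "pair_subspace F W" using has_chain_subspace[OF Suc(2)] .
    obtain U where U: "U \<subset> W" "has_chain F (Suc n) U" using Suc(2) by auto
    show ?case
    proof (cases "U \<subseteq> ?cut W")
      case True
      then show ?thesis using has_chain_mono[OF U(2) True cut[OF W]] by simp
    next
      case False
      then obtain u where u: "u \<in> U" "\<mu> u \<notin> V" using U(1) by auto
      obtain w where w: "w \<in> W" "w \<notin> U" using U(1) by auto
      have "has_chain F n (?cut U)" using Suc(1)[OF U(2)] Suc(3) U(1) by blast
      moreover have "?cut U \<subset> ?cut W"
      proof -
        have Us: "pair_subspace F U" using has_chain_subspace[OF U(2)] .
        have uc: "u \<in> carrier R \<times> carrier R" "w \<in> carrier R \<times> carrier R"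
          using u w U(1) W unfolding pair_subspace_def by auto
        obtain a x where a: "a \<in> F" "x \<in> V" "\<mu> u = a \<otimes> k \<oplus> x"
          using Suc(3)[of u] u U(1) unfolding line_extension_mem_iff by auto
        obtain b y where b: "b \<in> F" "y \<in> V" "\<mu> w = b \<otimes> k \<oplus> y"
          using Suc(3)[of w] w unfolding line_extension_mem_iff by auto
        have Fc: "F \<subseteq> carrier R" using subringE(1)[OF Fr] .
        have c: "a \<in> carrier R" "b \<in> carrier R" "x \<in> carrier R" "y \<in> carrier R"
          using a b Fc Vr(1) by auto
        have an: "a \<noteq> \<zero>" using u(2) a Vr k c by auto
        then have aU: "a \<in> F - {\<zero>}" "inv a \<in> F" "a \<otimes> inv a = \<one>"
          using a(1) subfield_m_inv[OF F, of a] by auto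
        \<comment> \<open>With \<mu>(u) = a k + x and \<mu>(w) = b k + y, the multiplier -b/a
          cancels the k-component of \<mu>(w + d u).\<close>
        define d where "d = \<ominus> (b \<otimes> inv a)"
        have d: "d \<in> F" unfolding d_def using b(1) aU subringE(5,6)[OF Fr] by auto
        have dc: "d \<in> carrier R" using d Fc by auto
        have ic: "inv a \<in> carrier R" using aU Fc by auto
        have da: "d \<otimes> a = \<ominus> b"
        proof -
          have "d \<otimes> a = \<ominus> b \<otimes> (a \<otimes> inv a)" unfolding d_def using c ic by algebra
          then show ?thesis using aU(3) c by simp
        qed
        let ?v = "pair_add w (pair_smult d u)"
        have pc: "pair_smult d u \<in> carrier R \<times> carrier R" using uc dc unfolding pair_smult_def by auto
        have vW: "?v \<in> W" 
          using pair_subspaceD(1)[OF W w(1) pair_subspaceD(2)[OF W d, of u]] u(1) U(1) by blast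
        have "\<mu> ?v = (b \<otimes> k \<oplus> y) \<oplus> d \<otimes> (a \<otimes> k \<oplus> x)"
          using add[OF uc(2) pc] smult[OF d uc(1)] a(3) b(3) by simp
        also have "\<dots> = (b \<oplus> d \<otimes> a) \<otimes> k \<oplus> (y \<oplus> d \<otimes> x)" using c dc k by algebra
        also have "\<dots> = y \<oplus> d \<otimes> x" unfolding da using c dc k by (simp add: r_neg)
        finally have "?v \<in> ?cut W" using vW Vr a b d by auto
        moreover have "?v \<notin> U"
        proof
          assume vU: "?v \<in> U"
          have "\<ominus> d \<in> F" using d subringE(5)[OF Fr] by auto
          then have "pair_add ?v (pair_smult (\<ominus> d) u) \<in> U"

            by (rule pair_subspaceD(1)[OF Us vU pair_subspaceD(2)[OF Us _ u(1)]])
          moreover have "pair_add ?v (pair_smult (\<ominus> d) u) = w"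
          proof -
            obtain u1 u2 w1 w2 where e: "u = (u1, u2)" "w = (w1, w2)" by (cases u; cases w) auto
            have cc: "u1 \<in> carrier R" "u2 \<in> carrier R" "w1 \<in> carrier R" "w2 \<in> carrier R"
              using uc unfolding e by auto
            have "(w1 \<oplus> d \<otimes> u1) \<oplus> \<ominus> d \<otimes> u1 = w1" "(w2 \<oplus> d \<otimes> u2) \<oplus> \<ominus> d \<otimes> u2 = w2"
              using cc dc by algebra+
            then show ?thesis unfolding e pair_add_def pair_smult_def by simp
          qed
          ultimately show False using w(2) by simp
        qed
        ultimately show ?thesis using U(1) by auto
      qed
      ultimately show ?thesis using cut[OF W] by auto
    qed
  }
qed

text \<open>The quotient of K by the span of \<open>Us\<close> has dimension at most r, so the
  condition costs at most r links of the chain. Each step enlarges \<open>Us\<close> by a value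
  \<mu>(w) outside the span and then removes that vector again with one functional.\<close>

lemma has_chain_cut_codim:
  assumes F: "subfield F R" and K: "dimension n F K" and Us: "independent F Us" "set Us \<subseteq> K"
    and cod: "n \<le> length Us + r"
    and closed: "\<And>v. v \<in> carrier R \<times> carrier R \<Longrightarrow> \<mu> v \<in> carrier R"
    and add: "\<And>v w. \<lbrakk>v \<in> carrier R \<times> carrier R; w \<in> carrier R \<times> carrier R\<rbrakk>
      \<Longrightarrow> \<mu> (pair_add v w) = \<mu> v \<oplus> \<mu> w"
    and smult: "\<And>c v. \<lbrakk>c \<in> F; v \<in> carrier R \<times> carrier R\<rbrakk> \<Longrightarrow> \<mu> (pair_smult c v) = c \<otimes> \<mu> v"
    and chain: "has_chain F (m + r) W" and img: "\<And>w. w \<in> W \<Longrightarrow> \<mu> w \<in> K"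
  shows "has_chain F m {w \<in> W. \<mu> w \<in> Span F Us}"
  using Us cod chain
proof (induction r arbitrary: Us m)
  case 0
  then have "length Us = n" using independent_length_le_dimension[OF F K] by fastforce
  then have "Span F Us = K" using independent_length_eq_dimension[OF F K] 0 by auto
  then have "{w \<in> W. \<mu> w \<in> Span F Us} = W" using img by auto
  then show ?case using 0 by simp
next
  case (Suc r)
  have Uc: "set Us \<subseteq> carrier R" using independent_in_carrier[OF Suc(2)] .
  show ?case
  proof (cases "\<forall>w\<in>W. \<mu> w \<in> Span F Us")
    case True
    then have eq: "{w \<in> W. \<mu> w \<in> Span F Us} = W" by blast
    show ?thesis unfolding eq by (rule has_chain_le[OF Suc(5)])
  next
    case False
    then obtain w where w: "w \<in> W" "\<mu> w \<notin> Span F Us" by auto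
    have kc: "\<mu> w \<in> carrier R" "\<mu> w \<in> K" using img[OF w(1)] space_subgroup_props(1)[OF F K] by auto
    have ind: "independent F (\<mu> w # Us)" using li_Cons[OF kc(1) w(2) Suc(2)] .
    have c1: "has_chain F (Suc m) {v \<in> W. \<mu> v \<in> Span F (\<mu> w # Us)}"
      by (rule Suc(1)[OF ind]) (use Suc kc in auto)
    have "has_chain F m {v \<in> {v \<in> W. \<mu> v \<in> Span F (\<mu> w # Us)}. \<mu> v \<in> Span F Us}"
      by (rule has_chain_cut[OF F Span_is_subalgebra[OF F Uc] kc(1) _ _ _ c1])
        (use closed add smult in \<open>auto simp: mem_Times_iff\<close>)
    moreover have "Span F Us \<subseteq> Span F (\<mu> w # Us)" using mono_Span[OF F Uc kc(1)] .
    ultimately show ?thesis by (smt (verit) Collect_cong mem_Collect_eq subsetD)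
  qed
qed

text \<open>The E-span of W, formed inside L \<times> L; vectors of W that are independent over F
  may become dependent over E. Adding one multiple at a time lets linear statements pass from W to
  its span by induction.\<close>

inductive_set pair_hull :: "'a set \<Rightarrow> ('a \<times> 'a) set \<Rightarrow> ('a \<times> 'a) set" for E W
  where
    hull_zero: "(\<zero>, \<zero>) \<in> pair_hull E W"
  | hull_add: "\<lbrakk>t \<in> pair_hull E W; e \<in> E; w \<in> W\<rbrakk> \<Longrightarrow> pair_add t (pair_smult e w) \<in> pair_hull E W"

lemma pair_hull_mono:
  assumes "t \<in> pair_hull E V" "E \<subseteq> E'" "V \<subseteq> W" shows "t \<in> pair_hull E' W"
  using assms by (induction) (auto intro: hull_zero hull_add)

lemma pair_hull_carrier:
  assumes "t \<in> pair_hull E W" "E \<subseteq> carrier R" "W \<subseteq> carrier R \<times> carrier R"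
  shows "fst t \<in> carrier R" "snd t \<in> carrier R"
  using assms by (induction) (auto simp: pair_add_def pair_smult_def subset_iff)

end

context algebraically_closed
begin

text \<open>The number r (r + 1) / 2 + 1 increases by r + 1 when r is replaced by r + 1. This is
  what polarity to v modulo the span of \<open>Us\<close> costs when that span has codimension at
  most r + 1 in K. In exchange f(v) joins the span, which lowers the codimension by one, at the
  price of one square root at the end. Once the span is all of K, a single nonzero vector
  suffices.\<close>

lemma exists_common_zero:
  assumes F: "subfield F L" and K: "subfield K L" "F \<subseteq> K" "dimension n F K"
    and two: "\<one> \<oplus> \<one> \<noteq> \<zero>" and bc: "b \<in> K" "c \<in> K"
    and Us: "independent F Us" "set Us \<subseteq> K" and cod: "n \<le> length Us + r"
    and W: "W \<subseteq> K \<times> K" "has_chain F (r * (r + 1) div 2 + 1) W"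
  shows "\<exists>m\<le>r. \<exists>E t. quadratic_tower F m E \<and> t \<in> pair_hull E W \<and> t \<noteq> (\<zero>, \<zero>) \<and>
    b \<otimes> (fst t \<otimes> fst t) \<oplus> c \<otimes> (snd t \<otimes> snd t) \<in> Span E Us"
  using Us cod W
proof (induction r arbitrary: Us W)
  let ?f = "\<lambda>t. b \<otimes> (fst t \<otimes> fst t) \<oplus> c \<otimes> (snd t \<otimes> snd t)"
  have Kr: "subring K L" using subfieldE(1)[OF K(1)] .
  have Kc: "K \<subseteq> carrier L" using subringE(1)[OF Kr] .
  have bcc: "b \<in> carrier L" "c \<in> carrier L" using bc Kc by auto
  have fK: "?f t \<in> K" if "t \<in> K \<times> K" for t
    using that bc subringE(6,7)[OF Kr] by auto
  have self: "v \<in> pair_hull F W" if "v \<in> W" "W \<subseteq> K \<times> K" for v W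
  proof -
    have vc: "v \<in> carrier L \<times> carrier L" using that Kc by auto
    have "pair_add (\<zero>, \<zero>) (pair_smult \<one> v) \<in> pair_hull F W"
      using hull_add[OF hull_zero subringE(3)[OF subfieldE(1)[OF F]] that(1)] .
    then show ?thesis using vc unfolding pair_add_def pair_smult_def by auto
  qed
  {
    case 0
    then have "length Us = n" using independent_length_le_dimension[OF F K(3)] by fastforce
    then have S: "Span F Us = K" using independent_length_eq_dimension[OF F K(3)] 0 by auto
    have "has_chain F (Suc 0) W" using 0(5) by simp
    then obtain v where "v \<in> W" "v \<noteq> (\<zero>, \<zero>)" by (rule has_chain_nonzero)
    then show ?case using tower_base[of F] self 0(4) fK S by (intro exI[of _ 0]) blast
  next
    case (Suc r)
    have Uc: "set Us \<subseteq> carrier L" using Suc(3) Kc by auto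
    have Wc: "W \<subseteq> carrier L \<times> carrier L" using Suc(5) Kc by auto
    have "has_chain F (Suc (Suc r * (Suc r + 1) div 2)) W" using Suc(6) by (simp only: Suc_eq_plus1)
    then obtain v where v: "v \<in> W" "v \<noteq> (\<zero>, \<zero>)" by (rule has_chain_nonzero)
    have vK: "fst v \<in> K" "snd v \<in> K" using v(1) Suc(5) by auto
    have vc: "fst v \<in> carrier L" "snd v \<in> carrier L" using vK Kc by auto
    show ?case
    proof (cases "?f v \<in> Span F Us")
      case True
      then show ?thesis using tower_base[of F] self[OF v(1) Suc(5)] v(2) by (intro exI[of _ 0]) blast
    next
      case False
      have fvK: "?f v \<in> K" using fK v(1) Suc(5) by auto
      have fvc: "?f v \<in> carrier L" using fvK Kc by auto
      have ind: "independent F (?f v # Us)" using li_Cons[OF fvc False Suc(2)] .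
      \<comment> \<open>Half the polar form of f at v, in the sense that f(t + d v) = f(t) + d^2
        f(v) + 2 d \<mu>(t).\<close>
      define \<mu> where "\<mu> w = b \<otimes> (fst v \<otimes> fst w) \<oplus> c \<otimes> (snd v \<otimes> snd w)" for w
      have lcl: "\<mu> x \<in> carrier L" if "x \<in> carrier L \<times> carrier L" for x
        using that vc bcc unfolding \<mu>_def by auto
      have ladd: "\<mu> (pair_add x y) = \<mu> x \<oplus> \<mu> y"
        if "x \<in> carrier L \<times> carrier L" "y \<in> carrier L \<times> carrier L" for x y
      proof -
        obtain x1 x2 y1 y2 where e: "x = (x1, x2)" "y = (y1, y2)" by (cases x; cases y) auto
        have "x1 \<in> carrier L" "x2 \<in> carrier L" "y1 \<in> carrier L" "y2 \<in> carrier L"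
          using that unfolding e by auto
        then show ?thesis unfolding e \<mu>_def pair_add_def fst_conv snd_conv using vc bcc by algebra
      qed
      have lsm: "\<mu> (pair_smult d x) = d \<otimes> \<mu> x"
        if "d \<in> carrier L" "x \<in> carrier L \<times> carrier L" for d x
      proof -
        obtain x1 x2 where e: "x = (x1, x2)" by (cases x) auto
        have "x1 \<in> carrier L" "x2 \<in> carrier L" using that unfolding e by auto
        then show ?thesis unfolding e \<mu>_def pair_smult_def fst_conv snd_conv using vc bcc that(1) by algebra
      qed
      have Fc: "F \<subseteq> carrier L" using subfieldE(3)[OF F] .
      let ?W = "{w \<in> W. \<mu> w \<in> Span F Us}"
      let ?m = "r * (r + 1) div 2 + 1"
      have "Suc r * (Suc r + 1) div 2 + 1 = ?m + Suc r" by simp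
      then have c1: "has_chain F (?m + Suc r) W" using Suc(6) by metis
      have wK: "\<mu> w \<in> K" if "w \<in> W" for w
        using that unfolding \<mu>_def using vK bc Suc(5) subringE(6,7)[OF Kr] by auto
      have chain': "has_chain F ?m ?W"
      proof (rule has_chain_cut_codim[OF F K(3) Suc(2,3,4) _ _ _ c1 wK])
        show "\<mu> (pair_smult d x) = d \<otimes> \<mu> x" if "d \<in> F" "x \<in> carrier L \<times> carrier L" for d x
          using lsm[OF subsetD[OF Fc that(1)] that(2)] .
      qed (rule lcl ladd; assumption)+
      have "\<exists>m\<le>r. \<exists>E t. quadratic_tower F m E \<and> t \<in> pair_hull E ?W \<and> t \<noteq> (\<zero>, \<zero>) \<and>
        ?f t \<in> Span E (?f v # Us)"
        by (rule Suc(1)[OF ind _ _ _ chain']) (use fvK Suc(3,4,5) in auto)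
      then obtain m E t where m: "m \<le> r" and tower: "quadratic_tower F m E"
        and t: "t \<in> pair_hull E ?W" "t \<noteq> (\<zero>, \<zero>)" "?f t \<in> Span E (?f v # Us)" by blast
      have E: "subfield E L" "F \<subseteq> E" using quadratic_tower_subfield[OF tower F] by auto
      have Ec: "E \<subseteq> carrier L" using subfieldE(3)[OF E(1)] .
      have tc: "fst t \<in> carrier L" "snd t \<in> carrier L"
        using pair_hull_carrier[OF t(1) Ec] Wc by auto
      obtain g u where g: "g \<in> E" "u \<in> Span E Us" "?f t = g \<otimes> ?f v \<oplus> u"
        using t(3) unfolding Span.simps foldr.simps o_apply line_extension_mem_iff by auto
      have gc: "g \<in> carrier L" using g(1) Ec by auto
      \<comment> \<open>In f(t + d v) the term d^2 f(v) has to cancel g f(v); both d = e and d = -e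
        achieve this.\<close>
      obtain e where e: "e \<in> carrier L" "e \<otimes> e = \<ominus> g" using exists_square_root[of "\<ominus> g"] gc by auto
      have eE: "e \<otimes> e \<in> E" using e(2) g(1) subringE(5)[OF subfieldE(1)[OF E(1)]] by auto
      let ?E = "line_extension E e E"
      have tower': "quadratic_tower F (Suc m) ?E" using tower_step[OF tower e(1) eE] .
      have E': "subfield ?E L" "E \<subseteq> ?E" "e \<in> ?E"
        using quadratic_extension_subfield[OF E(1) e(1) eE] quadratic_extension_incl[OF E(1) e(1) eE] by auto
      have SE: "x \<in> Span ?E Us" if "x \<in> Span E Us" for x
        using that Span_eq_combine_set[OF E(1) Uc] Span_eq_combine_set[OF E'(1) Uc] E'(2) by blast
      note S' = Span_subgroup_props[OF E'(1) Uc] Span_smult_closed[OF E'(1) Uc]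
      \<comment> \<open>Polarity was imposed on vectors of W over F; linearity of \<mu> carries it
        to t, which lies in their E-span.\<close>
      have lt: "\<mu> t \<in> Span ?E Us"
        using t(1)
      proof (induction)
        case hull_zero
        have "\<mu> (\<zero>, \<zero>) = \<zero>" unfolding \<mu>_def using vc bcc by simp
        then show ?case using S'(2) by simp
      next
        case (hull_add s d w)
        have sc: "s \<in> carrier L \<times> carrier L"
          using pair_hull_carrier[OF hull_add(1) Ec] Wc by (cases s) auto
        have wc: "w \<in> carrier L \<times> carrier L" using hull_add(3) Wc by auto
        have dc: "d \<in> carrier L" using hull_add(2) Ec by auto
        have pc: "pair_smult d w \<in> carrier L \<times> carrier L" using wc dc unfolding pair_smult_def by auto
        have "\<mu> w \<in> Span F Us" using hull_add(3) by auto
        then have "\<mu> w \<in> Span E Us"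
          using Span_eq_combine_set[OF E(1) Uc] Span_eq_combine_set[OF F Uc] E(2) by blast
        then have "d \<otimes> \<mu> w \<in> Span ?E Us" using S'(5) SE hull_add(2) E'(2) by blast
        then show ?case unfolding ladd[OF sc pc] lsm[OF dc wc] using S'(3) hull_add(4) by simp
      qed
      have lc: "\<mu> t \<in> carrier L" using lt S'(1) by auto
      have uc: "u \<in> carrier L" using SE[OF g(2)] S'(1) by auto
      have good: "?f (pair_add t (pair_smult d v)) \<in> Span ?E Us"
        "pair_add t (pair_smult d v) \<in> pair_hull ?E W"
        if d: "d \<in> ?E" "d \<otimes> d = \<ominus> g" for d
      proof -
        have dc: "d \<in> carrier L" using d(1) subfieldE(3)[OF E'(1)] by auto
        have "?f (pair_add t (pair_smult d v)) = ?f t \<oplus> (d \<otimes> d) \<otimes> ?f v \<oplus> (d \<oplus> d) \<otimes> \<mu> t"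
          unfolding \<mu>_def pair_add_def pair_smult_def fst_conv snd_conv using vc tc bcc dc by algebra
        also have "\<dots> = u \<oplus> (d \<oplus> d) \<otimes> \<mu> t"
        proof -
          have *: "x \<otimes> y \<oplus> u \<oplus> \<ominus> x \<otimes> y \<oplus> z = u \<oplus> z"
            if "x \<in> carrier L" "y \<in> carrier L" "z \<in> carrier L" for x y z
            using that uc by algebra
          show ?thesis unfolding d(2) g(3) using *[OF gc fvc] dc lc by simp
        qed
        also have "\<dots> \<in> Span ?E Us"
        proof -
          have "d \<oplus> d \<in> ?E" using d(1) subringE(7)[OF subfieldE(1)[OF E'(1)]] by auto
          then show ?thesis using S'(3,5) lt SE[OF g(2)] by blast
        qed
        finally show "?f (pair_add t (pair_smult d v)) \<in> Span ?E Us" .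
        show "pair_add t (pair_smult d v) \<in> pair_hull ?E W"
          using hull_add[OF pair_hull_mono[OF t(1) E'(2), of W] d(1) v(1)] by auto
      qed
      have e1: "\<ominus> e \<in> ?E" "\<ominus> e \<otimes> \<ominus> e = \<ominus> g"
        using E'(3) subringE(5)[OF subfieldE(1)[OF E'(1)]] e gc
        by (auto simp: l_minus r_minus)
      have "pair_add t (pair_smult e v) \<noteq> (\<zero>, \<zero>) \<or> pair_add t (pair_smult (\<ominus> e) v) \<noteq> (\<zero>, \<zero>)"
      proof (rule ccontr)
        assume "\<not> ?thesis"
        then have z: "fst t \<oplus> e \<otimes> fst v = \<zero>" "fst t \<oplus> \<ominus> e \<otimes> fst v = \<zero>"
          "snd t \<oplus> e \<otimes> snd v = \<zero>" "snd t \<oplus> \<ominus> e \<otimes> snd v = \<zero>"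
          unfolding pair_add_def pair_smult_def by auto
        have "(\<one> \<oplus> \<one>) \<otimes> fst t = (fst t \<oplus> e \<otimes> fst v) \<oplus> (fst t \<oplus> \<ominus> e \<otimes> fst v)"
          "(\<one> \<oplus> \<one>) \<otimes> snd t = (snd t \<oplus> e \<otimes> snd v) \<oplus> (snd t \<oplus> \<ominus> e \<otimes> snd v)"
          using tc vc e(1) by algebra+
        then have "(\<one> \<oplus> \<one>) \<otimes> fst t = \<zero>" "(\<one> \<oplus> \<one>) \<otimes> snd t = \<zero>" unfolding z by simp_all
        then have "fst t = \<zero>" "snd t = \<zero>" using two tc by (auto simp: integral_iff)
        then show False using t(2) by (cases t) auto
      qed
      then show ?thesis
        using good[OF E'(3) e(2)] good[OF e1] tower' m by (metis Suc_le_mono)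
    qed
  }
qed

end

section \<open>Representing b by the norm form of a\<close>

context field
begin

lemma add_cancel_diff:
  assumes "x \<in> carrier R" "y \<in> carrier R" "z \<in> carrier R"
  shows "(x \<oplus> z) \<oplus> \<ominus> (y \<oplus> z) = x \<oplus> \<ominus> y"
  using assms by algebra

lemma subfield_inv_mem:
  assumes "subfield M R" "x \<in> M" "x \<noteq> \<zero>"
  shows "inv x \<in> M" "x \<otimes> inv x = \<one>" "inv x \<otimes> x = \<one>"
  using subfield_m_inv[OF assms(1), of x] assms(2,3) by auto

text \<open>When a = s^2, the norm form factors as (u - s v)(u + s v). The factors 1 and b give u =
  (b + 1)/2 and s v = (b - 1)/2.\<close>

lemma norm_form_of_square:
  assumes M: "subfield M R" and m: "s \<in> M" "b \<in> M" "s \<noteq> \<zero>" and two: "\<one> \<oplus> \<one> \<noteq> \<zero>"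
  shows "\<exists>u\<in>M. \<exists>v\<in>M. b = u \<otimes> u \<ominus> (s \<otimes> s) \<otimes> (v \<otimes> v)"
proof -
  have Mr: "subring M R" using subfieldE(1)[OF M] .
  note cl = subringE(3,5,6,7)[OF Mr]
  have Mc: "M \<subseteq> carrier R" using subringE(1)[OF Mr] .
  define h where "h = inv (\<one> \<oplus> \<one>)"
  have h: "h \<in> M" "(\<one> \<oplus> \<one>) \<otimes> h = \<one>" unfolding h_def
    using subfield_inv_mem[OF M _ two] cl by auto
  define i where "i = inv s"
  have i: "i \<in> M" "s \<otimes> i = \<one>" unfolding i_def using subfield_inv_mem[OF M m(1,3)] by auto
  have c: "h \<in> carrier R" "i \<in> carrier R" "s \<in> carrier R" "b \<in> carrier R" using h i m Mc by auto
  have "h \<otimes> (b \<oplus> \<one>) \<in> M" "h \<otimes> (b \<oplus> \<ominus> \<one>) \<otimes> i \<in> M" using h i m cl by auto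
  moreover have "b = (h \<otimes> (b \<oplus> \<one>)) \<otimes> (h \<otimes> (b \<oplus> \<one>)) \<ominus>
      (s \<otimes> s) \<otimes> ((h \<otimes> (b \<oplus> \<ominus> \<one>) \<otimes> i) \<otimes> (h \<otimes> (b \<oplus> \<ominus> \<one>) \<otimes> i))" (is "b = ?r")
  proof -
    define f where "f = h \<otimes> (b \<oplus> \<one>)"
    define g where "g = h \<otimes> (b \<oplus> \<ominus> \<one>)"
    have fg: "f \<in> carrier R" "g \<in> carrier R" unfolding f_def g_def using c by auto
    have "f \<otimes> f \<ominus> (s \<otimes> s) \<otimes> ((g \<otimes> i) \<otimes> (g \<otimes> i)) = f \<otimes> f \<ominus> (s \<otimes> i) \<otimes> (s \<otimes> i) \<otimes> (g \<otimes> g)"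
      using c fg by (simp add: m_ac)
    also have "\<dots> = (f \<oplus> g) \<otimes> (f \<oplus> \<ominus> g)" unfolding i(2) using fg by algebra
    also have "f \<oplus> g = (\<one> \<oplus> \<one>) \<otimes> h \<otimes> b" unfolding f_def g_def using c by algebra
    also have "f \<oplus> \<ominus> g = (\<one> \<oplus> \<one>) \<otimes> h" unfolding f_def g_def using c by algebra
    finally have "f \<otimes> f \<ominus> (s \<otimes> s) \<otimes> ((g \<otimes> i) \<otimes> (g \<otimes> i)) = ((\<one> \<oplus> \<one>) \<otimes> h \<otimes> b) \<otimes> ((\<one> \<oplus> \<one>) \<otimes> h)" .
    then show ?thesis unfolding h(2) f_def g_def using c by simp
  qed
  ultimately show ?thesis by blast
qed

text \<open>This is the norm of (e + x \<alpha>)(z + y \<alpha>) with \<alpha>^2 = a, written in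
  coordinates.\<close>

lemma brahmagupta_identity:
  assumes c: "a \<in> carrier R" "e \<in> carrier R" "x \<in> carrier R" "z \<in> carrier R" "y \<in> carrier R"
  shows "(e \<otimes> z \<oplus> a \<otimes> (x \<otimes> y)) \<otimes> (e \<otimes> z \<oplus> a \<otimes> (x \<otimes> y)) \<ominus>
      a \<otimes> ((e \<otimes> y \<oplus> x \<otimes> z) \<otimes> (e \<otimes> y \<oplus> x \<otimes> z))
    = (e \<otimes> e \<ominus> a \<otimes> (x \<otimes> x)) \<otimes> (z \<otimes> z \<ominus> a \<otimes> (y \<otimes> y))"
proof -
  \<comment> \<open>The mixed term 2 a e x z y, which occurs in both squares and cancels in the
    difference.\<close>
  define S where "S = a \<otimes> (e \<otimes> x) \<otimes> (z \<otimes> y) \<oplus> a \<otimes> (e \<otimes> x) \<otimes> (z \<otimes> y)"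
  have "(e \<otimes> z \<oplus> a \<otimes> (x \<otimes> y)) \<otimes> (e \<otimes> z \<oplus> a \<otimes> (x \<otimes> y))
      = (e \<otimes> e \<otimes> (z \<otimes> z) \<oplus> a \<otimes> a \<otimes> (x \<otimes> x) \<otimes> (y \<otimes> y)) \<oplus> S"
    "a \<otimes> ((e \<otimes> y \<oplus> x \<otimes> z) \<otimes> (e \<otimes> y \<oplus> x \<otimes> z))
      = (a \<otimes> (e \<otimes> e) \<otimes> (y \<otimes> y) \<oplus> a \<otimes> (x \<otimes> x) \<otimes> (z \<otimes> z)) \<oplus> S"
    unfolding S_def using c by (simp_all add: l_distr r_distr m_ac a_ac)
  moreover have "S \<in> carrier R" unfolding S_def using c by simp
  ultimately show ?thesis unfolding a_minus_def using c
    by (simp add: add_cancel_diff) (simp add: l_distr r_distr l_minus r_minus minus_add m_ac a_ac)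
qed

text \<open>With d = z^2 - a y^2, multiplying the equation by d exhibits b d^2 as a norm, and d^2 is
  divided out. If d = 0, then y \<noteq> 0 and a = (z/y)^2 is a square, so every b is a
  norm.\<close>

lemma norm_form_of_isotropic:
  assumes M: "subfield M R" and m: "a \<in> M" "b \<in> M" "e \<in> M" "x \<in> M" "z \<in> M" "y \<in> M"
    and a: "a \<noteq> \<zero>" and nz: "z \<noteq> \<zero> \<or> y \<noteq> \<zero>" and two: "\<one> \<oplus> \<one> \<noteq> \<zero>"
    and eq: "e \<otimes> e \<ominus> a \<otimes> (x \<otimes> x) = b \<otimes> (z \<otimes> z \<ominus> a \<otimes> (y \<otimes> y))"
  shows "\<exists>u\<in>M. \<exists>v\<in>M. b = u \<otimes> u \<ominus> a \<otimes> (v \<otimes> v)"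
proof -
  have Mr: "subring M R" using subfieldE(1)[OF M] .
  note cl = subringE(3,5,6,7)[OF Mr]
  have Mc: "M \<subseteq> carrier R" using subringE(1)[OF Mr] .
  have c: "a \<in> carrier R" "b \<in> carrier R" "e \<in> carrier R" "x \<in> carrier R" "z \<in> carrier R" "y \<in> carrier R"
    using m Mc by auto
  define d where "d = z \<otimes> z \<ominus> a \<otimes> (y \<otimes> y)"
  have dM: "d \<in> M" unfolding d_def a_minus_def using m cl by auto
  have dc: "d \<in> carrier R" using dM Mc by auto
  show ?thesis
  proof (cases "d = \<zero>")
    case True
    have zz: "z \<otimes> z = a \<otimes> (y \<otimes> y)"
      using True unfolding d_def by (rule diff_zeroI) (use c in auto)
    have y: "y \<noteq> \<zero>" using nz zz c by (metis integral m_closed r_null)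
    define i where "i = inv y"
    have i: "i \<in> M" "y \<otimes> i = \<one>" unfolding i_def using subfield_inv_mem[OF M m(6) y] by auto
    have ic: "i \<in> carrier R" using i Mc by auto
    have "(z \<otimes> i) \<otimes> (z \<otimes> i) = (z \<otimes> z) \<otimes> (i \<otimes> i)" using c ic by algebra
    also have "\<dots> = a \<otimes> ((y \<otimes> i) \<otimes> (y \<otimes> i))" unfolding zz using c ic by algebra
    finally have sq: "(z \<otimes> i) \<otimes> (z \<otimes> i) = a" unfolding i(2) using c by simp
    have "z \<otimes> i \<in> M" "z \<otimes> i \<noteq> \<zero>" using m i cl sq a c ic by auto
    then show ?thesis using norm_form_of_square[OF M _ m(2) _ two, of "z \<otimes> i"] unfolding sq by auto
  next
    case False
    define i where "i = inv d"
    have i: "i \<in> M" "d \<otimes> i = \<one>" unfolding i_def using subfield_inv_mem[OF M dM False] by auto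
    have ic: "i \<in> carrier R" using i Mc by auto
    let ?u = "i \<otimes> (e \<otimes> z \<oplus> a \<otimes> (x \<otimes> y))" and ?v = "i \<otimes> (e \<otimes> y \<oplus> x \<otimes> z)"
    have "?u \<in> M" "?v \<in> M" using m i cl by auto
    moreover have "b = ?u \<otimes> ?u \<ominus> a \<otimes> (?v \<otimes> ?v)"
    proof -
      have "?u \<otimes> ?u \<ominus> a \<otimes> (?v \<otimes> ?v)
        = (i \<otimes> i) \<otimes> ((e \<otimes> e \<ominus> a \<otimes> (x \<otimes> x)) \<otimes> (z \<otimes> z \<ominus> a \<otimes> (y \<otimes> y)))"
        using c ic brahmagupta_identity[of a e x z y, symmetric]
        by (simp add: a_minus_def r_distr r_minus m_ac)
      also have "\<dots> = b \<otimes> ((d \<otimes> i) \<otimes> (d \<otimes> i))" unfolding eq d_def[symmetric] using c dc ic by algebra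
      finally show ?thesis unfolding i(2) using c by simp
    qed
    ultimately show ?thesis by blast
  qed
qed

lemma pair_subspace_times:
  assumes F: "subfield F R" and "dimension m F U" "dimension n F V"
  shows "pair_subspace F (U \<times> V)"
  using space_subgroup_props(1,2,3,5)[OF F assms(2)] space_subgroup_props(1,2,3,5)[OF F assms(3)]
  unfolding pair_subspace_def pair_add_def pair_smult_def by auto

lemma line_extension_psubset:
  assumes F: "subfield F R" and "dimension n F V" "v \<in> carrier R" "v \<notin> V"
  shows "V \<subset> line_extension F v V"
proof -
  note V = space_subgroup_props[OF F assms(2)]
  have Fr: "subring F R" using subfieldE(1)[OF F] .
  have "v = \<one> \<otimes> v \<oplus> \<zero>" using assms(3) by simp
  then have "v \<in> line_extension F v V"
    unfolding line_extension_mem_iff using V(2) subringE(3)[OF Fr] by blast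
  moreover have "V \<subseteq> line_extension F v V"
  proof
    fix w assume w: "w \<in> V"
    then have "w = \<zero> \<otimes> v \<oplus> w" using V(1) assms(3) by auto
    then show "w \<in> line_extension F v V"
      unfolding line_extension_mem_iff using w subringE(2)[OF Fr] by blast
  qed
  ultimately show ?thesis using assms(4) by blast
qed

text \<open>Bases of the factors supply the chain, one vector at a time: the induction peels off V
  and then U.\<close>

lemma has_chain_times:
  assumes "dimension m F U" "dimension n F V" and F: "subfield F R"
  shows "has_chain F (m + n) (U \<times> V)"
  using assms(2,1) F
proof (induction n F V arbitrary: m U)
  case (zero_dim K m U)
  from zero_dim(1,2) show ?case
  proof (induction m K U)
    case (zero_dim K)
    then show ?case using pair_subspace_times[OF _ dimension.zero_dim dimension.zero_dim] by simp
  next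
    case (Suc_dim v E n K)
    have "has_chain K n (E \<times> {\<zero>})" using Suc_dim(4)[OF Suc_dim(5)] by simp
    moreover have "E \<times> {\<zero>} \<subset> line_extension K v E \<times> {\<zero>}"
      using line_extension_psubset[OF Suc_dim(5,3,1,2)] by auto
    moreover have "pair_subspace K (line_extension K v E \<times> {\<zero>})"
      using pair_subspace_times[OF Suc_dim(5) dimension.Suc_dim[OF Suc_dim(1,2,3)] dimension.zero_dim] .
    ultimately show ?case by auto
  qed
next
  case (Suc_dim v E n K m U)
  have "has_chain K (m + n) (U \<times> E)" using Suc_dim(4)[OF Suc_dim(5,6)] .
  moreover have "U \<times> E \<subset> U \<times> line_extension K v E"
    using line_extension_psubset[OF Suc_dim(6,3,1,2)] space_subgroup_props(2)[OF Suc_dim(6,5)] by auto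
  moreover have "pair_subspace K (U \<times> line_extension K v E)"
    using pair_subspace_times[OF Suc_dim(6,5) dimension.Suc_dim[OF Suc_dim(1,2,3)]] .
  ultimately show ?case by auto
qed

end

context algebraically_closed
begin

text \<open>Independence makes \<open>U\<close> three-dimensional, so n \<ge> 3 and K/U has
  dimension n - 3. The conclusion quantifies over all fields M above K and E, so that the composite
  field can be inserted later.\<close>

lemma norm_form_independent:
  assumes F: "subfield F L" and K: "subfield K L" "F \<subseteq> K" "dimension n F K" and n8: "n \<le> 8"
    and two: "\<one> \<oplus> \<one> \<noteq> \<zero>" and ab: "a \<in> K" "b \<in> K" "a \<noteq> \<zero>"
    and ind: "independent F [inv a, a, \<one>]"
  shows "\<exists>m\<le>n. \<exists>E. quadratic_tower F m E \<and>
    (\<forall>M. subfield M L \<longrightarrow> K \<union> E \<subseteq> M \<longrightarrow> (\<exists>u\<in>M. \<exists>v\<in>M. b = u \<otimes> u \<ominus> a \<otimes> (v \<otimes> v)))"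
proof -
  have Kr: "subring K L" using subfieldE(1)[OF K(1)] .
  note clK = subringE(3,5,6,7)[OF Kr]
  have Kc: "K \<subseteq> carrier L" using subringE(1)[OF Kr] .
  let ?Us = "[inv a, a, \<one>]"
  have ia: "inv a \<in> K" "a \<otimes> inv a = \<one>" using subfield_inv_mem[OF K(1) ab(1,3)] by auto
  have UsK: "set ?Us \<subseteq> K" using ia ab clK by auto
  have n3: "3 \<le> n" using independent_length_le_dimension[OF F K(3) ind UsK] by simp
  define r where "r = n - 3"
  \<comment> \<open>For n = 8 the inequality is sharp: 5 * 6 / 2 + 1 = 16 = 2 * 8. For n = 9 it
    would read 22 \<le> 18.\<close>
  have "n = 3 \<or> n = 4 \<or> n = 5 \<or> n = 6 \<or> n = 7 \<or> n = 8" using n3 n8 by auto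
  then have "r * (r + 1) div 2 + 1 \<le> n + n" unfolding r_def by auto
  then obtain d where d: "n + n = (r * (r + 1) div 2 + 1) + d" using le_Suc_ex by blast
  have "has_chain F (n + n) (K \<times> K)" using has_chain_times[OF K(3,3) F] .
  then have chain: "has_chain F (r * (r + 1) div 2 + 1) (K \<times> K)" unfolding d by (rule has_chain_le)
  have acc: "a \<in> carrier L" "b \<in> carrier L" "inv a \<in> carrier L" using ab ia Kc by auto
  let ?c = "\<ominus> (a \<otimes> b)"
  have cK: "?c \<in> K" using ab clK by auto
  have "n \<le> length ?Us + r" unfolding r_def by simp
  from exists_common_zero[OF F K two ab(2) cK ind UsK this _ chain]
  obtain m E t where m: "m \<le> r" and tower: "quadratic_tower F m E" and t: "t \<in> pair_hull E (K \<times> K)"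
    "t \<noteq> (\<zero>, \<zero>)"
    and ft: "b \<otimes> (fst t \<otimes> fst t) \<oplus> ?c \<otimes> (snd t \<otimes> snd t) \<in> Span E ?Us" by blast
  have E: "subfield E L" "F \<subseteq> E" using quadratic_tower_subfield[OF tower F] by auto
  have Ec: "E \<subseteq> carrier L" using subfieldE(3)[OF E(1)] .
  obtain z y where tzy: "t = (z, y)" by (cases t) auto
  have zyc: "z \<in> carrier L" "y \<in> carrier L"
    using pair_hull_carrier[OF t(1) Ec] Kc unfolding tzy by auto
  obtain g2 g1 g0 where g: "g2 \<in> E" "g1 \<in> E" "g0 \<in> E"
    and ftg: "b \<otimes> (z \<otimes> z) \<oplus> ?c \<otimes> (y \<otimes> y) = g2 \<otimes> inv a \<oplus> (g1 \<otimes> a \<oplus> (g0 \<otimes> \<one> \<oplus> \<zero>))"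
    using ft unfolding tzy by (auto simp: line_extension_mem_iff)
  have gc: "g2 \<in> carrier L" "g1 \<in> carrier L" "g0 \<in> carrier L" using g Ec by auto
  \<comment> \<open>The target is g2/a + g1 a + g0 = e^2 - a (p + q/a)^2 = e^2 - p^2 a - 2 p q -
    q^2/a. Comparing the parts gives p^2 = -g1, q^2 = -g2 and e^2 = g0 + 2 p q; the last value lies
    in the tower only after p and q have been adjoined.\<close>
  obtain p where p: "p \<in> carrier L" "p \<otimes> p = \<ominus> g1" using exists_square_root[of "\<ominus> g1"] gc by auto
  obtain q where q: "q \<in> carrier L" "q \<otimes> q = \<ominus> g2" using exists_square_root[of "\<ominus> g2"] gc by auto
  define w where "w = g0 \<oplus> (p \<otimes> q \<oplus> p \<otimes> q)"
  have wc: "w \<in> carrier L" unfolding w_def using gc p(1) q(1) by simp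
  obtain e where e: "e \<in> carrier L" "e \<otimes> e = w" using exists_square_root[OF wc] .
  have pE: "p \<otimes> p \<in> E" using p(2) g subringE(5)[OF subfieldE(1)[OF E(1)]] by auto
  let ?E1 = "line_extension E p E"
  have tower1: "quadratic_tower F (Suc m) ?E1" using tower_step[OF tower p(1) pE] .
  have E1: "subfield ?E1 L" "E \<subseteq> ?E1" "p \<in> ?E1"
    using quadratic_extension_subfield[OF E(1) p(1) pE] quadratic_extension_incl[OF E(1) p(1) pE] by auto
  have qE: "q \<otimes> q \<in> ?E1" using q(2) g E1(2) subringE(5)[OF subfieldE(1)[OF E1(1)]] by auto
  let ?E2 = "line_extension ?E1 q ?E1"
  have tower2: "quadratic_tower F (Suc (Suc m)) ?E2" using tower_step[OF tower1 q(1) qE] .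
  have E2: "subfield ?E2 L" "?E1 \<subseteq> ?E2" "q \<in> ?E2"
    using quadratic_extension_subfield[OF E1(1) q(1) qE] quadratic_extension_incl[OF E1(1) q(1) qE] by auto
  have "g0 \<in> ?E2" "p \<in> ?E2" using g(3) E1 E2(2) by auto
  then have eE: "e \<otimes> e \<in> ?E2" unfolding e(2) w_def using E2(3) subringE(6,7)[OF subfieldE(1)[OF E2(1)]] by auto
  let ?E3 = "line_extension ?E2 e ?E2"
  have tower3: "quadratic_tower F (Suc (Suc (Suc m))) ?E3" using tower_step[OF tower2 e(1) eE] .
  have E3: "subfield ?E3 L" "?E2 \<subseteq> ?E3" "e \<in> ?E3"
    using quadratic_extension_subfield[OF E2(1) e(1) eE] quadratic_extension_incl[OF E2(1) e(1) eE] by auto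
  have "\<exists>u\<in>M. \<exists>v\<in>M. b = u \<otimes> u \<ominus> a \<otimes> (v \<otimes> v)" if M: "subfield M L" "K \<union> ?E3 \<subseteq> M" for M
  proof -
    have Mr: "subring M L" using subfieldE(1)[OF M(1)] .
    note clM = subringE(2,3,5,6,7)[OF Mr]
    have EM: "E \<subseteq> M" using M(2) E1(2) E2(2) E3(2) by blast
    \<comment> \<open>As an E-combination of pairs from K, the zero t has its coordinates in every
      field containing K and E.\<close>
    have "fst t \<in> M \<and> snd t \<in> M" using t(1)
    proof (induction)
      case (hull_add t e w)
      then have "e \<in> M" "fst w \<in> M" "snd w \<in> M" using EM M(2) by auto
      then show ?case using hull_add(4) clM unfolding pair_add_def pair_smult_def by auto
    qed (use clM in auto)
    then have zyM: "z \<in> M" "y \<in> M" unfolding tzy by auto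
    have pqM: "p \<in> M" "q \<in> M" "e \<in> M" using E1 E2 E3 M(2) by auto
    have aM: "a \<in> M" "b \<in> M" "inv a \<in> M" using ab ia M(2) by auto
    let ?x = "p \<oplus> q \<otimes> inv a"
    have xM: "?x \<in> M" using pqM aM clM by auto
    have "e \<otimes> e \<ominus> a \<otimes> (?x \<otimes> ?x) = b \<otimes> (z \<otimes> z \<ominus> a \<otimes> (y \<otimes> y))"
    proof -
      define i where "i = inv a"
      have ic: "i \<in> carrier L" "a \<otimes> i = \<one>" unfolding i_def using acc ia by auto
      have "e \<otimes> e \<ominus> a \<otimes> ((p \<oplus> q \<otimes> i) \<otimes> (p \<oplus> q \<otimes> i))
        = g0 \<oplus> (p \<otimes> q \<oplus> p \<otimes> q) \<ominus> a \<otimes> (p \<otimes> p) \<ominus> (a \<otimes> i) \<otimes> (p \<otimes> q \<oplus> p \<otimes> q) \<ominus> (a \<otimes> i) \<otimes> (i \<otimes> (q \<otimes> q))"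
        unfolding e(2) w_def a_minus_def using p(1) q(1) ic(1) gc acc
        by (simp add: l_distr r_distr minus_add m_ac a_ac)
      also have "\<dots> = g2 \<otimes> i \<oplus> (g1 \<otimes> a \<oplus> (g0 \<otimes> \<one> \<oplus> \<zero>))"
        unfolding ic(2) p(2) q(2) using p(1) q(1) ic(1) gc acc by algebra
      also have "\<dots> = b \<otimes> (z \<otimes> z) \<oplus> ?c \<otimes> (y \<otimes> y)" unfolding i_def ftg ..
      also have "\<dots> = b \<otimes> (z \<otimes> z \<ominus> a \<otimes> (y \<otimes> y))" using zyc acc by algebra
      finally show ?thesis unfolding i_def .
    qed
    then show ?thesis
      using norm_form_of_isotropic[OF M(1) aM(1,2) pqM(3) xM zyM ab(3) _ two] t(2) unfolding tzy by auto
  qed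
  then show ?thesis using tower3 m n3 unfolding r_def
    by (intro exI[of _ "Suc (Suc (Suc m))"] conjI exI[of _ ?E3]) auto
qed

text \<open>A relation among 1/a, a, 1 makes a a root of a polynomial of degree at most two over F.
  One square root puts a into the tower and another makes it a square, where the norm form
  represents everything. The roots are affordable: a \<notin> F forces n \<ge> 2, and for a \<in> F
  only the second one is taken.\<close>

lemma norm_form_dependent:
  assumes F: "subfield F L" and K: "subfield K L" "F \<subseteq> K" "dimension n F K"
    and two: "\<one> \<oplus> \<one> \<noteq> \<zero>" and ab: "a \<in> K" "b \<in> K" "a \<noteq> \<zero>"
    and dep: "dependent F [inv a, a, \<one>]"
  shows "\<exists>m\<le>n. \<exists>E. quadratic_tower F m E \<and>
    (\<forall>M. subfield M L \<longrightarrow> K \<union> E \<subseteq> M \<longrightarrow> (\<exists>u\<in>M. \<exists>v\<in>M. b = u \<otimes> u \<ominus> a \<otimes> (v \<otimes> v)))"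
proof -
  have Kr: "subring K L" using subfieldE(1)[OF K(1)] .
  note clK = subringE(3,5,6,7)[OF Kr]
  have Kc: "K \<subseteq> carrier L" using subringE(1)[OF Kr] .
  have Fr: "subring F L" using subfieldE(1)[OF F] .
  have Fc: "F \<subseteq> carrier L" using subringE(1)[OF Fr] .
  note clF = subringE(2,3,5,6,7)[OF Fr]
  have acc: "a \<in> carrier L" "b \<in> carrier L" using ab Kc by auto
  obtain s where s: "s \<in> carrier L" "s \<otimes> s = a" using exists_square_root[OF acc(1)] .
  have fin: ?thesis if E: "quadratic_tower F m E" "a \<in> E" and m: "Suc m \<le> n" for m E
  proof -
    have Es: "subfield E L" using quadratic_tower_subfield[OF E(1) F] by auto
    have sE: "s \<otimes> s \<in> E" using s(2) E(2) by simp
    let ?E = "line_extension E s E"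
    have "s \<in> ?E" using quadratic_extension_incl(2)[OF Es s(1) sE] .
    moreover have "s \<noteq> \<zero>" using s ab(3) by auto
    ultimately have "\<exists>u\<in>M. \<exists>v\<in>M. b = u \<otimes> u \<ominus> a \<otimes> (v \<otimes> v)" if M: "subfield M L" "K \<union> ?E \<subseteq> M" for M
      using norm_form_of_square[OF M(1) _ _ _ two, of s b] M(2) ab(2) unfolding s(2) by auto
    then show ?thesis using tower_step[OF E(1) s(1) sE] m by blast
  qed
  have S1: "Span F [\<one>] = F"
  proof -
    have "x \<in> Span F [\<one>] \<longleftrightarrow> (\<exists>k\<in>F. x = k \<otimes> \<one> \<oplus> \<zero>)" for x by (simp add: line_extension_mem_iff)
    moreover have "k \<otimes> \<one> \<oplus> \<zero> = k" if "k \<in> F" for k using that Fc by auto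
    ultimately show ?thesis by auto
  qed
  have i1: "independent F [\<one>]" using li_Cons[of \<one> F "[]"] by simp
  show ?thesis
  proof (cases "a \<in> F")
    case True
    have "1 \<le> n" using independent_length_le_dimension[OF F K(3) i1] clK by simp
    then show ?thesis using fin[OF tower_base True] by simp
  next
    case False
    have i2: "independent F [a, \<one>]" using li_Cons[OF acc(1) _ i1] False unfolding S1 by simp
    have n2: "2 \<le> n" using independent_length_le_dimension[OF F K(3) i2] clK ab by simp
    have iac: "inv a \<in> carrier L" "inv a \<otimes> a = \<one>" using subfield_inv_mem[OF K(1) ab(1,3)] Kc by auto
    have "inv a \<in> Span F [a, \<one>]" using dep li_Cons[OF iac(1) _ i2] by blast
    then obtain c d where cd: "c \<in> F" "d \<in> F" "inv a = c \<otimes> a \<oplus> (d \<otimes> \<one> \<oplus> \<zero>)"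
      by (auto simp: line_extension_mem_iff)
    have cc: "c \<in> carrier L" "d \<in> carrier L" using cd Fc by auto
    have eq: "c \<otimes> (a \<otimes> a) \<oplus> d \<otimes> a = \<one>"
    proof -
      have "c \<otimes> (a \<otimes> a) \<oplus> d \<otimes> a = (c \<otimes> a \<oplus> (d \<otimes> \<one> \<oplus> \<zero>)) \<otimes> a" using cc acc by algebra
      then show ?thesis unfolding cd(3)[symmetric] using iac by simp
    qed
    \<comment> \<open>Otherwise d a = 1, which would put a into F.\<close>
    have cn: "c \<noteq> \<zero>"
    proof
      assume c0: "c = \<zero>"
      have da: "d \<otimes> a = \<one>" using eq acc cc unfolding c0 by simp
      then have dn: "d \<noteq> \<zero>" using acc by auto
      have "a = inv d"
        using da acc cc dn by (metis comm_inv_char m_comm)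
      then show False using False subfield_inv_mem(1)[OF F cd(2) dn] by simp
    qed
    let ?t = "\<one> \<oplus> \<one>"
    \<comment> \<open>Completing the square in c a^2 + d a = 1: the square of 2 c a + d is 4 c +
      d^2, which lies in F.\<close>
    define s1 where "s1 = ?t \<otimes> c \<otimes> a \<oplus> d"
    have s1c: "s1 \<in> carrier L" unfolding s1_def using cc acc by auto
    have "s1 \<otimes> s1 = ?t \<otimes> ?t \<otimes> c \<otimes> (c \<otimes> (a \<otimes> a) \<oplus> d \<otimes> a) \<oplus> d \<otimes> d"
      unfolding s1_def using cc acc by algebra
    then have "s1 \<otimes> s1 = ?t \<otimes> ?t \<otimes> c \<otimes> \<one> \<oplus> d \<otimes> d" unfolding eq .
    then have s1F: "s1 \<otimes> s1 \<in> F" using cd clF by auto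
    let ?E = "line_extension F s1 F"
    have E: "subfield ?E L" "F \<subseteq> ?E" "s1 \<in> ?E"
      using quadratic_extension_subfield[OF F s1c s1F] quadratic_extension_incl[OF F s1c s1F] by auto
    have tc: "?t \<otimes> c \<in> F" "?t \<otimes> c \<noteq> \<zero>" using cd clF two cn cc by (auto simp: integral_iff)
    define i where "i = inv (?t \<otimes> c)"
    have i: "i \<in> F" "i \<otimes> (?t \<otimes> c) = \<one>" unfolding i_def using subfield_inv_mem[OF F tc] by auto
    have ic: "i \<in> carrier L" using i Fc by auto
    have "i \<otimes> (s1 \<oplus> \<ominus> d) = i \<otimes> (?t \<otimes> c) \<otimes> a" unfolding s1_def using cc acc ic by algebra
    then have "a = i \<otimes> (s1 \<oplus> \<ominus> d)" unfolding i(2) using acc by simp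
    moreover have "i \<in> ?E" "d \<in> ?E" using i(1) cd(2) E(2) by auto
    ultimately have "a \<in> ?E" using E(3) subringE(5,6,7)[OF subfieldE(1)[OF E(1)]] by auto
    moreover have "quadratic_tower F (Suc 0) ?E" using tower_step[OF tower_base s1c s1F] .
    ultimately show ?thesis using fin[of "Suc 0" ?E] n2 by auto
  qed
qed

end

section \<open>Quaternion bases\<close>

text \<open>The base field appears as its copy S in the centre, so the algebra is just a ring with a
  distinguished subfield and scalars act by ring multiplication.\<close>

locale degree_two_algebra = ring R for R (structure) +
  fixes S
  assumes S: "subfield S R" and center: "ring_center R = S" and simple: "simple_ring R"
    and dim4: "dimension 4 S (carrier R)" and two: "\<one> \<oplus> \<one> \<noteq> \<zero>"
begin

lemma Sr: "subring S R" using subfieldE(1)[OF S] .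

lemma S_carrier: "s \<in> S \<Longrightarrow> s \<in> carrier R"
  using subringE(1)[OF Sr] by auto

lemma S_comm: "\<lbrakk>s \<in> S; x \<in> carrier R\<rbrakk> \<Longrightarrow> s \<otimes> x = x \<otimes> s"
  using center unfolding ring_center_def by blast

lemma S_lcomm: "\<lbrakk>s \<in> S; x \<in> carrier R; y \<in> carrier R\<rbrakk> \<Longrightarrow> x \<otimes> (s \<otimes> y) = s \<otimes> (x \<otimes> y)"
  using S_comm S_carrier by (metis m_assoc)

lemma S_closed:
  "\<zero> \<in> S" "\<one> \<in> S" "\<And>s. s \<in> S \<Longrightarrow> \<ominus> s \<in> S"
  "\<And>s t. \<lbrakk>s \<in> S; t \<in> S\<rbrakk> \<Longrightarrow> s \<oplus> t \<in> S" "\<And>s t. \<lbrakk>s \<in> S; t \<in> S\<rbrakk> \<Longrightarrow> s \<otimes> t \<in> S"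
  using subringE[OF Sr] by auto

lemma S_inverse:
  assumes "s \<in> S" "s \<noteq> \<zero>" shows "\<exists>t\<in>S. t \<otimes> s = \<one>"
  using subfield_m_inv[OF S, of s] assms by blast

lemma half: "\<exists>h\<in>S. h \<otimes> (\<one> \<oplus> \<one>) = \<one>"
  by (rule S_inverse[OF S_closed(4)[OF S_closed(2,2)] two])

lemma one_not_zero: "\<one> \<noteq> \<zero>"
  using two by auto

lemma double_zero:
  assumes "x \<in> carrier R" "x \<oplus> x = \<zero>" shows "x = \<zero>"
proof -
  obtain h where h: "h \<in> S" "h \<otimes> (\<one> \<oplus> \<one>) = \<one>" using half by auto
  have "x = (h \<otimes> (\<one> \<oplus> \<one>)) \<otimes> x" using h assms by simp
  also have "\<dots> = h \<otimes> (x \<oplus> x)" using assms(1) S_carrier[OF h(1)] by (simp add: m_assoc l_distr)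
  finally show ?thesis using assms S_carrier[OF h(1)] by simp
qed

lemma not_commutative: "\<exists>x\<in>carrier R. \<exists>y\<in>carrier R. x \<otimes> y \<noteq> y \<otimes> x"
proof (rule ccontr)
  assume "\<not> ?thesis"
  then have "ring_center R = carrier R" unfolding ring_center_def by auto
  then have "dimension 1 S (carrier R)" using center dimension_one[OF S] by simp
  from dimension_is_inj[OF S dim4 this] show False by simp
qed

lemma span_four:
  assumes "set [w, x, y, z] \<subseteq> carrier R" "v \<in> Span S [w, x, y, z]"
  shows "\<exists>a\<in>S. \<exists>b\<in>S. \<exists>c\<in>S. \<exists>d\<in>S. v = a \<otimes> w \<oplus> (b \<otimes> x \<oplus> (c \<otimes> y \<oplus> d \<otimes> z))"
proof -
  obtain a b c d where "a \<in> S" "b \<in> S" "c \<in> S" "d \<in> S"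
    "v = a \<otimes> w \<oplus> (b \<otimes> x \<oplus> (c \<otimes> y \<oplus> (d \<otimes> z \<oplus> \<zero>)))"
    using assms(2) by (auto simp: line_extension_mem_iff)
  moreover from this have "d \<otimes> z \<oplus> \<zero> = d \<otimes> z" using assms(1) S_carrier by simp
  ultimately show ?thesis by metis
qed

lemma independent_fourI:
  assumes c: "set [w, x, y, z] \<subseteq> carrier R"
    and ind: "\<And>a b c d. \<lbrakk>a \<in> S; b \<in> S; c \<in> S; d \<in> S;
      a \<otimes> w \<oplus> (b \<otimes> x \<oplus> (c \<otimes> y \<oplus> d \<otimes> z)) = \<zero>\<rbrakk> \<Longrightarrow> a = \<zero> \<and> b = \<zero> \<and> c = \<zero> \<and> d = \<zero>"
  shows "independent S [w, x, y, z]"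
proof -
  have m1: "\<ominus> \<one> \<in> S" using S_closed by auto
  have m1n: "\<ominus> \<one> \<noteq> \<zero>" using one_not_zero by (metis minus_minus minus_zero one_closed)
  have neg: "\<ominus> \<one> \<otimes> v \<oplus> v = \<zero>" if "v \<in> carrier R" for v
    using that by (simp add: l_minus l_neg)
  have cc: "w \<in> carrier R" "x \<in> carrier R" "y \<in> carrier R" "z \<in> carrier R" using c by auto
  have z: "z \<notin> Span S []"
    using ind[OF S_closed(1,1,1,2)] cc one_not_zero by auto
  have y: "y \<notin> Span S [z]"
  proof
    assume "y \<in> Span S [z]"
    then obtain d where "d \<in> S" "y = d \<otimes> z" using cc S_carrier by (auto simp: line_extension_mem_iff)
    then show False using ind[OF S_closed(1,1) m1, of d] neg[of y] cc S_carrier m1n by auto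
  qed
  have x: "x \<notin> Span S [y, z]"
  proof
    assume "x \<in> Span S [y, z]"
    then obtain c d where "c \<in> S" "d \<in> S" "x = c \<otimes> y \<oplus> d \<otimes> z"
      using cc S_carrier by (auto simp: line_extension_mem_iff)
    then show False using ind[OF S_closed(1) m1, of c d] neg[of x] cc S_carrier m1n by auto
  qed
  have w: "w \<notin> Span S [x, y, z]"
  proof
    assume "w \<in> Span S [x, y, z]"
    then obtain b c d where "b \<in> S" "c \<in> S" "d \<in> S" "w = b \<otimes> x \<oplus> (c \<otimes> y \<oplus> d \<otimes> z)"
      using cc S_carrier by (auto simp: line_extension_mem_iff)
    then show False using ind[OF m1, of b c d] neg[of w] cc S_carrier m1n by auto
  qed
  show ?thesis using li_Cons[OF cc(1) w li_Cons[OF cc(2) x li_Cons[OF cc(3) y li_Cons[OF cc(4) z li_Nil]]]] .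
qed

lemma independent_four_spans:
  assumes "independent S [w, x, y, z]" shows "Span S [w, x, y, z] = carrier R"
  using independent_length_eq_dimension[OF S dim4 assms] independent_in_carrier[OF assms] by simp

text \<open>Both p and g = c + d x commute with x. If g were nonzero, y would be minus the quotient
  of p by g and would commute with x as well. So 1 and y are left independent over the centraliser
  of x, and c + d x = 0 forces c = d = 0 because x is not central.\<close>

lemma division_independent:
  assumes div: "\<And>x. \<lbrakk>x \<in> carrier R; x \<noteq> \<zero>\<rbrakk> \<Longrightarrow> \<exists>y\<in>carrier R. y \<otimes> x = \<one>"
    and x: "x \<in> carrier R" and y: "y \<in> carrier R" and nc: "x \<otimes> y \<noteq> y \<otimes> x"
    and c: "c \<in> S" "d \<in> S" and p: "p \<in> carrier R" "p \<otimes> x = x \<otimes> p" "p \<oplus> (c \<otimes> y \<oplus> d \<otimes> (x \<otimes> y)) = \<zero>"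
  shows "p = \<zero> \<and> c = \<zero> \<and> d = \<zero>"
proof -
  have cc: "c \<in> carrier R" "d \<in> carrier R" using c S_carrier by auto
  define g where "g = c \<oplus> d \<otimes> x"
  have gc: "g \<in> carrier R" unfolding g_def using cc x by simp
  have gx: "g \<otimes> x = x \<otimes> g" unfolding g_def using cc x c S_comm S_lcomm by (simp add: l_distr r_distr m_assoc)
  have eq: "p \<oplus> g \<otimes> y = \<zero>" using p(3) cc x y p(1) unfolding g_def by (simp add: l_distr m_assoc)
  have xS: "x \<notin> S" using nc S_comm y by auto
  have g0: "g = \<zero>"
  proof (rule ccontr)
    assume "g \<noteq> \<zero>"
    then obtain h where h: "h \<in> carrier R" "h \<otimes> g = \<one>" using div[OF gc] by auto
    have hn: "h \<noteq> \<zero>" using h gc one_not_zero by auto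
    \<comment> \<open>The hypothesis \<open>div\<close> only provides left inverses. A left inverse
      k of h coincides with g, which makes h a two-sided inverse of g.\<close>
    obtain k where k: "k \<in> carrier R" "k \<otimes> h = \<one>" using div[OF h(1) hn] by auto
    have "(k \<otimes> h) \<otimes> g = k \<otimes> (h \<otimes> g)" by (rule m_assoc) (use k h gc in auto)
    then have "g = k" using k h gc by simp
    then have gh: "g \<otimes> h = \<one>" using k by simp
    have hx: "h \<otimes> x = x \<otimes> h"
    proof -
      have "h \<otimes> x = h \<otimes> (x \<otimes> g) \<otimes> h" using gh h gc x by (simp add: m_assoc)
      also have "\<dots> = (h \<otimes> g) \<otimes> (x \<otimes> h)" unfolding gx[symmetric] using h(1) gc x by (simp add: m_assoc)
      finally show ?thesis using h x by simp
    qed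
    have "g \<otimes> y = \<ominus> p" using eq gc y p(1) by (metis a_comm m_closed minus_equality)
    then have yp: "y = h \<otimes> \<ominus> p" using h gc y by (metis l_one m_assoc)
    have "x \<otimes> y = h \<otimes> \<ominus> (x \<otimes> p)" unfolding yp using h hx x p(1)
      by (metis a_inv_closed m_assoc r_minus)
    also have "\<dots> = y \<otimes> x" unfolding yp p(2)[symmetric] using h x p(1) by (simp add: m_assoc l_minus)
    finally show False using nc by simp
  qed
  have d0: "d = \<zero>"
  proof (rule ccontr)
    assume "d \<noteq> \<zero>"
    then obtain t where t: "t \<in> S" "t \<otimes> d = \<one>" using S_inverse[OF c(2)] by blast
    have tc: "t \<in> carrier R" using t S_carrier by auto
    have "d \<otimes> x = \<ominus> c" using g0 cc x unfolding g_def by (metis a_comm m_closed minus_equality)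
    then have "x = t \<otimes> \<ominus> c" using t tc cc x by (metis l_one m_assoc)
    then show False using xS t c S_closed by auto
  qed
  have "c = \<zero>" using g0 d0 cc x unfolding g_def by simp
  then show ?thesis using d0 g0 eq p y by simp
qed

text \<open>The vectors 1, x, y, x y form a basis. Since x^2 commutes with x, its components along y
  and x y vanish, and x^2 = a + b x; then x - b/2 has a central square.\<close>

lemma exists_square_in_center:
  assumes div: "\<And>x. \<lbrakk>x \<in> carrier R; x \<noteq> \<zero>\<rbrakk> \<Longrightarrow> \<exists>y\<in>carrier R. y \<otimes> x = \<one>"
  shows "\<exists>i\<in>carrier R. i \<otimes> i \<in> S \<and> i \<notin> S"
proof -
  obtain x y where x: "x \<in> carrier R" and y: "y \<in> carrier R" and nc: "x \<otimes> y \<noteq> y \<otimes> x"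
    using not_commutative by auto
  have xS: "x \<notin> S" using nc S_comm y by auto
  have ind: "independent S [\<one>, x, y, x \<otimes> y]"
  proof (rule independent_fourI)
    fix a b c d assume S4: "a \<in> S" "b \<in> S" "c \<in> S" "d \<in> S"
      and eq: "a \<otimes> \<one> \<oplus> (b \<otimes> x \<oplus> (c \<otimes> y \<oplus> d \<otimes> (x \<otimes> y))) = \<zero>"
    have cc: "a \<in> carrier R" "b \<in> carrier R" "c \<in> carrier R" "d \<in> carrier R" using S4 S_carrier by auto
    have e1: "(a \<oplus> b \<otimes> x) \<oplus> (c \<otimes> y \<oplus> d \<otimes> (x \<otimes> y)) = \<zero>" using eq cc x y by (simp add: a_assoc)
    have e2: "(a \<oplus> b \<otimes> x) \<otimes> x = x \<otimes> (a \<oplus> b \<otimes> x)"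
      using cc x S4 S_comm S_lcomm by (simp add: l_distr r_distr m_assoc)
    have "a \<oplus> b \<otimes> x \<in> carrier R" using cc x by simp
    from division_independent[OF div x y nc S4(3,4) this e2 e1]
    have z: "a \<oplus> b \<otimes> x = \<zero> \<and> c = \<zero> \<and> d = \<zero>" by simp
    have "b = \<zero>"
    proof (rule ccontr)
      assume "b \<noteq> \<zero>"
      then obtain t where t: "t \<in> S" "t \<otimes> b = \<one>" using S_inverse[OF S4(2)] by blast
      have tc: "t \<in> carrier R" using t S_carrier by auto
      have "b \<otimes> x = \<ominus> a" using z cc x by (metis a_comm m_closed minus_equality)
      then have "x = t \<otimes> \<ominus> a" using t tc cc x by (metis l_one m_assoc)
      then show False using xS t S4 S_closed by auto
    qed
    then show "a = \<zero> \<and> b = \<zero> \<and> c = \<zero> \<and> d = \<zero>" using z cc x by simp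
  qed (use x y in auto)
  have sp: "x \<otimes> x \<in> Span S [\<one>, x, y, x \<otimes> y]" using independent_four_spans[OF ind] x by simp
  obtain a b c d where S4: "a \<in> S" "b \<in> S" "c \<in> S" "d \<in> S"
    and eq: "x \<otimes> x = a \<otimes> \<one> \<oplus> (b \<otimes> x \<oplus> (c \<otimes> y \<oplus> d \<otimes> (x \<otimes> y)))"
    using span_four[OF _ sp] x y by auto
  have cc: "a \<in> carrier R" "b \<in> carrier R" "c \<in> carrier R" "d \<in> carrier R" using S4 S_carrier by auto
  \<comment> \<open>The part of the relation that commutes with x, as
    \<open>division_independent\<close> requires.\<close>
  let ?p = "(a \<oplus> b \<otimes> x) \<ominus> x \<otimes> x"
  have pc: "?p \<in> carrier R" using cc x by simp
  have e1: "?p \<oplus> (c \<otimes> y \<oplus> d \<otimes> (x \<otimes> y)) = \<zero>"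
  proof -
    have "?p \<oplus> (c \<otimes> y \<oplus> d \<otimes> (x \<otimes> y)) = (a \<otimes> \<one> \<oplus> (b \<otimes> x \<oplus> (c \<otimes> y \<oplus> d \<otimes> (x \<otimes> y)))) \<ominus> x \<otimes> x"
      unfolding a_minus_def using cc x y by (simp add: a_ac)
    then show ?thesis unfolding eq[symmetric] using x by (simp add: a_minus_def r_neg)
  qed
  have e2: "?p \<otimes> x = x \<otimes> ?p"
    using cc x S4 S_comm S_lcomm by (simp add: a_minus_def l_distr r_distr m_assoc l_minus r_minus)
  have "c = \<zero> \<and> d = \<zero>"
    using division_independent[OF div x y nc S4(3,4) pc e2 e1] by simp
  then have xx: "x \<otimes> x = a \<oplus> b \<otimes> x" using eq cc x y by simp
  obtain h where h: "h \<in> S" "h \<otimes> (\<one> \<oplus> \<one>) = \<one>" using half by auto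
  have hc: "h \<in> carrier R" using h S_carrier by auto
  define g where "g = \<ominus> (h \<otimes> b)"
  have g: "g \<in> S" "g \<in> carrier R" unfolding g_def using h S4 S_closed S_carrier by auto
  have gg: "g \<oplus> g = \<ominus> b"
  proof -
    have "g \<oplus> g = \<ominus> ((h \<otimes> (\<one> \<oplus> \<one>)) \<otimes> b)" unfolding g_def using hc cc
      by (simp add: r_distr l_distr minus_add)
    then show ?thesis using h cc by simp
  qed
  let ?i = "x \<oplus> g"
  have "?i \<otimes> ?i = (x \<otimes> x \<oplus> (g \<oplus> g) \<otimes> x) \<oplus> g \<otimes> g"
    using x g S_comm[OF g(1) x] by (simp add: l_distr r_distr a_ac)
  also have "\<dots> = a \<oplus> g \<otimes> g" unfolding gg xx using cc x g by (simp add: l_minus r_neg a_assoc)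
  finally have "?i \<otimes> ?i \<in> S" using S4 g S_closed by simp
  moreover have "?i \<notin> S"
  proof
    assume "?i \<in> S"
    then have "?i \<oplus> \<ominus> g \<in> S" using g S_closed by simp
    moreover have "?i \<oplus> \<ominus> g = x" using x g by (simp add: a_assoc r_neg)
    ultimately show False using xS by simp
  qed
  ultimately show ?thesis using x g by (intro bexI[of _ ?i]) auto
qed

definition quaternion_basis :: "'a \<Rightarrow> 'a \<Rightarrow> 'a \<Rightarrow> 'a \<Rightarrow> bool"
  where "quaternion_basis a b i j \<longleftrightarrow> a \<in> S \<and> b \<in> S \<and> a \<noteq> \<zero> \<and> b \<noteq> \<zero> \<and>
    i \<in> carrier R \<and> j \<in> carrier R \<and> i \<otimes> i = a \<and> j \<otimes> j = b \<and> j \<otimes> i = \<ominus> (i \<otimes> j) \<and>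
    independent S [\<one>, i, j, i \<otimes> j]"

text \<open>Let i be noncentral with central square, and y not commuting with i. The commutator j =
  y i - i y anticommutes with i because i^2 is central. Then j^2 commutes with i, so j^2 = c0 + c1
  i; it also commutes with j, while i anticommutes with j, and this leaves c1 = 0.\<close>

lemma quaternion_basis_division:
  assumes div: "\<And>x. \<lbrakk>x \<in> carrier R; x \<noteq> \<zero>\<rbrakk> \<Longrightarrow> \<exists>y\<in>carrier R. y \<otimes> x = \<one>"
  shows "\<exists>a b i j. quaternion_basis a b i j"
proof -
  have integral: "x = \<zero> \<or> y = \<zero>" if xy: "x \<in> carrier R" "y \<in> carrier R" "x \<otimes> y = \<zero>" for x y
  proof (cases "x = \<zero>")
    case False
    then obtain z where z: "z \<in> carrier R" "z \<otimes> x = \<one>" using div[OF xy(1)] by auto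
    have "y = z \<otimes> (x \<otimes> y)" using z xy(1,2) by (simp add: m_assoc[symmetric])
    then show ?thesis using xy(3) z by simp
  qed simp
  obtain i where i: "i \<in> carrier R" "i \<otimes> i \<in> S" "i \<notin> S" using exists_square_in_center[OF div] by auto
  obtain y where y: "y \<in> carrier R" "i \<otimes> y \<noteq> y \<otimes> i" using i(1,3) center unfolding ring_center_def by auto
  define a where "a = i \<otimes> i"
  have aS: "a \<in> S" "a \<in> carrier R" unfolding a_def using i by auto
  have in0: "i \<noteq> \<zero>" using i(3) S_closed by auto
  then have an: "a \<noteq> \<zero>" unfolding a_def using integral i(1) by blast
  define j where "j = y \<otimes> i \<ominus> i \<otimes> y"
  have jc: "j \<in> carrier R" unfolding j_def using i y by simp
  have ay: "i \<otimes> (i \<otimes> y) = y \<otimes> a" "i \<otimes> i = a"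
    using S_comm[OF aS(1) y(1)] i(1) y(1) unfolding a_def by (simp_all add: m_assoc)
  have ji: "j \<otimes> i = \<ominus> (i \<otimes> j)"
    unfolding j_def using i(1) y(1) aS(2) ay
    by (simp add: a_minus_def l_distr r_distr l_minus r_minus m_assoc minus_add a_ac)
  have jn: "j \<noteq> \<zero>" unfolding j_def using y(2) i(1) y(1) by (metis m_closed r_right_minus_eq)
  have ijn: "i \<otimes> j \<noteq> \<zero>" using integral i(1) jc in0 jn by blast
  have nc: "i \<otimes> j \<noteq> j \<otimes> i"
  proof
    assume "i \<otimes> j = j \<otimes> i"
    then have "i \<otimes> j \<oplus> i \<otimes> j = \<zero>" using ji i(1) jc by (metis m_closed r_neg)
    from double_zero[OF m_closed[OF i(1) jc] this] show False using ijn by simp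
  qed
  have ind: "independent S [\<one>, i, j, i \<otimes> j]"
  proof (rule independent_fourI)
    fix c0 c1 c2 c3 assume S4: "c0 \<in> S" "c1 \<in> S" "c2 \<in> S" "c3 \<in> S"
      and eq: "c0 \<otimes> \<one> \<oplus> (c1 \<otimes> i \<oplus> (c2 \<otimes> j \<oplus> c3 \<otimes> (i \<otimes> j))) = \<zero>"
    have cc: "c0 \<in> carrier R" "c1 \<in> carrier R" "c2 \<in> carrier R" "c3 \<in> carrier R" using S4 S_carrier by auto
    have e1: "(c0 \<oplus> c1 \<otimes> i) \<oplus> (c2 \<otimes> j \<oplus> c3 \<otimes> (i \<otimes> j)) = \<zero>" using eq cc i(1) jc by (simp add: a_assoc)
    have e2: "(c0 \<oplus> c1 \<otimes> i) \<otimes> i = i \<otimes> (c0 \<oplus> c1 \<otimes> i)"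
      using cc i(1) S4 S_comm S_lcomm by (simp add: l_distr r_distr m_assoc)
    have "c0 \<oplus> c1 \<otimes> i \<in> carrier R" using cc i(1) by simp
    from division_independent[OF div i(1) jc nc S4(3,4) this e2 e1]
    have z: "c0 \<oplus> c1 \<otimes> i = \<zero> \<and> c2 = \<zero> \<and> c3 = \<zero>" by simp
    have "c1 = \<zero>"
    proof (rule ccontr)
      assume "c1 \<noteq> \<zero>"
      then obtain t where t: "t \<in> S" "t \<otimes> c1 = \<one>" using S_inverse[OF S4(2)] by blast
      have tc: "t \<in> carrier R" using t S_carrier by auto
      have "c1 \<otimes> i = \<ominus> c0" using z cc i(1) by (metis a_comm m_closed minus_equality)
      then have "i = t \<otimes> \<ominus> c0" using t tc cc i(1) by (metis l_one m_assoc)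
      then show False using i(3) t S4 S_closed by auto
    qed
    then show "c0 = \<zero> \<and> c1 = \<zero> \<and> c2 = \<zero> \<and> c3 = \<zero>" using z cc i(1) by simp
  qed (use i jc in auto)
  have sp: "j \<otimes> j \<in> Span S [\<one>, i, j, i \<otimes> j]" using independent_four_spans[OF ind] jc by simp
  obtain c0 c1 c2 c3 where S4: "c0 \<in> S" "c1 \<in> S" "c2 \<in> S" "c3 \<in> S"
    and eq: "j \<otimes> j = c0 \<otimes> \<one> \<oplus> (c1 \<otimes> i \<oplus> (c2 \<otimes> j \<oplus> c3 \<otimes> (i \<otimes> j)))"
    using span_four[OF _ sp] i(1) jc by auto
  have cc: "c0 \<in> carrier R" "c1 \<in> carrier R" "c2 \<in> carrier R" "c3 \<in> carrier R" using S4 S_carrier by auto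
  let ?p = "(c0 \<oplus> c1 \<otimes> i) \<ominus> j \<otimes> j"
  have pc: "?p \<in> carrier R" using cc i(1) jc by simp
  have e1: "?p \<oplus> (c2 \<otimes> j \<oplus> c3 \<otimes> (i \<otimes> j)) = \<zero>"
  proof -
    have "?p \<oplus> (c2 \<otimes> j \<oplus> c3 \<otimes> (i \<otimes> j)) = (c0 \<otimes> \<one> \<oplus> (c1 \<otimes> i \<oplus> (c2 \<otimes> j \<oplus> c3 \<otimes> (i \<otimes> j)))) \<ominus> j \<otimes> j"
      unfolding a_minus_def using cc i(1) jc by (simp add: a_ac)
    then show ?thesis unfolding eq[symmetric] using jc by (simp add: a_minus_def r_neg)
  qed
  have e2: "?p \<otimes> i = i \<otimes> ?p"
  proof -
    have "(j \<otimes> j) \<otimes> i = j \<otimes> \<ominus> (i \<otimes> j)" using ji i(1) jc by (simp add: m_assoc)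
    also have "\<dots> = \<ominus> (j \<otimes> i) \<otimes> j" using i(1) jc by (simp add: m_assoc l_minus r_minus)
    also have "\<dots> = i \<otimes> (j \<otimes> j)" unfolding ji using i(1) jc by (simp add: m_assoc)
    finally have jji: "(j \<otimes> j) \<otimes> i = i \<otimes> (j \<otimes> j)" .
    show ?thesis unfolding a_minus_def
      using cc i(1) jc S4 S_comm S_lcomm jji by (simp add: l_distr r_distr m_assoc l_minus r_minus)
  qed
  have "c2 = \<zero> \<and> c3 = \<zero>"
    using division_independent[OF div i(1) jc nc S4(3,4) pc e2 e1] by simp
  then have jj: "j \<otimes> j = c0 \<oplus> c1 \<otimes> i" using eq cc i(1) jc by simp
  have "c1 \<otimes> (i \<otimes> j) \<oplus> c1 \<otimes> (i \<otimes> j) = \<zero>"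
  proof -
    have "(j \<otimes> j) \<otimes> j = j \<otimes> (j \<otimes> j)" using jc by (simp add: m_assoc)
    then have "c0 \<otimes> j \<oplus> c1 \<otimes> (i \<otimes> j) = c0 \<otimes> j \<oplus> c1 \<otimes> (j \<otimes> i)"
      unfolding jj using cc i(1) jc
      by (simp add: l_distr r_distr m_assoc S_lcomm[OF S4(2)] S_comm[OF S4(1) jc])
    then have "c1 \<otimes> (i \<otimes> j) = \<ominus> (c1 \<otimes> (i \<otimes> j))" unfolding ji using cc i(1) jc by (simp add: r_minus)
    then show ?thesis using cc i(1) jc by (metis m_closed r_neg)
  qed
  from double_zero[OF m_closed[OF cc(2) m_closed[OF i(1) jc]] this] have "c1 \<otimes> (i \<otimes> j) = \<zero>" .
  then have "c1 = \<zero>" using integral cc(2) ijn i(1) jc by (metis m_closed)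
  then have "j \<otimes> j = c0" using jj cc i(1) by simp
  moreover have "j \<otimes> j \<noteq> \<zero>" using integral[OF jc jc] jn by auto
  ultimately have "quaternion_basis a c0 i j"
    unfolding quaternion_basis_def using aS an S4(1) i(1) jc a_def ji ind by auto
  then show ?thesis by blast
qed

end

section \<open>Left ideals, zero divisors and matrix units\<close>

context degree_two_algebra
begin

lemma combine_mult_right:
  assumes "set Ks \<subseteq> carrier R" "set Us \<subseteq> carrier R" "x \<in> carrier R"
  shows "combine Ks (map (\<lambda>u. u \<otimes> x) Us) = combine Ks Us \<otimes> x"
  using assms by (induction Ks Us rule: combine.induct) (auto simp: l_distr m_assoc)

definition left_annihilator :: "'a \<Rightarrow> 'a set"
  where "left_annihilator x = {q \<in> carrier R. q \<otimes> x = \<zero>}"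

definition left_multiples :: "'a \<Rightarrow> 'a set"
  where "left_multiples x = (\<lambda>q. q \<otimes> x) ` carrier R"

text \<open>Rank and nullity of the map q |-> q x, which is S-linear because scalars act from the
  left. A basis of the kernel is completed to one of the algebra, and the added vectors are mapped
  to a basis of the image.\<close>

lemma annihilator_multiples_dimension:
  assumes x: "x \<in> carrier R"
  shows "\<exists>d e. d + e = 4 \<and> dimension d S (left_multiples x) \<and> dimension e S (left_annihilator x)"
proof -
  let ?A = "left_annihilator x"
  have Ac: "?A \<subseteq> carrier R" unfolding left_annihilator_def by auto
  have "subalgebra S ?A R"
  proof (unfold_locales)
    show "inv\<^bsub>add_monoid R\<^esub> q \<in> ?A" if "q \<in> ?A" for q
    proof -
      have "\<ominus> q \<in> ?A" using that x unfolding left_annihilator_def by (simp add: l_minus)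
      then show ?thesis unfolding a_inv_def .
    qed
  qed (use x S_carrier in \<open>auto simp: left_annihilator_def l_distr m_assoc\<close>)
  then have "finite_dimension S ?A"
    using subalbegra_incl_imp_finite_dimension[OF S finite_dimensionI[OF dim4] _ Ac] by simp
  then obtain e where e: "dimension e S ?A" by auto
  obtain As where As: "set As \<subseteq> carrier R" "independent S As" "length As = e" "Span S As = ?A"
    using exists_base[OF S e] by auto
  obtain Bs where Bs: "length (Bs @ As) = 4" "independent S (Bs @ As)" "Span S (Bs @ As) = carrier R"
    using complete_base[OF S dim4 As(2,1)] by auto
  have Bc: "set Bs \<subseteq> carrier R" using independent_in_carrier[OF Bs(2)] by auto
  have inter: "Span S Bs \<inter> ?A = {\<zero>}" using independent_split(3)[OF S Bs(2)] As(4) by simp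
  have indB: "independent S Bs" using independent_split(2)[OF S Bs(2)] .
  let ?V = "map (\<lambda>u. u \<otimes> x) Bs"
  have Vc: "set ?V \<subseteq> carrier R" using Bc x by auto
  have Sc: "set Ks \<subseteq> carrier R" if "set Ks \<subseteq> S" for Ks using that S_carrier by auto
  have indV: "independent S ?V"
  proof (rule trivial_combine_imp_independent[OF S Vc])
    fix Ks assume Ks: "set Ks \<subseteq> S" "combine Ks ?V = \<zero>"
    have z: "combine Ks Bs \<otimes> x = \<zero>" using combine_mult_right[OF Sc[OF Ks(1)] Bc x] Ks(2) by simp
    have c: "combine Ks Bs \<in> carrier R" by (rule combine_in_carrier[OF Sc[OF Ks(1)] Bc])
    have "combine Ks Bs \<in> Span S Bs" using Span_eq_combine_set[OF S Bc] Ks(1) by auto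
    then have "combine Ks Bs = \<zero>" using inter z c unfolding left_annihilator_def by auto
    then show "set (take (length ?V) Ks) \<subseteq> {\<zero>}"
      using independent_imp_trivial_combine[OF S indB Ks(1)] by simp
  qed
  have "Span S ?V = left_multiples x"
  proof
    show "Span S ?V \<subseteq> left_multiples x"
    proof
      fix v assume "v \<in> Span S ?V"
      then obtain Ks where Ks: "set Ks \<subseteq> S" "v = combine Ks ?V"
        using Span_eq_combine_set[OF S Vc] by auto
      then have "v = combine Ks Bs \<otimes> x" using combine_mult_right[OF Sc[OF Ks(1)] Bc x] by simp
      moreover have "combine Ks Bs \<in> carrier R" by (rule combine_in_carrier[OF Sc[OF Ks(1)] Bc])
      ultimately show "v \<in> left_multiples x" unfolding left_multiples_def by blast
    qed
    show "left_multiples x \<subseteq> Span S ?V"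
    proof
      fix v assume "v \<in> left_multiples x"
      then obtain q where q: "q \<in> carrier R" "v = q \<otimes> x" unfolding left_multiples_def by auto
      have "q \<in> Span S Bs <+>\<^bsub>R\<^esub> Span S As"
        using q(1) Bs(3) Span_append_eq_set_add[OF S Bc As(1)] by simp
      then obtain y z where yz: "y \<in> Span S Bs" "z \<in> ?A" "q = y \<oplus> z"
        unfolding As(4) set_add_def' by auto
      have yc: "y \<in> carrier R" using yz(1) Span_subgroup_props(1)[OF S Bc] by auto
      have "v = y \<otimes> x" unfolding q(2) yz(3) using yz(2) yc x
        unfolding left_annihilator_def by (simp add: l_distr)
      moreover obtain Ks where Ks: "set Ks \<subseteq> S" "y = combine Ks Bs"
        using yz(1) Span_eq_combine_set[OF S Bc] by auto
      ultimately have "v = combine Ks ?V" using combine_mult_right[OF Sc[OF Ks(1)] Bc x] by simp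
      then show "v \<in> Span S ?V" using Span_eq_combine_set[OF S Vc] Ks(1) by auto
    qed
  qed
  then have "dimension (length Bs) S (left_multiples x)" using dimensionI[OF S indV] by simp
  then show ?thesis using e As(3) Bs(1) by auto
qed

text \<open>The elements annihilating a left ideal V form a two-sided ideal. It is proper because 1
  does not annihilate a nonzero V, hence zero by simplicity.\<close>

lemma faithful:
  assumes V: "V \<subseteq> carrier R" "\<And>q v. \<lbrakk>q \<in> carrier R; v \<in> V\<rbrakk> \<Longrightarrow> q \<otimes> v \<in> V"
    and nz: "\<exists>v\<in>V. v \<noteq> \<zero>" and q: "q \<in> carrier R" "\<And>v. v \<in> V \<Longrightarrow> q \<otimes> v = \<zero>"
  shows "q = \<zero>"
proof -
  let ?I = "{q \<in> carrier R. \<forall>v\<in>V. q \<otimes> v = \<zero>}"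
  have "ideal ?I R"
  proof (rule idealI[OF ring_axioms])
    show "subgroup ?I (add_monoid R)"
    proof (unfold_locales)
      show "inv\<^bsub>add_monoid R\<^esub> q \<in> ?I" if "q \<in> ?I" for q
      proof -
        have "\<ominus> q \<in> ?I" using that V(1) by (auto simp: l_minus subset_iff)
        then show ?thesis unfolding a_inv_def .
      qed
    qed (use V(1) in \<open>auto simp: l_distr subset_iff\<close>)
  qed (use V in \<open>auto simp: m_assoc subset_iff\<close>)
  then have "?I = {\<zero>} \<or> ?I = carrier R" using simple unfolding simple_ring_def by auto
  moreover have "\<one> \<notin> ?I"
  proof
    obtain v where v: "v \<in> V" "v \<noteq> \<zero>" using nz by auto
    assume "\<one> \<in> ?I"
    then have "\<one> \<otimes> v = \<zero>" using v(1) by blast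
    moreover have "v \<in> carrier R" using v V(1) by auto
    ultimately show False using v(2) by simp
  qed
  ultimately have "?I = {\<zero>}" by blast
  then show ?thesis using q by blast
qed

text \<open>On a one-dimensional left ideal every element acts as a central scalar, so all
  commutators annihilate it. By faithfulness the algebra would be commutative, although it has
  dimension four over its centre.\<close>

lemma left_ideal_not_line:
  assumes V: "V \<subseteq> carrier R" "\<And>q v. \<lbrakk>q \<in> carrier R; v \<in> V\<rbrakk> \<Longrightarrow> q \<otimes> v \<in> V"
  shows "\<not> dimension 1 S V"
proof
  assume d: "dimension 1 S V"
  obtain Us where Us: "set Us \<subseteq> carrier R" "independent S Us" "length Us = 1" "Span S Us = V"
    using exists_base[OF S d] by auto
  then obtain v where v: "Us = [v]" by (cases Us) auto
  have vc: "v \<in> carrier R" using Us v by auto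
  have vn: "v \<noteq> \<zero>" using Us(2) unfolding v by (auto elim: independent.cases)
  have mem: "w \<in> V \<Longrightarrow> \<exists>s\<in>S. w = s \<otimes> v" for w
    using Us(4) vc S_carrier unfolding v by (auto simp: line_extension_mem_iff)
  have vV: "v \<in> V" using Span_base_incl[OF S Us(1)] Us(4) v by auto
  have "x \<otimes> y = y \<otimes> x" if xy: "x \<in> carrier R" "y \<in> carrier R" for x y
  proof -
    have z: "(x \<otimes> y \<ominus> y \<otimes> x) \<otimes> w = \<zero>" if w: "w \<in> V" for w
    proof -
      have wc: "w \<in> carrier R" using w V(1) by auto
      obtain s where s: "s \<in> S" "w = s \<otimes> v" using mem[OF w] by auto
      obtain p where p: "p \<in> S" "x \<otimes> v = p \<otimes> v" using mem[OF V(2)[OF xy(1) vV]] by auto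
      obtain q where q: "q \<in> S" "y \<otimes> v = q \<otimes> v" using mem[OF V(2)[OF xy(2) vV]] by auto
      have c: "s \<in> carrier R" "p \<in> carrier R" "q \<in> carrier R" using s p q S_carrier by auto
      have "x \<otimes> (y \<otimes> v) = q \<otimes> (p \<otimes> v)" unfolding q(2) S_lcomm[OF q(1) xy(1) vc] p(2) ..
      moreover have "y \<otimes> (x \<otimes> v) = p \<otimes> (q \<otimes> v)" unfolding p(2) S_lcomm[OF p(1) xy(2) vc] q(2) ..
      moreover have "q \<otimes> (p \<otimes> v) = p \<otimes> (q \<otimes> v)" by (rule S_lcomm[OF p(1) c(3) vc])
      ultimately have e: "x \<otimes> (y \<otimes> v) = y \<otimes> (x \<otimes> v)" by simp
      have "(x \<otimes> y \<ominus> y \<otimes> x) \<otimes> v = \<zero>"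
        using xy vc e by (simp add: a_minus_def l_distr l_minus m_assoc r_neg)
      then have "s \<otimes> ((x \<otimes> y \<ominus> y \<otimes> x) \<otimes> v) = \<zero>" using c by simp
      then show ?thesis unfolding s(2) using S_lcomm[OF s(1) _ vc, of "x \<otimes> y \<ominus> y \<otimes> x"] xy by simp
    qed
    have "x \<otimes> y \<ominus> y \<otimes> x = \<zero>"
      by (rule faithful[OF V _ _ z]) (use vV vn xy in auto)
    then show ?thesis using xy by simp
  qed
  then show False using not_commutative by auto
qed

lemma left_multiples_closed:
  assumes "x \<in> carrier R"
  shows "left_multiples x \<subseteq> carrier R" "\<And>q v. \<lbrakk>q \<in> carrier R; v \<in> left_multiples x\<rbrakk> \<Longrightarrow> q \<otimes> v \<in> left_multiples x"
proof -
  show "left_multiples x \<subseteq> carrier R" using assms unfolding left_multiples_def by auto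
  fix q v assume q: "q \<in> carrier R" "v \<in> left_multiples x"
  then obtain p where p: "p \<in> carrier R" "v = p \<otimes> x" unfolding left_multiples_def by auto
  have "q \<otimes> v = (q \<otimes> p) \<otimes> x" unfolding p(2) using q p assms by (simp add: m_assoc)
  then show "q \<otimes> v \<in> left_multiples x" unfolding left_multiples_def using q p by auto
qed

lemma left_annihilator_closed:
  assumes "x \<in> carrier R"
  shows "left_annihilator x \<subseteq> carrier R"
    "\<And>q v. \<lbrakk>q \<in> carrier R; v \<in> left_annihilator x\<rbrakk> \<Longrightarrow> q \<otimes> v \<in> left_annihilator x"
  using assms unfolding left_annihilator_def by (auto simp: m_assoc)

text \<open>The dimensions d of R x and e of the annihilator add up to 4, and neither is 1. Moreover
  d \<noteq> 0 since x \<in> R x, and d \<noteq> 4 since \<one> \<notin> R x. This leaves d = e =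
  2.\<close>

lemma singular_dimensions:
  assumes x: "x \<in> carrier R" "x \<noteq> \<zero>" and sing: "\<one> \<notin> left_multiples x"
  shows "dimension 2 S (left_multiples x)" "\<exists>q\<in>carrier R. q \<noteq> \<zero> \<and> q \<otimes> x = \<zero>"
proof -
  obtain d e where de: "d + e = 4" "dimension d S (left_multiples x)" "dimension e S (left_annihilator x)"
    using annihilator_multiples_dimension[OF x(1)] by auto
  have "x \<in> left_multiples x" unfolding left_multiples_def using x(1) by (auto intro!: image_eqI[of _ _ \<one>])
  then have "d \<noteq> 0" using de(2) dimension_zero[OF S] x(2) by (metis singletonD)
  moreover have "d \<noteq> 1" using left_ideal_not_line[OF left_multiples_closed[OF x(1)]] de(2) by metis
  moreover have "e \<noteq> 1" using left_ideal_not_line[OF left_annihilator_closed[OF x(1)]] de(3) by metis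
  moreover have "d \<noteq> 4"
  proof
    assume "d = 4"
    then obtain Us where Us: "independent S Us" "length Us = 4" "Span S Us = left_multiples x"
      using exists_base[OF S de(2)] by auto
    then have "left_multiples x = carrier R"
      using independent_length_eq_dimension[OF S dim4 Us(1)] independent_in_carrier[OF Us(1)] by auto
    then show False using sing by auto
  qed
  ultimately have de2: "d = 2" "e = 2" using de(1) by linarith+
  then show "dimension 2 S (left_multiples x)" using de(2) by simp
  obtain As where As: "set As \<subseteq> carrier R" "independent S As" "length As = 2" "Span S As = left_annihilator x"
    using exists_base[OF S de(3)] de2 by auto
  then obtain q r where q: "As = [q, r]" by (metis One_nat_def Suc_1 length_0_conv length_Suc_conv)
  have "q \<notin> Span S [r]" "q \<in> carrier R" using As(2) unfolding q by (auto elim: independent.cases)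
  moreover have "\<zero> \<in> Span S [r]" by (rule Span_subgroup_props(2)[OF S]) (use As(1) q in auto)
  ultimately have "q \<in> carrier R" "q \<noteq> \<zero>" by metis+
  moreover have "q \<in> left_annihilator x" using Span_base_incl[OF S As(1)] As(4) q by auto
  ultimately show "\<exists>q\<in>carrier R. q \<noteq> \<zero> \<and> q \<otimes> x = \<zero>" unfolding left_annihilator_def by blast
qed

text \<open>The two-dimensional left ideal V = R x plays the role of the column vectors: the algebra
  acts on it faithfully and realises all matrix units for a basis v, w. For i one takes the diagonal
  matrix with entries 1, -1, and for j the exchange of v and w, so that both squares are 1.\<close>

lemma quaternion_basis_singular:
  assumes x: "x \<in> carrier R" "x \<noteq> \<zero>" and sing: "\<one> \<notin> left_multiples x"
  shows "\<exists>i j. quaternion_basis \<one> \<one> i j"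
proof -
  let ?V = "left_multiples x"
  note V = left_multiples_closed[OF x(1)]
  have V2: "dimension 2 S ?V" using singular_dimensions(1)[OF x sing] .
  have sub: "left_multiples w \<subseteq> ?V" if "w \<in> ?V" for w
    unfolding left_multiples_def[of w] using V(2)[OF _ that] by auto
  \<comment> \<open>V is a minimal left ideal: a nonzero w \<in> V generates a left ideal inside V
    that again has dimension two.\<close>
  have full: "left_multiples w = ?V" if w: "w \<in> ?V" "w \<noteq> \<zero>" for w
  proof -
    have wc: "w \<in> carrier R" using w(1) V(1) by auto
    have "\<one> \<notin> left_multiples w" using sub[OF w(1)] sing by auto
    then have "dimension 2 S (left_multiples w)" using singular_dimensions(1)[OF wc w(2)] by auto
    then obtain Us where Us: "independent S Us" "length Us = 2" "Span S Us = left_multiples w"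
      "set Us \<subseteq> carrier R" using exists_base[OF S] by blast
    have "set Us \<subseteq> ?V" using Span_base_incl[OF S Us(4)] Us(3) sub[OF w(1)] by auto
    then show ?thesis using independent_length_eq_dimension[OF S V2 Us(1)] Us by auto
  qed
  obtain Us where Us: "set Us \<subseteq> carrier R" "independent S Us" "length Us = 2" "Span S Us = ?V"
    using exists_base[OF S V2] by auto
  then obtain v w where vw: "Us = [v, w]" by (metis One_nat_def Suc_1 length_0_conv length_Suc_conv)
  have c: "v \<in> carrier R" "w \<in> carrier R" using Us(1) vw by auto
  note ind = Us(2)[unfolded vw]
  have vS: "v \<notin> Span S [w]" using independent_backwards(1)[OF ind] .
  have wn: "w \<noteq> \<zero>" using independent_backwards(1)[OF independent_backwards(2)[OF ind]] by simp
  have spV: "\<exists>s\<in>S. \<exists>t\<in>S. y = s \<otimes> v \<oplus> t \<otimes> w" if y: "y \<in> ?V" for y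
  proof -
    have "y \<in> Span S [v, w]" using y Us(4) vw by simp
    then obtain s t where "s \<in> S" "t \<in> S" "y = s \<otimes> v \<oplus> (t \<otimes> w \<oplus> \<zero>)"
      by (auto simp: line_extension_mem_iff)
    moreover from this have "t \<otimes> w \<oplus> \<zero> = t \<otimes> w" using c S_carrier by simp
    ultimately show ?thesis by metis
  qed
  have lin: "s = \<zero> \<and> t = \<zero>" if st: "s \<in> S" "t \<in> S" "s \<otimes> v \<oplus> t \<otimes> w = \<zero>" for s t
  proof -
    have sc: "s \<in> carrier R" "t \<in> carrier R" using st S_carrier by auto
    have "combine [s, t] Us = \<zero>" unfolding vw using st sc c by simp
    then have "set (take (length Us) [s, t]) \<subseteq> {\<zero>}"
      using independent_imp_trivial_combine[OF S Us(2), of "[s, t]"] st by simp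
    then show ?thesis unfolding vw by simp
  qed
  have vn: "v \<noteq> \<zero>" using vS Span_subgroup_props(2)[OF S, of "[w]"] c(2) by force
  have vwV: "v \<in> ?V" "w \<in> ?V" using Span_base_incl[OF S Us(1)] Us(4) vw by auto
  have zeroI: "q = \<zero>" if q: "q \<in> carrier R" "q \<otimes> v = \<zero>" "q \<otimes> w = \<zero>" for q
  proof (rule faithful[OF V _ q(1)])
    fix y assume "y \<in> ?V"
    then obtain s t where st: "s \<in> S" "t \<in> S" "y = s \<otimes> v \<oplus> t \<otimes> w" using spV by blast
    have "q \<otimes> y = s \<otimes> (q \<otimes> v) \<oplus> t \<otimes> (q \<otimes> w)"
      unfolding st(3) using q(1) c S_carrier[OF st(1)] S_carrier[OF st(2)]
      by (simp add: r_distr S_lcomm[OF st(1) q(1) c(1)] S_lcomm[OF st(2) q(1) c(2)])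
    then show "q \<otimes> y = \<zero>" unfolding q(2,3) using st S_carrier by simp
  qed (use vwV vn in auto)
  have eqI: "p = q" if pq: "p \<in> carrier R" "q \<in> carrier R" "p \<otimes> v = q \<otimes> v" "p \<otimes> w = q \<otimes> w" for p q
  proof -
    have "p \<ominus> q = \<zero>"
      by (rule zeroI) (use pq c in \<open>auto simp: a_minus_def l_distr l_minus r_neg\<close>)
    then show ?thesis using pq by simp
  qed
  \<comment> \<open>Some q \<noteq> 0 kills y1, and q y2 \<noteq> 0 by faithfulness. So q y2
    generates V, and a left multiple of q sends y2 to y while still killing y1.\<close>
  have unit: "\<exists>q\<in>carrier R. q \<otimes> y1 = \<zero> \<and> q \<otimes> y2 = y"
    if y12: "y1 = v \<and> y2 = w \<or> y1 = w \<and> y2 = v" and y: "y \<in> ?V" for y1 y2 y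
  proof -
    have yc: "y1 \<in> carrier R" "y1 \<noteq> \<zero>" "y1 \<in> ?V" "y2 \<in> carrier R" "y2 \<in> ?V"
      using y12 c vn wn vwV by auto
    have "\<one> \<notin> left_multiples y1" using full[OF yc(3,2)] sing by simp
    then obtain q where q: "q \<in> carrier R" "q \<noteq> \<zero>" "q \<otimes> y1 = \<zero>"
      using singular_dimensions(2)[OF yc(1,2)] by auto
    have "q \<otimes> y2 \<noteq> \<zero>" using zeroI[OF q(1)] q y12 by auto
    then have "y \<in> left_multiples (q \<otimes> y2)" using full[OF V(2)[OF q(1) yc(5)]] y by simp
    then obtain r where r: "r \<in> carrier R" "y = r \<otimes> (q \<otimes> y2)" unfolding left_multiples_def[of "q \<otimes> y2"] by blast
    have "(r \<otimes> q) \<otimes> y1 = \<zero>" "(r \<otimes> q) \<otimes> y2 = y" using r q yc by (simp_all add: m_assoc)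
    then show ?thesis using r(1) q(1) by blast
  qed
  \<comment> \<open>The four matrix units: p1 and p3 project onto w and v, p2 sends w to v, p4 sends
    v to w, and each kills the other basis vector.\<close>
  obtain p1 where p1: "p1 \<in> carrier R" "p1 \<otimes> v = \<zero>" "p1 \<otimes> w = w" using unit[of v w w] vwV by auto
  obtain p2 where p2: "p2 \<in> carrier R" "p2 \<otimes> v = \<zero>" "p2 \<otimes> w = v" using unit[of v w v] vwV by auto
  obtain p3 where p3: "p3 \<in> carrier R" "p3 \<otimes> w = \<zero>" "p3 \<otimes> v = v" using unit[of w v v] vwV by auto
  obtain p4 where p4: "p4 \<in> carrier R" "p4 \<otimes> w = \<zero>" "p4 \<otimes> v = w" using unit[of w v w] vwV by auto
  define i where "i = p3 \<ominus> p1"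
  define j where "j = p2 \<oplus> p4"
  have ic: "i \<in> carrier R" and jc: "j \<in> carrier R" unfolding i_def j_def using p1 p2 p3 p4 by auto
  have iv: "i \<otimes> v = v" and iw: "i \<otimes> w = \<ominus> w" unfolding i_def
    using p1 p3 c by (simp_all add: a_minus_def l_distr l_minus)
  have jv: "j \<otimes> v = w" and jw: "j \<otimes> w = v" unfolding j_def using p2 p4 c by (simp_all add: l_distr)
  have ii: "i \<otimes> i = \<one>" by (rule eqI) (use ic c iv iw in \<open>auto simp: m_assoc r_minus\<close>)
  have jj: "j \<otimes> j = \<one>" by (rule eqI) (use jc c jv jw in \<open>auto simp: m_assoc\<close>)
  have ji: "j \<otimes> i = \<ominus> (i \<otimes> j)"
    by (rule eqI) (use ic jc c iv iw jv jw in \<open>auto simp: m_assoc r_minus l_minus\<close>)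
  have "independent S [\<one>, i, j, i \<otimes> j]"
  proof (rule independent_fourI)
    fix c0 c1 c2 c3 assume S4: "c0 \<in> S" "c1 \<in> S" "c2 \<in> S" "c3 \<in> S"
      and eq: "c0 \<otimes> \<one> \<oplus> (c1 \<otimes> i \<oplus> (c2 \<otimes> j \<oplus> c3 \<otimes> (i \<otimes> j))) = \<zero>"
    have cc: "c0 \<in> carrier R" "c1 \<in> carrier R" "c2 \<in> carrier R" "c3 \<in> carrier R" using S4 S_carrier by auto
    \<comment> \<open>Applying the relation to v and to w yields four scalar equations in c0 + c1,
      c0 - c1, c2 + c3, c2 - c3; invertibility of 2 then gives zero coefficients.\<close>
    have "(c0 \<otimes> \<one> \<oplus> (c1 \<otimes> i \<oplus> (c2 \<otimes> j \<oplus> c3 \<otimes> (i \<otimes> j)))) \<otimes> v = (c0 \<oplus> c1) \<otimes> v \<oplus> (c2 \<ominus> c3) \<otimes> w"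
      using cc ic jc c iv iw jv jw by (simp add: a_minus_def l_distr m_assoc l_minus r_minus a_ac)
    then have "(c0 \<oplus> c1) \<otimes> v \<oplus> (c2 \<ominus> c3) \<otimes> w = \<zero>" unfolding eq using c by simp
    from lin[OF _ _ this] have z1: "c0 \<oplus> c1 = \<zero> \<and> c2 \<ominus> c3 = \<zero>"
      using S4 S_closed by (simp add: a_minus_def)
    have "(c0 \<otimes> \<one> \<oplus> (c1 \<otimes> i \<oplus> (c2 \<otimes> j \<oplus> c3 \<otimes> (i \<otimes> j)))) \<otimes> w = (c2 \<oplus> c3) \<otimes> v \<oplus> (c0 \<ominus> c1) \<otimes> w"
      using cc ic jc c iv iw jv jw by (simp add: a_minus_def l_distr m_assoc l_minus r_minus a_ac)
    then have "(c2 \<oplus> c3) \<otimes> v \<oplus> (c0 \<ominus> c1) \<otimes> w = \<zero>" unfolding eq using c by simp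
    from lin[OF _ _ this] have z2: "c2 \<oplus> c3 = \<zero> \<and> c0 \<ominus> c1 = \<zero>"
      using S4 S_closed by (simp add: a_minus_def)
    have "c0 = c1" "c2 = c3" using z1 z2 cc by auto
    moreover from this have "c0 \<oplus> c0 = \<zero>" "c2 \<oplus> c2 = \<zero>" using z1 z2 by auto
    ultimately show "c0 = \<zero> \<and> c1 = \<zero> \<and> c2 = \<zero> \<and> c3 = \<zero>"
      using double_zero[OF cc(1)] double_zero[OF cc(3)] by auto
  qed (use ic jc in auto)
  then have "quaternion_basis \<one> \<one> i j"
    unfolding quaternion_basis_def using S_closed(2) one_not_zero ic jc ii jj ji by auto
  then show ?thesis by blast
qed

text \<open>The Wedderburn dichotomy in dimension four: either every nonzero element has a left
  inverse, or a proper nonzero left ideal R x turns the algebra into a matrix algebra.\<close>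

lemma exists_quaternion_basis: "\<exists>a b i j. quaternion_basis a b i j"
proof (cases "\<forall>x\<in>carrier R. x \<noteq> \<zero> \<longrightarrow> \<one> \<in> left_multiples x")
  case True
  show ?thesis
  proof (rule quaternion_basis_division)
    fix x assume "x \<in> carrier R" "x \<noteq> \<zero>"
    then have "\<one> \<in> left_multiples x" using True by blast
    then show "\<exists>y\<in>carrier R. y \<otimes> x = \<one>" unfolding left_multiples_def by force
  qed
next
  case False
  then show ?thesis using quaternion_basis_singular by blast
qed

end

section \<open>Quaternion coordinates and matrices\<close>

text \<open>The rows are (p, q) and (r, s). The restrictions put the matrix into the extensional
  function space underlying \<open>matrix_algebra\<close>, where equality is equality of the four
  entries.\<close>

definition mat2 :: "'a \<Rightarrow> 'a \<Rightarrow> 'a \<Rightarrow> 'a \<Rightarrow> nat \<Rightarrow> nat \<Rightarrow> 'a"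
  where "mat2 p q r s = (\<lambda>i\<in>{..<2}. \<lambda>j\<in>{..<2}.
    if i = 0 then (if j = 0 then p else q) else (if j = 0 then r else s))"

lemma mat2_eq_iff: "mat2 p q r s = mat2 p' q' r' s' \<longleftrightarrow> p = p' \<and> q = q' \<and> r = r' \<and> s = s'"
proof
  assume e: "mat2 p q r s = mat2 p' q' r' s'"
  have "mat2 p q r s x y = mat2 p' q' r' s' x y" for x y by (simp add: e)
  from this[of 0 0] this[of 0 1] this[of 1 0] this[of 1 1]
  show "p = p' \<and> q = q' \<and> r = r' \<and> s = s'" unfolding mat2_def by simp
qed simp

lemma lambda2_eq_mat2:
  "(\<lambda>i\<in>{..<2::nat}. \<lambda>j\<in>{..<2::nat}. f i j) = mat2 (f 0 0) (f 0 1) (f 1 0) (f 1 1)"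
  unfolding mat2_def by (intro ext) (auto simp: restrict_def less_2_cases_iff)

lemma mat2_nth [simp]:
  "mat2 p q r s 0 0 = p" "mat2 p q r s 0 (Suc 0) = q" "mat2 p q r s (Suc 0) 0 = r"
  "mat2 p q r s (Suc 0) (Suc 0) = s"
  unfolding mat2_def by simp_all

locale field_with_subfield = field R for R (structure) +
  fixes M assumes M: "subfield M R"
begin

abbreviation Mat where "Mat \<equiv> matrix_algebra (R\<lparr>carrier := M\<rparr>) 2"

lemma Mr: "subring M R" using subfieldE(1)[OF M] .

lemma M_carrier: "x \<in> M \<Longrightarrow> x \<in> carrier R" using subringE(1)[OF Mr] by auto

lemma M_closed:
  "\<zero> \<in> M" "\<one> \<in> M" "\<And>x. x \<in> M \<Longrightarrow> \<ominus> x \<in> M"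
  "\<And>x y. \<lbrakk>x \<in> M; y \<in> M\<rbrakk> \<Longrightarrow> x \<otimes> y \<in> M" "\<And>x y. \<lbrakk>x \<in> M; y \<in> M\<rbrakk> \<Longrightarrow> x \<oplus> y \<in> M"
  using subringE[OF Mr] by auto

lemma Mat_carrier: "carrier Mat = {mat2 p q r s | p q r s. p \<in> M \<and> q \<in> M \<and> r \<in> M \<and> s \<in> M}"
proof
  show "carrier Mat \<subseteq> {mat2 p q r s | p q r s. p \<in> M \<and> q \<in> M \<and> r \<in> M \<and> s \<in> M}"
  proof
    fix A assume "A \<in> carrier Mat"
    then have A: "A \<in> {..<2} \<rightarrow>\<^sub>E ({..<2} \<rightarrow>\<^sub>E M)" unfolding matrix_algebra_def by simp
    have "A = (\<lambda>i\<in>{..<2}. \<lambda>j\<in>{..<2}. A i j)"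
    proof (intro ext)
      fix i j
      show "A i j = (\<lambda>i\<in>{..<2}. \<lambda>j\<in>{..<2}. A i j) i j"
        using A by (cases "i < 2"; cases "j < 2") (auto simp: PiE_def extensional_def Pi_def)
    qed
    then have "A = mat2 (A 0 0) (A 0 1) (A 1 0) (A 1 1)" using lambda2_eq_mat2 by metis
    moreover have "A i j \<in> M" if "i < 2" "j < 2" for i j using A that by (auto simp: PiE_def Pi_def)
    ultimately show "A \<in> {mat2 p q r s | p q r s. p \<in> M \<and> q \<in> M \<and> r \<in> M \<and> s \<in> M}"
      by (smt (verit) mem_Collect_eq one_less_numeral_iff pos2 semiring_norm(76))
  qed
  show "{mat2 p q r s | p q r s. p \<in> M \<and> q \<in> M \<and> r \<in> M \<and> s \<in> M} \<subseteq> carrier Mat"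
    unfolding matrix_algebra_def mat2_def by (auto split: if_splits)
qed

lemma mat2_in: "\<lbrakk>p \<in> M; q \<in> M; r \<in> M; s \<in> M\<rbrakk> \<Longrightarrow> mat2 p q r s \<in> carrier Mat"
  unfolding Mat_carrier by blast

lemma Mat_mult:
  assumes "p \<in> M" "q \<in> M" "r \<in> M" "s \<in> M" "p' \<in> M" "q' \<in> M" "r' \<in> M" "s' \<in> M"
  shows "mat2 p q r s \<otimes>\<^bsub>Mat\<^esub> mat2 p' q' r' s' =
    mat2 (p \<otimes> p' \<oplus> q \<otimes> r') (p \<otimes> q' \<oplus> q \<otimes> s') (r \<otimes> p' \<oplus> s \<otimes> r') (r \<otimes> q' \<oplus> s \<otimes> s')"
proof -
  interpret M: field "R\<lparr>carrier := M\<rparr>" using subfield_iff(2)[OF M] .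
  have fs: "finsum (R\<lparr>carrier := M\<rparr>) f {..<2} = f 0 \<oplus> f 1" if "f 0 \<in> M" "f 1 \<in> M" for f :: "nat \<Rightarrow> 'a"
  proof -
    have s: "{..<2::nat} = insert 0 {1}" by auto
    have "finsum (R\<lparr>carrier := M\<rparr>) f {..<2} = f 0 \<oplus>\<^bsub>R\<lparr>carrier := M\<rparr>\<^esub> finsum (R\<lparr>carrier := M\<rparr>) f {1}"
      unfolding s by (rule M.finsum_insert) (use that in auto)
    also have "finsum (R\<lparr>carrier := M\<rparr>) f {1} = f 1"
      using M.finsum_insert[of "{}" 1 f] that M.r_zero by auto
    finally show ?thesis by simp
  qed
  have "mat2 p q r s \<otimes>\<^bsub>Mat\<^esub> mat2 p' q' r' s' = (\<lambda>i\<in>{..<2}. \<lambda>j\<in>{..<2}.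
      finsum (R\<lparr>carrier := M\<rparr>) (\<lambda>k. mat2 p q r s i k \<otimes> mat2 p' q' r' s' k j) {..<2})"
    unfolding matrix_algebra_def by simp
  also have "\<dots> = mat2 (p \<otimes> p' \<oplus> q \<otimes> r') (p \<otimes> q' \<oplus> q \<otimes> s') (r \<otimes> p' \<oplus> s \<otimes> r') (r \<otimes> q' \<oplus> s \<otimes> s')"
    unfolding lambda2_eq_mat2 using assms M_closed by (simp add: fs)
  finally show ?thesis .
qed

lemma Mat_add: "mat2 p q r s \<oplus>\<^bsub>Mat\<^esub> mat2 p' q' r' s' = mat2 (p \<oplus> p') (q \<oplus> q') (r \<oplus> r') (s \<oplus> s')"
  unfolding matrix_algebra_def by (simp add: lambda2_eq_mat2)

lemma Mat_smult: "m \<odot>\<^bsub>Mat\<^esub> mat2 p q r s = mat2 (m \<otimes> p) (m \<otimes> q) (m \<otimes> r) (m \<otimes> s)"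
  unfolding matrix_algebra_def by (simp add: lambda2_eq_mat2)

lemma Mat_one: "\<one>\<^bsub>Mat\<^esub> = mat2 \<one> \<zero> \<zero> \<one>"
  unfolding matrix_algebra_def by (simp add: lambda2_eq_mat2)

lemma Mat_zero: "\<zero>\<^bsub>Mat\<^esub> = mat2 \<zero> \<zero> \<zero> \<zero>"
  unfolding matrix_algebra_def by (simp add: lambda2_eq_mat2)

lemma Mat_ring: "ring Mat"
proof (rule ringI)
  show "abelian_group Mat"
  proof (rule abelian_groupI)
    fix A assume "A \<in> carrier Mat"
    then obtain p q r s where A: "A = mat2 p q r s" "p \<in> M" "q \<in> M" "r \<in> M" "s \<in> M"
      unfolding Mat_carrier by auto
    show "\<zero>\<^bsub>Mat\<^esub> \<oplus>\<^bsub>Mat\<^esub> A = A" unfolding A(1) Mat_zero Mat_add using A M_carrier by simp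
    have "mat2 (\<ominus> p) (\<ominus> q) (\<ominus> r) (\<ominus> s) \<in> carrier Mat" by (rule mat2_in) (use A M_closed in auto)
    moreover have "mat2 (\<ominus> p) (\<ominus> q) (\<ominus> r) (\<ominus> s) \<oplus>\<^bsub>Mat\<^esub> A = \<zero>\<^bsub>Mat\<^esub>"
      unfolding A(1) Mat_zero Mat_add using A M_carrier by (simp add: l_neg)
    ultimately show "\<exists>B\<in>carrier Mat. B \<oplus>\<^bsub>Mat\<^esub> A = \<zero>\<^bsub>Mat\<^esub>" by blast
  next
    fix A B assume "A \<in> carrier Mat" "B \<in> carrier Mat"
    then obtain p q r s p' q' r' s' where A: "A = mat2 p q r s" "p \<in> M" "q \<in> M" "r \<in> M" "s \<in> M"
      and B: "B = mat2 p' q' r' s'" "p' \<in> M" "q' \<in> M" "r' \<in> M" "s' \<in> M"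
      unfolding Mat_carrier by blast
    show "A \<oplus>\<^bsub>Mat\<^esub> B \<in> carrier Mat"
      unfolding A(1) B(1) Mat_add by (rule mat2_in) (use A B M_closed in auto)
    show "A \<oplus>\<^bsub>Mat\<^esub> B = B \<oplus>\<^bsub>Mat\<^esub> A"
      unfolding A(1) B(1) Mat_add using A B M_carrier by (simp add: a_comm)
  next
    fix A B C assume "A \<in> carrier Mat" "B \<in> carrier Mat" "C \<in> carrier Mat"
    then obtain p q r s p' q' r' s' p'' q'' r'' s''
      where A: "A = mat2 p q r s" "p \<in> M" "q \<in> M" "r \<in> M" "s \<in> M"
      and B: "B = mat2 p' q' r' s'" "p' \<in> M" "q' \<in> M" "r' \<in> M" "s' \<in> M"
      and C: "C = mat2 p'' q'' r'' s''" "p'' \<in> M" "q'' \<in> M" "r'' \<in> M" "s'' \<in> M"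
      unfolding Mat_carrier by blast
    note c = A(2-)[THEN M_carrier] B(2-)[THEN M_carrier] C(2-)[THEN M_carrier]
    show "A \<oplus>\<^bsub>Mat\<^esub> B \<oplus>\<^bsub>Mat\<^esub> C = A \<oplus>\<^bsub>Mat\<^esub> (B \<oplus>\<^bsub>Mat\<^esub> C)"
      unfolding A(1) B(1) C(1) Mat_add mat2_eq_iff by (simp add: c a_assoc)
  next
    show "\<zero>\<^bsub>Mat\<^esub> \<in> carrier Mat" unfolding Mat_zero by (rule mat2_in) (use M_closed in auto)
  qed
  show "monoid Mat"
  proof (rule monoidI)
    fix A B assume "A \<in> carrier Mat" "B \<in> carrier Mat"
    then obtain p q r s p' q' r' s' where A: "A = mat2 p q r s" "p \<in> M" "q \<in> M" "r \<in> M" "s \<in> M"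
      and B: "B = mat2 p' q' r' s'" "p' \<in> M" "q' \<in> M" "r' \<in> M" "s' \<in> M"
      unfolding Mat_carrier by blast
    show "A \<otimes>\<^bsub>Mat\<^esub> B \<in> carrier Mat"
      unfolding A(1) B(1) Mat_mult[OF A(2-) B(2-)] by (rule mat2_in) (use A B M_closed in auto)
  next
    show "\<one>\<^bsub>Mat\<^esub> \<in> carrier Mat" unfolding Mat_one by (rule mat2_in) (use M_closed in auto)
  next
    fix A B C assume "A \<in> carrier Mat" "B \<in> carrier Mat" "C \<in> carrier Mat"
    then obtain p q r s p' q' r' s' p'' q'' r'' s''
      where A: "A = mat2 p q r s" "p \<in> M" "q \<in> M" "r \<in> M" "s \<in> M"
      and B: "B = mat2 p' q' r' s'" "p' \<in> M" "q' \<in> M" "r' \<in> M" "s' \<in> M"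
      and C: "C = mat2 p'' q'' r'' s''" "p'' \<in> M" "q'' \<in> M" "r'' \<in> M" "s'' \<in> M"
      unfolding Mat_carrier by blast
    note c = A(2-)[THEN M_carrier] B(2-)[THEN M_carrier] C(2-)[THEN M_carrier]
    have BC: "B \<otimes>\<^bsub>Mat\<^esub> C = mat2 (p' \<otimes> p'' \<oplus> q' \<otimes> r'') (p' \<otimes> q'' \<oplus> q' \<otimes> s'')
        (r' \<otimes> p'' \<oplus> s' \<otimes> r'') (r' \<otimes> q'' \<oplus> s' \<otimes> s'')"
      unfolding B(1) C(1) by (rule Mat_mult[OF B(2-) C(2-)])
    have AB: "A \<otimes>\<^bsub>Mat\<^esub> B = mat2 (p \<otimes> p' \<oplus> q \<otimes> r') (p \<otimes> q' \<oplus> q \<otimes> s')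
        (r \<otimes> p' \<oplus> s \<otimes> r') (r \<otimes> q' \<oplus> s \<otimes> s')"
      unfolding A(1) B(1) by (rule Mat_mult[OF A(2-) B(2-)])
    note cl = A(2-) B(2-) C(2-) M_closed(4,5)
    show "A \<otimes>\<^bsub>Mat\<^esub> B \<otimes>\<^bsub>Mat\<^esub> C = A \<otimes>\<^bsub>Mat\<^esub> (B \<otimes>\<^bsub>Mat\<^esub> C)"
      unfolding AB BC unfolding A(1) C(1)
      by (simp only: Mat_mult cl mat2_eq_iff) (simp add: c l_distr r_distr m_assoc a_ac)
  next
    fix A assume "A \<in> carrier Mat"
    then obtain p q r s where A: "A = mat2 p q r s" "p \<in> M" "q \<in> M" "r \<in> M" "s \<in> M"
      unfolding Mat_carrier by auto
    show "\<one>\<^bsub>Mat\<^esub> \<otimes>\<^bsub>Mat\<^esub> A = A" "A \<otimes>\<^bsub>Mat\<^esub> \<one>\<^bsub>Mat\<^esub> = A"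
      unfolding A(1) Mat_one Mat_mult[OF M_closed(2,1,1,2) A(2-)] Mat_mult[OF A(2-) M_closed(2,1,1,2)]
        mat2_eq_iff using A(2-)[THEN M_carrier] by simp_all
  qed
  fix A B C assume "A \<in> carrier Mat" "B \<in> carrier Mat" "C \<in> carrier Mat"
  then obtain p q r s p' q' r' s' p'' q'' r'' s''
    where A: "A = mat2 p q r s" "p \<in> M" "q \<in> M" "r \<in> M" "s \<in> M"
    and B: "B = mat2 p' q' r' s'" "p' \<in> M" "q' \<in> M" "r' \<in> M" "s' \<in> M"
    and C: "C = mat2 p'' q'' r'' s''" "p'' \<in> M" "q'' \<in> M" "r'' \<in> M" "s'' \<in> M"
    unfolding Mat_carrier by blast
  note c = A(2-)[THEN M_carrier] B(2-)[THEN M_carrier] C(2-)[THEN M_carrier]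
  note cl = A(2-) B(2-) C(2-) M_closed(4,5)
  show "(A \<oplus>\<^bsub>Mat\<^esub> B) \<otimes>\<^bsub>Mat\<^esub> C = A \<otimes>\<^bsub>Mat\<^esub> C \<oplus>\<^bsub>Mat\<^esub> B \<otimes>\<^bsub>Mat\<^esub> C"
    "C \<otimes>\<^bsub>Mat\<^esub> (A \<oplus>\<^bsub>Mat\<^esub> B) = C \<otimes>\<^bsub>Mat\<^esub> A \<oplus>\<^bsub>Mat\<^esub> C \<otimes>\<^bsub>Mat\<^esub> B"
    unfolding A(1) B(1) C(1)
    by ((simp only: Mat_mult Mat_add cl mat2_eq_iff), (simp add: c l_distr r_distr m_assoc a_ac))+
qed

end

section \<open>Splitting matrices for a quaternion basis\<close>

context field
begin

fun quat_add :: "'a \<times> 'a \<times> 'a \<times> 'a \<Rightarrow> 'a \<times> 'a \<times> 'a \<times> 'a \<Rightarrow> 'a \<times> 'a \<times> 'a \<times> 'a"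
  where "quat_add (x0, x1, x2, x3) (y0, y1, y2, y3) = (x0 \<oplus> y0, x1 \<oplus> y1, x2 \<oplus> y2, x3 \<oplus> y3)"

fun quat_smult :: "'a \<Rightarrow> 'a \<times> 'a \<times> 'a \<times> 'a \<Rightarrow> 'a \<times> 'a \<times> 'a \<times> 'a"
  where "quat_smult c (x0, x1, x2, x3) = (c \<otimes> x0, c \<otimes> x1, c \<otimes> x2, c \<otimes> x3)"

text \<open>Coordinates of a product with respect to \<open>1, i, j, ij\<close>, where \<open>i\<^sup>2 = a\<close>, \<open>j\<^sup>2 = b\<close> and
  \<open>ji = -ij\<close>.\<close>

fun quat_mult :: "'a \<Rightarrow> 'a \<Rightarrow> 'a \<times> 'a \<times> 'a \<times> 'a \<Rightarrow> 'a \<times> 'a \<times> 'a \<times> 'a \<Rightarrow> 'a \<times> 'a \<times> 'a \<times> 'a"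
  where "quat_mult a b (x0, x1, x2, x3) (y0, y1, y2, y3) =
    (x0 \<otimes> y0 \<oplus> a \<otimes> x1 \<otimes> y1 \<oplus> b \<otimes> x2 \<otimes> y2 \<oplus> \<ominus> (a \<otimes> b \<otimes> x3 \<otimes> y3),
     x0 \<otimes> y1 \<oplus> x1 \<otimes> y0 \<oplus> \<ominus> (b \<otimes> x2 \<otimes> y3) \<oplus> b \<otimes> x3 \<otimes> y2,
     x0 \<otimes> y2 \<oplus> x2 \<otimes> y0 \<oplus> a \<otimes> x1 \<otimes> y3 \<oplus> \<ominus> (a \<otimes> x3 \<otimes> y1),
     x0 \<otimes> y3 \<oplus> x3 \<otimes> y0 \<oplus> x1 \<otimes> y2 \<oplus> \<ominus> (x2 \<otimes> y1))"

text \<open>If \<open>b = u\<^sup>2 - a v\<^sup>2\<close>, the matrices with rows \<open>(0, a), (1, 0)\<close> and \<open>(u, -a v), (v, -u)\<close> satisfy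
  the relations of \<open>i\<close> and \<open>j\<close>.\<close>

fun quat_matrix :: "'a \<Rightarrow> 'a \<Rightarrow> 'a \<Rightarrow> 'a \<times> 'a \<times> 'a \<times> 'a \<Rightarrow> nat \<Rightarrow> nat \<Rightarrow> 'a"
  where "quat_matrix a u v (x0, x1, x2, x3) = mat2
    (x0 \<oplus> (x2 \<otimes> u \<oplus> x3 \<otimes> (a \<otimes> v))) (a \<otimes> x1 \<oplus> \<ominus> (a \<otimes> (x2 \<otimes> v \<oplus> x3 \<otimes> u)))
    (x1 \<oplus> (x2 \<otimes> v \<oplus> x3 \<otimes> u)) (x0 \<oplus> \<ominus> (x2 \<otimes> u \<oplus> x3 \<otimes> (a \<otimes> v)))"

end

context field_with_subfield
begin

lemma quat_matrix_closed:
  assumes "a \<in> M" "u \<in> M" "v \<in> M" "x \<in> M \<times> M \<times> M \<times> M"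
  shows "quat_matrix a u v x \<in> carrier Mat"
proof -
  obtain x0 x1 x2 x3 where x: "x = (x0, x1, x2, x3)" "x0 \<in> M" "x1 \<in> M" "x2 \<in> M" "x3 \<in> M"
    using assms(4) by auto
  show ?thesis unfolding x(1) quat_matrix.simps
    by (rule mat2_in) (use assms x(2-) M_closed in auto)
qed

lemma quat_matrix_add:
  assumes "a \<in> M" "u \<in> M" "v \<in> M" "x \<in> M \<times> M \<times> M \<times> M" "y \<in> M \<times> M \<times> M \<times> M"
  shows "quat_matrix a u v (quat_add x y) = quat_matrix a u v x \<oplus>\<^bsub>Mat\<^esub> quat_matrix a u v y"
proof -
  obtain x0 x1 x2 x3 where x: "x = (x0, x1, x2, x3)" "x0 \<in> M" "x1 \<in> M" "x2 \<in> M" "x3 \<in> M"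
    using assms(4) by auto
  obtain y0 y1 y2 y3 where y: "y = (y0, y1, y2, y3)" "y0 \<in> M" "y1 \<in> M" "y2 \<in> M" "y3 \<in> M"
    using assms(5) by auto
  have c: "a \<in> carrier R" "u \<in> carrier R" "v \<in> carrier R" "x0 \<in> carrier R" "x1 \<in> carrier R"
    "x2 \<in> carrier R" "x3 \<in> carrier R" "y0 \<in> carrier R" "y1 \<in> carrier R" "y2 \<in> carrier R" "y3 \<in> carrier R"
    using assms(1-3) x y M_carrier by auto
  show ?thesis
    unfolding x(1) y(1) quat_add.simps quat_matrix.simps Mat_add mat2_eq_iff
    using c by (simp add: l_distr r_distr minus_add a_ac)
qed

text \<open>With \<alpha>^2 = a, the abbreviations P and N come from P + N \<alpha> = (x2 + x3
  \<alpha>)(u + v \<alpha>), and likewise P' and N'. As b is the norm of u + v \<alpha>, one has b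
  (x2 + x3 \<alpha>)(y2 - y3 \<alpha>) = (P + N \<alpha>)(P' - N' \<alpha>). The two components of
  this equation are \<open>f1\<close> and \<open>f2\<close>; they eliminate b from the product
  formula.\<close>

lemma quat_matrix_mult:
  assumes auv: "a \<in> M" "u \<in> M" "v \<in> M" and b: "b = u \<otimes> u \<oplus> \<ominus> (a \<otimes> (v \<otimes> v))"
    and xy: "x \<in> M \<times> M \<times> M \<times> M" "y \<in> M \<times> M \<times> M \<times> M"
  shows "quat_matrix a u v (quat_mult a b x y) = quat_matrix a u v x \<otimes>\<^bsub>Mat\<^esub> quat_matrix a u v y"
proof -
  obtain x0 x1 x2 x3 where x: "x = (x0, x1, x2, x3)" "x0 \<in> M" "x1 \<in> M" "x2 \<in> M" "x3 \<in> M"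
    using xy(1) by auto
  obtain y0 y1 y2 y3 where y: "y = (y0, y1, y2, y3)" "y0 \<in> M" "y1 \<in> M" "y2 \<in> M" "y3 \<in> M"
    using xy(2) by auto
  have c: "a \<in> carrier R" "u \<in> carrier R" "v \<in> carrier R" "x0 \<in> carrier R" "x1 \<in> carrier R"
    "x2 \<in> carrier R" "x3 \<in> carrier R" "y0 \<in> carrier R" "y1 \<in> carrier R" "y2 \<in> carrier R" "y3 \<in> carrier R"
    using assms x y M_carrier by auto
  define P where "P = x2 \<otimes> u \<oplus> x3 \<otimes> (a \<otimes> v)"
  define N where "N = x2 \<otimes> v \<oplus> x3 \<otimes> u"
  define P' where "P' = y2 \<otimes> u \<oplus> y3 \<otimes> (a \<otimes> v)"
  define N' where "N' = y2 \<otimes> v \<oplus> y3 \<otimes> u"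
  have PN: "P \<in> carrier R" "N \<in> carrier R" "P' \<in> carrier R" "N' \<in> carrier R"
    unfolding P_def N_def P'_def N'_def using c by auto
  have PNM: "P \<in> M" "N \<in> M" "P' \<in> M" "N' \<in> M"
    unfolding P_def N_def P'_def N'_def using auv x y M_closed by auto
  have bc: "b \<in> carrier R" unfolding b using c by simp
  note quat_ring = l_distr r_distr l_minus r_minus minus_add m_ac a_ac
  have f1: "b \<otimes> x2 \<otimes> y2 \<oplus> \<ominus> (a \<otimes> b \<otimes> x3 \<otimes> y3) = P \<otimes> P' \<oplus> \<ominus> (a \<otimes> (N \<otimes> N'))"
  proof -
    \<comment> \<open>The terms containing u v, which are common to both products and cancel in the
      difference.\<close>
    define S where "S = a \<otimes> (u \<otimes> v) \<otimes> (x2 \<otimes> y3 \<oplus> x3 \<otimes> y2)"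
    have "P \<otimes> P' = (x2 \<otimes> y2 \<otimes> (u \<otimes> u) \<oplus> a \<otimes> a \<otimes> (v \<otimes> v) \<otimes> (x3 \<otimes> y3)) \<oplus> S"
      "a \<otimes> (N \<otimes> N') = (a \<otimes> (x2 \<otimes> y2) \<otimes> (v \<otimes> v) \<oplus> a \<otimes> (x3 \<otimes> y3) \<otimes> (u \<otimes> u)) \<oplus> S"
      unfolding P_def N_def P'_def N'_def S_def using c by (simp_all add: quat_ring)
    moreover have "S \<in> carrier R" unfolding S_def using c by simp
    ultimately show ?thesis unfolding b using c by (simp add: add_cancel_diff) (simp add: quat_ring)
  qed
  have f2: "\<ominus> (b \<otimes> x2 \<otimes> y3) \<oplus> b \<otimes> x3 \<otimes> y2 = N \<otimes> P' \<oplus> \<ominus> (P \<otimes> N')"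
  proof -
    define S where "S = u \<otimes> v \<otimes> (x2 \<otimes> y2 \<oplus> a \<otimes> (x3 \<otimes> y3))"
    have "N \<otimes> P' = (a \<otimes> (v \<otimes> v) \<otimes> (x2 \<otimes> y3) \<oplus> u \<otimes> u \<otimes> (x3 \<otimes> y2)) \<oplus> S"
      "P \<otimes> N' = (u \<otimes> u \<otimes> (x2 \<otimes> y3) \<oplus> a \<otimes> (v \<otimes> v) \<otimes> (x3 \<otimes> y2)) \<oplus> S"
      unfolding P_def N_def P'_def N'_def S_def using c by (simp_all add: quat_ring)
    moreover have "S \<in> carrier R" unfolding S_def using c by simp
    ultimately show ?thesis unfolding b using c by (simp add: add_cancel_diff) (simp add: quat_ring)
  qed
  have p: "x0 \<otimes> y0 \<oplus> a \<otimes> x1 \<otimes> y1 \<oplus> b \<otimes> x2 \<otimes> y2 \<oplus> \<ominus> (a \<otimes> b \<otimes> x3 \<otimes> y3)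
      = x0 \<otimes> y0 \<oplus> a \<otimes> x1 \<otimes> y1 \<oplus> (P \<otimes> P' \<oplus> \<ominus> (a \<otimes> (N \<otimes> N')))"
    "x0 \<otimes> y1 \<oplus> x1 \<otimes> y0 \<oplus> \<ominus> (b \<otimes> x2 \<otimes> y3) \<oplus> b \<otimes> x3 \<otimes> y2
      = x0 \<otimes> y1 \<oplus> x1 \<otimes> y0 \<oplus> (N \<otimes> P' \<oplus> \<ominus> (P \<otimes> N'))"
    unfolding f1[symmetric] f2[symmetric] using c bc by (simp_all add: a_assoc)
  have pP: "(x0 \<otimes> y2 \<oplus> x2 \<otimes> y0 \<oplus> a \<otimes> x1 \<otimes> y3 \<oplus> \<ominus> (a \<otimes> x3 \<otimes> y1)) \<otimes> u
      \<oplus> (x0 \<otimes> y3 \<oplus> x3 \<otimes> y0 \<oplus> x1 \<otimes> y2 \<oplus> \<ominus> (x2 \<otimes> y1)) \<otimes> (a \<otimes> v)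
      = x0 \<otimes> P' \<oplus> P \<otimes> y0 \<oplus> a \<otimes> (x1 \<otimes> N') \<oplus> \<ominus> (a \<otimes> (N \<otimes> y1))"
    unfolding P_def N_def P'_def N'_def using c by (simp add: quat_ring)
  have pN: "(x0 \<otimes> y2 \<oplus> x2 \<otimes> y0 \<oplus> a \<otimes> x1 \<otimes> y3 \<oplus> \<ominus> (a \<otimes> x3 \<otimes> y1)) \<otimes> v
      \<oplus> (x0 \<otimes> y3 \<oplus> x3 \<otimes> y0 \<oplus> x1 \<otimes> y2 \<oplus> \<ominus> (x2 \<otimes> y1)) \<otimes> u
      = x0 \<otimes> N' \<oplus> N \<otimes> y0 \<oplus> x1 \<otimes> P' \<oplus> \<ominus> (P \<otimes> y1)"
    unfolding P_def N_def P'_def N'_def using c by (simp add: quat_ring)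
  show ?thesis
    unfolding x(1) y(1) quat_mult.simps quat_matrix.simps p pP pN
      P_def[symmetric] N_def[symmetric] P'_def[symmetric] N'_def[symmetric]
    apply (subst Mat_mult)
    using auv x(2-) y(2-) PNM M_closed apply (simp_all (no_asm_simp))
    unfolding mat2_eq_iff using c PN by (simp add: quat_ring)
qed

lemma quat_matrix_one:
  assumes "a \<in> M" "u \<in> M" "v \<in> M"
  shows "quat_matrix a u v (\<one>, \<zero>, \<zero>, \<zero>) = \<one>\<^bsub>Mat\<^esub>"
  unfolding quat_matrix.simps Mat_one mat2_eq_iff using assms M_carrier by simp

text \<open>Sums and differences of entries, with the help of 1/2 and 1/a, recover x0, x1 and the
  combinations t = x2 u + x3 a v and w = x2 v + x3 u. The latter are a linear system for x2 and x3
  with determinant u^2 - a v^2 = b, which is invertible.\<close>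

lemma quat_matrix_bij:
  assumes auv: "a \<in> M" "u \<in> M" "v \<in> M" and b: "b = u \<otimes> u \<oplus> \<ominus> (a \<otimes> (v \<otimes> v))"
    and n: "a \<noteq> \<zero>" "b \<noteq> \<zero>" "\<one> \<oplus> \<one> \<noteq> \<zero>"
  shows "bij_betw (quat_matrix a u v) (M \<times> M \<times> M \<times> M) (carrier Mat)"
proof -
  have bM: "b \<in> M" unfolding b using auv M_closed by simp
  define h where "h = inv (\<one> \<oplus> \<one>)"
  have h: "h \<in> M" "(\<one> \<oplus> \<one>) \<otimes> h = \<one>" unfolding h_def
    using subfield_m_inv[OF M, of "\<one> \<oplus> \<one>"] n(3) M_closed by auto
  define k where "k = inv a"
  have k: "k \<in> M" "a \<otimes> k = \<one>" unfolding k_def using subfield_m_inv[OF M, of a] n(1) auv by auto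
  define l where "l = inv b"
  have l: "l \<in> M" "b \<otimes> l = \<one>" unfolding l_def using subfield_m_inv[OF M, of b] n(2) bM by auto
  have c: "a \<in> carrier R" "u \<in> carrier R" "v \<in> carrier R" "b \<in> carrier R"
    "h \<in> carrier R" "k \<in> carrier R" "l \<in> carrier R" using auv bM h k l M_carrier by auto
  \<comment> \<open>The inverse map, where h = 1/2, k = 1/a and l = 1/b; the last two coordinates
    follow Cramer's rule.\<close>
  define g where "g p q r s = (let t = h \<otimes> (p \<oplus> \<ominus> s); w = h \<otimes> (r \<oplus> \<ominus> (k \<otimes> q)) in
    (h \<otimes> (p \<oplus> s), h \<otimes> (r \<oplus> k \<otimes> q), l \<otimes> (u \<otimes> t \<oplus> \<ominus> (a \<otimes> (v \<otimes> w))), l \<otimes> (u \<otimes> w \<oplus> \<ominus> (v \<otimes> t))))" for p q r s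
  show ?thesis
  proof (rule bij_betwI')
    fix x assume "x \<in> M \<times> M \<times> M \<times> M"
    then show "quat_matrix a u v x \<in> carrier Mat" by (rule quat_matrix_closed[OF auv])
  next
    fix A assume "A \<in> carrier Mat"
    then obtain p q r s where A: "A = mat2 p q r s" "p \<in> M" "q \<in> M" "r \<in> M" "s \<in> M"
      unfolding Mat_carrier by auto
    have Ac: "p \<in> carrier R" "q \<in> carrier R" "r \<in> carrier R" "s \<in> carrier R" using A M_carrier by auto
    have gM: "g p q r s \<in> M \<times> M \<times> M \<times> M"
      unfolding g_def Let_def using A h k l auv M_closed by auto
    define t where "t = h \<otimes> (p \<oplus> \<ominus> s)"
    define w where "w = h \<otimes> (r \<oplus> \<ominus> (k \<otimes> q))"
    have tw: "t \<in> carrier R" "w \<in> carrier R" unfolding t_def w_def using c Ac by auto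
    let ?x2 = "l \<otimes> (u \<otimes> t \<oplus> \<ominus> (a \<otimes> (v \<otimes> w)))" and ?x3 = "l \<otimes> (u \<otimes> w \<oplus> \<ominus> (v \<otimes> t))"
    have e1: "?x2 \<otimes> u \<oplus> ?x3 \<otimes> (a \<otimes> v) = t"
    proof -
      have "?x2 \<otimes> u \<oplus> ?x3 \<otimes> (a \<otimes> v) = ((u \<otimes> u \<oplus> \<ominus> (a \<otimes> (v \<otimes> v))) \<otimes> l) \<otimes> t"
        using c tw by algebra
      then show ?thesis unfolding b[symmetric] l(2) using tw by simp
    qed
    have e2: "?x2 \<otimes> v \<oplus> ?x3 \<otimes> u = w"
    proof -
      have "?x2 \<otimes> v \<oplus> ?x3 \<otimes> u = ((u \<otimes> u \<oplus> \<ominus> (a \<otimes> (v \<otimes> v))) \<otimes> l) \<otimes> w"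
        using c tw by algebra
      then show ?thesis unfolding b[symmetric] l(2) using tw by simp
    qed
    have f1: "h \<otimes> (p \<oplus> s) \<oplus> t = p"
    proof -
      have "h \<otimes> (p \<oplus> s) \<oplus> t = ((\<one> \<oplus> \<one>) \<otimes> h) \<otimes> p" unfolding t_def using c Ac by algebra
      then show ?thesis unfolding h(2) using Ac by simp
    qed
    have f2: "h \<otimes> (p \<oplus> s) \<oplus> \<ominus> t = s"
    proof -
      have "h \<otimes> (p \<oplus> s) \<oplus> \<ominus> t = ((\<one> \<oplus> \<one>) \<otimes> h) \<otimes> s" unfolding t_def using c Ac by algebra
      then show ?thesis unfolding h(2) using Ac by simp
    qed
    have f3: "h \<otimes> (r \<oplus> k \<otimes> q) \<oplus> w = r"
    proof -
      have "h \<otimes> (r \<oplus> k \<otimes> q) \<oplus> w = ((\<one> \<oplus> \<one>) \<otimes> h) \<otimes> r" unfolding w_def using c Ac by algebra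
      then show ?thesis unfolding h(2) using Ac by simp
    qed
    have f4: "a \<otimes> (h \<otimes> (r \<oplus> k \<otimes> q)) \<oplus> \<ominus> (a \<otimes> w) = q"
    proof -
      have "a \<otimes> (h \<otimes> (r \<oplus> k \<otimes> q)) \<oplus> \<ominus> (a \<otimes> w) = ((\<one> \<oplus> \<one>) \<otimes> h) \<otimes> ((a \<otimes> k) \<otimes> q)"
        unfolding w_def using c Ac by algebra
      then show ?thesis unfolding h(2) k(2) using Ac by simp
    qed
    have "quat_matrix a u v (g p q r s) = A"
      unfolding g_def Let_def t_def[symmetric] w_def[symmetric] quat_matrix.simps e1 e2 f1 f2 f3 f4 A(1) ..
    then show "\<exists>x\<in>M \<times> M \<times> M \<times> M. A = quat_matrix a u v x" using gM by metis
  next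
    fix x y :: "'a \<times> 'a \<times> 'a \<times> 'a"
    have inv: "(case (x :: 'a \<times> 'a \<times> 'a \<times> 'a) of (x0, x1, x2, x3) \<Rightarrow>
        g (x0 \<oplus> (x2 \<otimes> u \<oplus> x3 \<otimes> (a \<otimes> v))) (a \<otimes> x1 \<oplus> \<ominus> (a \<otimes> (x2 \<otimes> v \<oplus> x3 \<otimes> u)))
          (x1 \<oplus> (x2 \<otimes> v \<oplus> x3 \<otimes> u)) (x0 \<oplus> \<ominus> (x2 \<otimes> u \<oplus> x3 \<otimes> (a \<otimes> v)))) = x"
      if xM: "x \<in> M \<times> M \<times> M \<times> M" for x
    proof -
      obtain x0 x1 x2 x3 where x: "x = (x0, x1, x2, x3)" "x0 \<in> M" "x1 \<in> M" "x2 \<in> M" "x3 \<in> M"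
        using xM by auto
      have xc: "x0 \<in> carrier R" "x1 \<in> carrier R" "x2 \<in> carrier R" "x3 \<in> carrier R" using x M_carrier by auto
      define t where "t = x2 \<otimes> u \<oplus> x3 \<otimes> (a \<otimes> v)"
      define w where "w = x2 \<otimes> v \<oplus> x3 \<otimes> u"
      have tw: "t \<in> carrier R" "w \<in> carrier R" unfolding t_def w_def using c xc by auto
      have e1: "h \<otimes> (x0 \<oplus> t \<oplus> \<ominus> (x0 \<oplus> \<ominus> t)) = t"
      proof -
        have "h \<otimes> (x0 \<oplus> t \<oplus> \<ominus> (x0 \<oplus> \<ominus> t)) = ((\<one> \<oplus> \<one>) \<otimes> h) \<otimes> t" using c xc tw by algebra
        then show ?thesis unfolding h(2) using tw by simp
      qed
      have e2: "h \<otimes> (x1 \<oplus> w \<oplus> \<ominus> (k \<otimes> (a \<otimes> x1 \<oplus> \<ominus> (a \<otimes> w)))) = w"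
      proof -
        have "h \<otimes> (x1 \<oplus> w \<oplus> \<ominus> (k \<otimes> (a \<otimes> x1 \<oplus> \<ominus> (a \<otimes> w))))
          = h \<otimes> (x1 \<oplus> w \<oplus> \<ominus> ((a \<otimes> k) \<otimes> (x1 \<oplus> \<ominus> w)))" using c xc tw by algebra
        also have "\<dots> = h \<otimes> (x1 \<oplus> w \<oplus> \<ominus> (x1 \<oplus> \<ominus> w))" unfolding k(2) using xc tw by simp
        also have "\<dots> = ((\<one> \<oplus> \<one>) \<otimes> h) \<otimes> w" using c xc tw by algebra
        finally show ?thesis unfolding h(2) using tw by simp
      qed
      have e3: "h \<otimes> (x0 \<oplus> t \<oplus> (x0 \<oplus> \<ominus> t)) = x0"
      proof -
        have "h \<otimes> (x0 \<oplus> t \<oplus> (x0 \<oplus> \<ominus> t)) = ((\<one> \<oplus> \<one>) \<otimes> h) \<otimes> x0" using c xc tw by algebra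
        then show ?thesis unfolding h(2) using xc by simp
      qed
      have e4: "h \<otimes> (x1 \<oplus> w \<oplus> k \<otimes> (a \<otimes> x1 \<oplus> \<ominus> (a \<otimes> w))) = x1"
      proof -
        have "h \<otimes> (x1 \<oplus> w \<oplus> k \<otimes> (a \<otimes> x1 \<oplus> \<ominus> (a \<otimes> w)))
          = h \<otimes> (x1 \<oplus> w \<oplus> (a \<otimes> k) \<otimes> (x1 \<oplus> \<ominus> w))" using c xc tw by algebra
        also have "\<dots> = h \<otimes> (x1 \<oplus> w \<oplus> (x1 \<oplus> \<ominus> w))" unfolding k(2) using xc tw by simp
        also have "\<dots> = ((\<one> \<oplus> \<one>) \<otimes> h) \<otimes> x1" using c xc tw by algebra
        finally show ?thesis unfolding h(2) using xc by simp
      qed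
      have e5: "l \<otimes> (u \<otimes> t \<oplus> \<ominus> (a \<otimes> (v \<otimes> w))) = x2"
      proof -
        have "l \<otimes> (u \<otimes> t \<oplus> \<ominus> (a \<otimes> (v \<otimes> w))) = ((u \<otimes> u \<oplus> \<ominus> (a \<otimes> (v \<otimes> v))) \<otimes> l) \<otimes> x2"
          unfolding t_def w_def using c xc tw by algebra
        then show ?thesis unfolding b[symmetric] l(2) using xc by simp
      qed
      have e6: "l \<otimes> (u \<otimes> w \<oplus> \<ominus> (v \<otimes> t)) = x3"
      proof -
        have "l \<otimes> (u \<otimes> w \<oplus> \<ominus> (v \<otimes> t)) = ((u \<otimes> u \<oplus> \<ominus> (a \<otimes> (v \<otimes> v))) \<otimes> l) \<otimes> x3"
          unfolding t_def w_def using c xc tw by algebra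
        then show ?thesis unfolding b[symmetric] l(2) using xc by simp
      qed
      show ?thesis
        unfolding x(1) prod.case t_def[symmetric] w_def[symmetric] g_def Let_def e1 e2 e3 e4 e5 e6 ..
    qed
    assume xM: "x \<in> M \<times> M \<times> M \<times> M" and yM: "y \<in> M \<times> M \<times> M \<times> M"
    obtain x0 x1 x2 x3 where x: "x = (x0, x1, x2, x3)" by (cases x) auto
    obtain y0 y1 y2 y3 where y: "y = (y0, y1, y2, y3)" by (cases y) auto
    show "quat_matrix a u v x = quat_matrix a u v y \<longleftrightarrow> x = y"
    proof
      assume "quat_matrix a u v x = quat_matrix a u v y"
      then have "x0 \<oplus> (x2 \<otimes> u \<oplus> x3 \<otimes> (a \<otimes> v)) = y0 \<oplus> (y2 \<otimes> u \<oplus> y3 \<otimes> (a \<otimes> v))"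
        "a \<otimes> x1 \<oplus> \<ominus> (a \<otimes> (x2 \<otimes> v \<oplus> x3 \<otimes> u)) = a \<otimes> y1 \<oplus> \<ominus> (a \<otimes> (y2 \<otimes> v \<oplus> y3 \<otimes> u))"
        "x1 \<oplus> (x2 \<otimes> v \<oplus> x3 \<otimes> u) = y1 \<oplus> (y2 \<otimes> v \<oplus> y3 \<otimes> u)"
        "x0 \<oplus> \<ominus> (x2 \<otimes> u \<oplus> x3 \<otimes> (a \<otimes> v)) = y0 \<oplus> \<ominus> (y2 \<otimes> u \<oplus> y3 \<otimes> (a \<otimes> v))"
        unfolding x y quat_matrix.simps mat2_eq_iff by blast+
      then show "x = y" using inv[OF xM] inv[OF yM] unfolding x y prod.case by metis
    qed simp
  qed
qed

end

section \<open>Tensor products\<close>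

lemma frag_cmul_diff: "frag_cmul c (a - b) = frag_cmul c a - frag_cmul c b"
  using frag_cmul_distrib2[of c "a - b" b] by (simp add: algebra_simps)

lemma frag_extend_fun_diff: "frag_extend (\<lambda>x. f x - g x) c = frag_extend f c - frag_extend g c"
  unfolding frag_extend_def frag_cmul_diff sum_subtractf ..

lemma frag_extend_fun_zero [simp]: "frag_extend (\<lambda>x. 0) c = 0"
  unfolding frag_extend_def by simp

lemma int_monoid_ring_simps [simp]:
  "x \<in> carrier (int_monoid_ring G) \<longleftrightarrow> Poly_Mapping.keys x \<subseteq> carrier G"
  "\<zero>\<^bsub>int_monoid_ring G\<^esub> = 0" "x \<oplus>\<^bsub>int_monoid_ring G\<^esub> y = x + y"
  "\<one>\<^bsub>int_monoid_ring G\<^esub> = frag_of \<one>\<^bsub>G\<^esub>"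
  "frag_of g \<otimes>\<^bsub>int_monoid_ring G\<^esub> frag_of h = frag_of (g \<otimes>\<^bsub>G\<^esub> h)"
  "0 \<otimes>\<^bsub>int_monoid_ring G\<^esub> x = 0" "x \<otimes>\<^bsub>int_monoid_ring G\<^esub> 0 = 0"
  unfolding int_monoid_ring_def by auto

lemma int_monoid_ring_diff_mult:
  "(x - y) \<otimes>\<^bsub>int_monoid_ring G\<^esub> z = x \<otimes>\<^bsub>int_monoid_ring G\<^esub> z - y \<otimes>\<^bsub>int_monoid_ring G\<^esub> z"
  "z \<otimes>\<^bsub>int_monoid_ring G\<^esub> (x - y) = z \<otimes>\<^bsub>int_monoid_ring G\<^esub> x - z \<otimes>\<^bsub>int_monoid_ring G\<^esub> y"
  unfolding int_monoid_ring_def by (simp_all add: frag_extend_diff frag_extend_fun_diff)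

lemma int_monoid_ring_add_mult:
  "(x + y) \<otimes>\<^bsub>int_monoid_ring G\<^esub> z = x \<otimes>\<^bsub>int_monoid_ring G\<^esub> z + y \<otimes>\<^bsub>int_monoid_ring G\<^esub> z"
  "z \<otimes>\<^bsub>int_monoid_ring G\<^esub> (x + y) = z \<otimes>\<^bsub>int_monoid_ring G\<^esub> x + z \<otimes>\<^bsub>int_monoid_ring G\<^esub> y"
  using int_monoid_ring_diff_mult(1)[where x = "x + y" and y = y and z = z and G = G]
    int_monoid_ring_diff_mult(2)[where x = "x + y" and y = y and z = z and G = G]
  by (simp_all add: algebra_simps)

lemma int_monoid_ring_mult_closed:
  assumes "monoid G" "x \<in> carrier (int_monoid_ring G)" "y \<in> carrier (int_monoid_ring G)"
  shows "x \<otimes>\<^bsub>int_monoid_ring G\<^esub> y \<in> carrier (int_monoid_ring G)"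
proof -
  have x: "Poly_Mapping.keys x \<subseteq> carrier G" and y: "Poly_Mapping.keys y \<subseteq> carrier G" using assms by auto
  have d: "Poly_Mapping.keys (p - q) \<subseteq> carrier G"
    if "Poly_Mapping.keys p \<subseteq> carrier G" "Poly_Mapping.keys q \<subseteq> carrier G" for p q :: "'a \<Rightarrow>\<^sub>0 int"
    using keys_diff[of p q] that by auto
  have "Poly_Mapping.keys (frag_of g \<otimes>\<^bsub>int_monoid_ring G\<^esub> y) \<subseteq> carrier G" if g: "g \<in> carrier G" for g
    using y
  proof (induction y rule: frag_induction)
    case (one h)
    then show ?case using monoid.m_closed[OF assms(1) g] by simp
  next
    case (diff p q)
    then show ?case unfolding int_monoid_ring_diff_mult by (rule d)
  qed simp
  note fy = this
  have "Poly_Mapping.keys (x \<otimes>\<^bsub>int_monoid_ring G\<^esub> y) \<subseteq> carrier G"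
    using x
  proof (induction x rule: frag_induction)
    case (diff p q)
    then show ?case unfolding int_monoid_ring_diff_mult by (rule d)
  qed (use fy in auto)
  then show ?thesis by simp
qed

text \<open>The product is additive in each argument, so the monoid laws reduce to generators;
  associativity takes one induction per factor.\<close>

lemma int_monoid_ring_is_ring:
  assumes G: "monoid G" shows "ring (int_monoid_ring G)"
proof (rule ringI)
  let ?Z = "int_monoid_ring G"
  show "abelian_group ?Z"
  proof (rule abelian_groupI)
    fix x y assume "x \<in> carrier ?Z" "y \<in> carrier ?Z"
    then show "x \<oplus>\<^bsub>?Z\<^esub> y \<in> carrier ?Z" using keys_add[of x y] by auto
  next
    fix x assume x: "x \<in> carrier ?Z"
    show "\<exists>y\<in>carrier ?Z. y \<oplus>\<^bsub>?Z\<^esub> x = \<zero>\<^bsub>?Z\<^esub>"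
      using x by (intro bexI[of _ "- x"]) auto
  qed (auto simp: algebra_simps)
  show "monoid ?Z"
  proof (rule monoidI)
    fix x y assume "x \<in> carrier ?Z" "y \<in> carrier ?Z"
    then show "x \<otimes>\<^bsub>?Z\<^esub> y \<in> carrier ?Z" by (rule int_monoid_ring_mult_closed[OF G])
  next
    show "\<one>\<^bsub>?Z\<^esub> \<in> carrier ?Z" using monoid.one_closed[OF G] by simp
  next
    fix x y z assume "x \<in> carrier ?Z" "y \<in> carrier ?Z" "z \<in> carrier ?Z"
    then have k: "Poly_Mapping.keys x \<subseteq> carrier G" "Poly_Mapping.keys y \<subseteq> carrier G"
      "Poly_Mapping.keys z \<subseteq> carrier G" by auto
    have z: "frag_of g \<otimes>\<^bsub>?Z\<^esub> frag_of h \<otimes>\<^bsub>?Z\<^esub> z = frag_of g \<otimes>\<^bsub>?Z\<^esub> (frag_of h \<otimes>\<^bsub>?Z\<^esub> z)"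
      if "g \<in> carrier G" "h \<in> carrier G" for g h
      using k(3)
      by (induction z rule: frag_induction)
        (use that monoid.m_assoc[OF G] in \<open>auto simp: int_monoid_ring_diff_mult simp del: int_monoid_ring_simps(5) intro: arg_cong[of _ _ frag_of] simp: int_monoid_ring_simps(5)\<close>)
    have yz: "frag_of g \<otimes>\<^bsub>?Z\<^esub> y \<otimes>\<^bsub>?Z\<^esub> z = frag_of g \<otimes>\<^bsub>?Z\<^esub> (y \<otimes>\<^bsub>?Z\<^esub> z)" if "g \<in> carrier G" for g
      using k(2)
      by (induction y rule: frag_induction)
        (use that z in \<open>auto simp: int_monoid_ring_diff_mult simp del: int_monoid_ring_simps(5)\<close>)
    show "x \<otimes>\<^bsub>?Z\<^esub> y \<otimes>\<^bsub>?Z\<^esub> z = x \<otimes>\<^bsub>?Z\<^esub> (y \<otimes>\<^bsub>?Z\<^esub> z)"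
      using k(1)
      by (induction x rule: frag_induction)
        (use yz in \<open>auto simp: int_monoid_ring_diff_mult simp del: int_monoid_ring_simps(5)\<close>)
  next
    fix x assume "x \<in> carrier ?Z"
    then have x: "Poly_Mapping.keys x \<subseteq> carrier G" by simp
    show "\<one>\<^bsub>?Z\<^esub> \<otimes>\<^bsub>?Z\<^esub> x = x"
      using x by (induction x rule: frag_induction) (use monoid.l_one[OF G] in \<open>auto simp: int_monoid_ring_diff_mult\<close>)
    show "x \<otimes>\<^bsub>?Z\<^esub> \<one>\<^bsub>?Z\<^esub> = x"
      using x by (induction x rule: frag_induction) (use monoid.r_one[OF G] in \<open>auto simp: int_monoid_ring_diff_mult\<close>)
  qed
qed (simp_all add: int_monoid_ring_add_mult)

lemma frag_induction_keys [consumes 1, case_names zero one diff]: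
  assumes "Poly_Mapping.keys c \<subseteq> S" and "P 0" and "\<And>x. x \<in> S \<Longrightarrow> P (frag_of x)"
    and "\<And>a b. \<lbrakk>Poly_Mapping.keys a \<subseteq> S; Poly_Mapping.keys b \<subseteq> S; P a; P b\<rbrakk> \<Longrightarrow> P (a - b)"
  shows "P c"
  using free_Abelian_group_induct[OF assms(1), of P] assms(2-4) by blast

text \<open>The universal property of the monoid ring: f is a monoid homomorphism into the
  multiplicative monoid of S. Its additive extension exists because the underlying group is free,
  and multiplicativity is checked on generators.\<close>

lemma int_monoid_ring_hom:
  assumes G: "monoid G" and S: "ring S" and f: "\<And>x. x \<in> carrier G \<Longrightarrow> f x \<in> carrier S"
    and mult: "\<And>x y. \<lbrakk>x \<in> carrier G; y \<in> carrier G\<rbrakk> \<Longrightarrow> f (x \<otimes>\<^bsub>G\<^esub> y) = f x \<otimes>\<^bsub>S\<^esub> f y"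
    and one: "f \<one>\<^bsub>G\<^esub> = \<one>\<^bsub>S\<^esub>"
  shows "\<exists>h \<in> ring_hom (int_monoid_ring G) S. \<forall>x\<in>carrier G. h (frag_of x) = f x"
proof -
  interpret S: ring S by (rule S)
  have "comm_group (add_monoid S)" by (rule S.a_comm_group)
  then obtain h where h: "h \<in> hom (free_Abelian_group (carrier G)) (add_monoid S)"
    "\<And>x. x \<in> carrier G \<Longrightarrow> h (frag_of x) = f x"
    by (rule comm_group.free_Abelian_group_universal[of "add_monoid S" f "carrier G"]) (use f in auto)
  have closed: "h x \<in> carrier S" if "Poly_Mapping.keys x \<subseteq> carrier G" for x
    using h(1) that unfolding hom_def by auto
  have add: "h (x + y) = h x \<oplus>\<^bsub>S\<^esub> h y"
    if "Poly_Mapping.keys x \<subseteq> carrier G" "Poly_Mapping.keys y \<subseteq> carrier G" for x y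
    using h(1) that unfolding hom_def by auto
  have diff': "h (x - y) = h x \<ominus>\<^bsub>S\<^esub> h y"
    if k: "Poly_Mapping.keys x \<subseteq> carrier G" "Poly_Mapping.keys y \<subseteq> carrier G" for x y
  proof -
    have d: "Poly_Mapping.keys (x - y) \<subseteq> carrier G" using keys_diff[of x y] k by auto
    have "h x = h (x - y) \<oplus>\<^bsub>S\<^esub> h y" using add[OF d k(2)] by simp
    then show ?thesis using closed[OF d] closed[OF k(2)] by (simp add: a_minus_def S.a_assoc S.r_neg)
  qed
  have zero: "h 0 = \<zero>\<^bsub>S\<^esub>" using add[of 0 0] closed[of 0] by (simp add: S.add.l_cancel_one)
  let ?Z = "int_monoid_ring G"
  interpret Z: ring ?Z by (rule int_monoid_ring_is_ring[OF G])
  have "h \<in> ring_hom ?Z S"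
  proof (rule ring_hom_memI)
    fix x y assume xy: "x \<in> carrier ?Z" "y \<in> carrier ?Z"
    then have k: "Poly_Mapping.keys x \<subseteq> carrier G" "Poly_Mapping.keys y \<subseteq> carrier G" by auto
    show "h (x \<oplus>\<^bsub>?Z\<^esub> y) = h x \<oplus>\<^bsub>S\<^esub> h y" using add[OF k] by simp
    have cl: "Poly_Mapping.keys (p \<otimes>\<^bsub>?Z\<^esub> q) \<subseteq> carrier G"
      if "Poly_Mapping.keys p \<subseteq> carrier G" "Poly_Mapping.keys q \<subseteq> carrier G" for p q
      using Z.m_closed[of p q] that by simp
    have sm: "a \<otimes>\<^bsub>S\<^esub> (b \<ominus>\<^bsub>S\<^esub> c) = a \<otimes>\<^bsub>S\<^esub> b \<ominus>\<^bsub>S\<^esub> a \<otimes>\<^bsub>S\<^esub> c"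
      "(b \<ominus>\<^bsub>S\<^esub> c) \<otimes>\<^bsub>S\<^esub> a = b \<otimes>\<^bsub>S\<^esub> a \<ominus>\<^bsub>S\<^esub> c \<otimes>\<^bsub>S\<^esub> a"
      if "a \<in> carrier S" "b \<in> carrier S" "c \<in> carrier S" for a b c
      using that by (simp_all add: a_minus_def S.l_distr S.r_distr S.l_minus S.r_minus)
    have fy: "h (frag_of g \<otimes>\<^bsub>?Z\<^esub> y) = f g \<otimes>\<^bsub>S\<^esub> h y" if g: "g \<in> carrier G" for g
      using k(2)
    proof (induction y rule: frag_induction_keys)
      case zero
      then show ?case using f[OF g] \<open>h 0 = \<zero>\<^bsub>S\<^esub>\<close> by simp
    next
      case (one y)
      then show ?case using g mult[OF g] h(2) monoid.m_closed[OF G g] by simp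
    next
      case (diff p q)
      have gk: "Poly_Mapping.keys (frag_of g) \<subseteq> carrier G" using g by simp
      show ?case
        unfolding int_monoid_ring_diff_mult diff'[OF cl[OF gk diff(1)] cl[OF gk diff(2)]]
          diff'[OF diff(1,2)] diff(3,4) sm(1)[OF f[OF g] closed[OF diff(1)] closed[OF diff(2)]] ..
    qed
    show "h (x \<otimes>\<^bsub>?Z\<^esub> y) = h x \<otimes>\<^bsub>S\<^esub> h y"
      using k(1)
    proof (induction x rule: frag_induction_keys)
      case zero
      then show ?case using closed[OF k(2)] \<open>h 0 = \<zero>\<^bsub>S\<^esub>\<close> by simp
    next
      case (one g)
      then show ?case using fy h(2) by simp
    next
      case (diff p q)
      show ?case
        unfolding int_monoid_ring_diff_mult diff'[OF cl[OF diff(1) k(2)] cl[OF diff(2) k(2)]]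
          diff'[OF diff(1,2)] diff(3,4) sm(2)[OF closed[OF k(2)] closed[OF diff(1)] closed[OF diff(2)]] ..
    qed
  qed (use closed one h(2) monoid.one_closed[OF G] in auto)
  then show ?thesis using h(2) by blast
qed

section \<open>Algebras with a given quaternion basis\<close>

definition quat_element ::
    "('a, 'q, 'n) module_scheme \<Rightarrow> 'q \<Rightarrow> 'q \<Rightarrow> 'a \<times> 'a \<times> 'a \<times> 'a \<Rightarrow> 'q"
  where "quat_element Q i j x = (case x of (x0, x1, x2, x3) \<Rightarrow>
    x0 \<odot>\<^bsub>Q\<^esub> \<one>\<^bsub>Q\<^esub> \<oplus>\<^bsub>Q\<^esub> (x1 \<odot>\<^bsub>Q\<^esub> i \<oplus>\<^bsub>Q\<^esub> (x2 \<odot>\<^bsub>Q\<^esub> j \<oplus>\<^bsub>Q\<^esub> x3 \<odot>\<^bsub>Q\<^esub> (i \<otimes>\<^bsub>Q\<^esub> j))))"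

text \<open>The field \<open>M\<close> is the one to which scalars are extended. The basis enters as
  a bijection between K^4 and the algebra, so that statements about the algebra become identities
  between coordinates.\<close>

locale based_quaternion_algebra = field_with_subfield R M
  for R :: "('a, 'r) ring_scheme" (structure) and M +
  fixes K and Q :: "('a, 'q, 'n) module_scheme" and i j a b
  assumes K: "subfield K R" "K \<subseteq> M" and alg: "assoc_algebra (R\<lparr>carrier := K\<rparr>) Q"
    and ab: "a \<in> K" "b \<in> K"
    and ij: "i \<in> carrier Q" "j \<in> carrier Q" "i \<otimes>\<^bsub>Q\<^esub> i = a \<odot>\<^bsub>Q\<^esub> \<one>\<^bsub>Q\<^esub>" "j \<otimes>\<^bsub>Q\<^esub> j = b \<odot>\<^bsub>Q\<^esub> \<one>\<^bsub>Q\<^esub>"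
      "j \<otimes>\<^bsub>Q\<^esub> i = \<ominus>\<^bsub>Q\<^esub> (i \<otimes>\<^bsub>Q\<^esub> j)"
    and basis: "bij_betw (quat_element Q i j) (K \<times> K \<times> K \<times> K) (carrier Q)"
begin

lemma Kr: "subring K R" using subfieldE(1)[OF K(1)] .

lemma K_closed:
  "\<zero> \<in> K" "\<one> \<in> K" "\<And>x. x \<in> K \<Longrightarrow> \<ominus> x \<in> K"
  "\<And>x y. \<lbrakk>x \<in> K; y \<in> K\<rbrakk> \<Longrightarrow> x \<otimes> y \<in> K" "\<And>x y. \<lbrakk>x \<in> K; y \<in> K\<rbrakk> \<Longrightarrow> x \<oplus> y \<in> K"
  using subringE[OF Kr] by auto

lemma K_carrier: "x \<in> K \<Longrightarrow> x \<in> carrier R" using subringE(1)[OF Kr] by auto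

sublocale Q: ring Q using alg unfolding assoc_algebra_def by auto

lemma Q_module: "module (R\<lparr>carrier := K\<rparr>) Q" using alg unfolding assoc_algebra_def by auto

lemma Q_smult:
  "\<And>k x. \<lbrakk>k \<in> K; x \<in> carrier Q\<rbrakk> \<Longrightarrow> k \<odot>\<^bsub>Q\<^esub> x \<in> carrier Q"
  "\<And>k l x. \<lbrakk>k \<in> K; l \<in> K; x \<in> carrier Q\<rbrakk> \<Longrightarrow> (k \<oplus> l) \<odot>\<^bsub>Q\<^esub> x = k \<odot>\<^bsub>Q\<^esub> x \<oplus>\<^bsub>Q\<^esub> l \<odot>\<^bsub>Q\<^esub> x"
  "\<And>k x y. \<lbrakk>k \<in> K; x \<in> carrier Q; y \<in> carrier Q\<rbrakk> \<Longrightarrow> k \<odot>\<^bsub>Q\<^esub> (x \<oplus>\<^bsub>Q\<^esub> y) = k \<odot>\<^bsub>Q\<^esub> x \<oplus>\<^bsub>Q\<^esub> k \<odot>\<^bsub>Q\<^esub> y"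
  "\<And>k l x. \<lbrakk>k \<in> K; l \<in> K; x \<in> carrier Q\<rbrakk> \<Longrightarrow> (k \<otimes> l) \<odot>\<^bsub>Q\<^esub> x = k \<odot>\<^bsub>Q\<^esub> (l \<odot>\<^bsub>Q\<^esub> x)"
  "\<And>x. x \<in> carrier Q \<Longrightarrow> \<one> \<odot>\<^bsub>Q\<^esub> x = x"
  "\<And>k x y. \<lbrakk>k \<in> K; x \<in> carrier Q; y \<in> carrier Q\<rbrakk> \<Longrightarrow> (k \<odot>\<^bsub>Q\<^esub> x) \<otimes>\<^bsub>Q\<^esub> y = k \<odot>\<^bsub>Q\<^esub> (x \<otimes>\<^bsub>Q\<^esub> y)"
  "\<And>k x y. \<lbrakk>k \<in> K; x \<in> carrier Q; y \<in> carrier Q\<rbrakk> \<Longrightarrow> x \<otimes>\<^bsub>Q\<^esub> (k \<odot>\<^bsub>Q\<^esub> y) = k \<odot>\<^bsub>Q\<^esub> (x \<otimes>\<^bsub>Q\<^esub> y)"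
  using module.smult_closed[OF Q_module] module.smult_l_distr[OF Q_module]
    module.smult_r_distr[OF Q_module] module.smult_assoc1[OF Q_module] module.smult_one[OF Q_module]
    assoc_algebra.smult_assoc_left[OF alg] assoc_algebra.smult_assoc_right[OF alg] by auto

lemma Q_smult_zero: "x \<in> carrier Q \<Longrightarrow> \<zero> \<odot>\<^bsub>Q\<^esub> x = \<zero>\<^bsub>Q\<^esub>"
  using Q_smult(2)[OF K_closed(1,1), of x] Q_smult(1)[OF K_closed(1), of x]
  by (simp add: Q.add.l_cancel_one)

lemma Q_smult_minus:
  assumes "k \<in> K" "x \<in> carrier Q"
  shows "(\<ominus> k) \<odot>\<^bsub>Q\<^esub> x = \<ominus>\<^bsub>Q\<^esub> (k \<odot>\<^bsub>Q\<^esub> x)" "k \<odot>\<^bsub>Q\<^esub> (\<ominus>\<^bsub>Q\<^esub> x) = \<ominus>\<^bsub>Q\<^esub> (k \<odot>\<^bsub>Q\<^esub> x)"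
proof -
  have m: "\<ominus> k \<in> K" using assms K_closed by auto
  have "(\<ominus> k) \<odot>\<^bsub>Q\<^esub> x \<oplus>\<^bsub>Q\<^esub> k \<odot>\<^bsub>Q\<^esub> x = \<zero>\<^bsub>Q\<^esub>"
    using Q_smult(2)[OF m assms] Q_smult_zero[OF assms(2)] K_carrier[OF assms(1)] by (simp add: l_neg)
  then show "(\<ominus> k) \<odot>\<^bsub>Q\<^esub> x = \<ominus>\<^bsub>Q\<^esub> (k \<odot>\<^bsub>Q\<^esub> x)"
    using Q_smult(1)[OF m assms(2)] Q_smult(1)[OF assms] by (metis Q.minus_equality)
  have "k \<odot>\<^bsub>Q\<^esub> \<zero>\<^bsub>Q\<^esub> = \<zero>\<^bsub>Q\<^esub>"
    using Q_smult(3)[OF assms(1) Q.zero_closed Q.zero_closed] Q_smult(1)[OF assms(1) Q.zero_closed]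
    by (simp add: Q.add.l_cancel_one)
  then have "k \<odot>\<^bsub>Q\<^esub> (\<ominus>\<^bsub>Q\<^esub> x) \<oplus>\<^bsub>Q\<^esub> k \<odot>\<^bsub>Q\<^esub> x = \<zero>\<^bsub>Q\<^esub>"
    using Q_smult(3)[OF assms(1) Q.a_inv_closed[OF assms(2)] assms(2)] assms by (simp add: Q.l_neg)
  then show "k \<odot>\<^bsub>Q\<^esub> (\<ominus>\<^bsub>Q\<^esub> x) = \<ominus>\<^bsub>Q\<^esub> (k \<odot>\<^bsub>Q\<^esub> x)"
    using Q_smult(1)[OF assms(1) Q.a_inv_closed[OF assms(2)]] Q_smult(1)[OF assms] by (metis Q.minus_equality)
qed

abbreviation elt where "elt \<equiv> quat_element Q i j"

lemma elt_add:
  assumes "x \<in> K \<times> K \<times> K \<times> K" "y \<in> K \<times> K \<times> K \<times> K"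
  shows "elt (quat_add x y) = elt x \<oplus>\<^bsub>Q\<^esub> elt y"
proof -
  obtain x0 x1 x2 x3 where x: "x = (x0, x1, x2, x3)" "x0 \<in> K" "x1 \<in> K" "x2 \<in> K" "x3 \<in> K"
    using assms(1) by auto
  obtain y0 y1 y2 y3 where y: "y = (y0, y1, y2, y3)" "y0 \<in> K" "y1 \<in> K" "y2 \<in> K" "y3 \<in> K"
    using assms(2) by auto
  show ?thesis
    unfolding x(1) y(1) quat_add.simps quat_element_def prod.case
    using x(2-) y(2-) ij(1,2) by (simp add: Q_smult Q.a_ac)
qed

lemma elt_smult:
  assumes "x \<in> K \<times> K \<times> K \<times> K" "k \<in> K"
  shows "elt (quat_smult k x) = k \<odot>\<^bsub>Q\<^esub> elt x"
proof -
  obtain x0 x1 x2 x3 where x: "x = (x0, x1, x2, x3)" "x0 \<in> K" "x1 \<in> K" "x2 \<in> K" "x3 \<in> K"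
    using assms(1) by auto
  show ?thesis
    unfolding x(1) quat_smult.simps quat_element_def prod.case
    using x(2-) ij(1,2) assms(2) by (simp add: Q_smult)
qed

lemma quat_mult_closed:
  assumes "x \<in> K \<times> K \<times> K \<times> K" "y \<in> K \<times> K \<times> K \<times> K"
  shows "quat_mult a b x y \<in> K \<times> K \<times> K \<times> K"
  using assms ab K_closed by auto

text \<open>The multiplication table of 1, i, j and k = i j follows from the values of i^2 and j^2
  and from anticommutation; it identifies \<open>quat_mult\<close> with the product of the
  algebra.\<close>

lemma elt_mult:
  assumes "x \<in> K \<times> K \<times> K \<times> K" "y \<in> K \<times> K \<times> K \<times> K"
  shows "elt (quat_mult a b x y) = elt x \<otimes>\<^bsub>Q\<^esub> elt y"
proof -
  obtain x0 x1 x2 x3 where x: "x = (x0, x1, x2, x3)" "x0 \<in> K" "x1 \<in> K" "x2 \<in> K" "x3 \<in> K"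
    using assms(1) by auto
  obtain y0 y1 y2 y3 where y: "y = (y0, y1, y2, y3)" "y0 \<in> K" "y1 \<in> K" "y2 \<in> K" "y3 \<in> K"
    using assms(2) by auto
  define k where "k = i \<otimes>\<^bsub>Q\<^esub> j"
  have kQ: "k \<in> carrier Q" unfolding k_def using ij by simp
  have table: "i \<otimes>\<^bsub>Q\<^esub> k = a \<odot>\<^bsub>Q\<^esub> j" "k \<otimes>\<^bsub>Q\<^esub> i = \<ominus>\<^bsub>Q\<^esub> (a \<odot>\<^bsub>Q\<^esub> j)"
    "j \<otimes>\<^bsub>Q\<^esub> k = \<ominus>\<^bsub>Q\<^esub> (b \<odot>\<^bsub>Q\<^esub> i)" "k \<otimes>\<^bsub>Q\<^esub> j = b \<odot>\<^bsub>Q\<^esub> i" "k \<otimes>\<^bsub>Q\<^esub> k = \<ominus>\<^bsub>Q\<^esub> (a \<odot>\<^bsub>Q\<^esub> (b \<odot>\<^bsub>Q\<^esub> \<one>\<^bsub>Q\<^esub>))"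
    "i \<otimes>\<^bsub>Q\<^esub> j = k" "j \<otimes>\<^bsub>Q\<^esub> i = \<ominus>\<^bsub>Q\<^esub> k"
  proof -
    show t1: "i \<otimes>\<^bsub>Q\<^esub> k = a \<odot>\<^bsub>Q\<^esub> j"
      unfolding k_def Q.m_assoc[OF ij(1,1,2), symmetric] ij(3) using ab ij(1,2) by (simp add: Q_smult)
    have "k \<otimes>\<^bsub>Q\<^esub> i = i \<otimes>\<^bsub>Q\<^esub> (j \<otimes>\<^bsub>Q\<^esub> i)" unfolding k_def using ij(1,2) by (simp add: Q.m_assoc)
    also have "\<dots> = \<ominus>\<^bsub>Q\<^esub> (i \<otimes>\<^bsub>Q\<^esub> k)" unfolding ij(5) k_def using ij(1,2) by (simp add: Q.r_minus)
    finally show t2: "k \<otimes>\<^bsub>Q\<^esub> i = \<ominus>\<^bsub>Q\<^esub> (a \<odot>\<^bsub>Q\<^esub> j)" unfolding t1 .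
    show t4: "k \<otimes>\<^bsub>Q\<^esub> j = b \<odot>\<^bsub>Q\<^esub> i"
      unfolding k_def Q.m_assoc[OF ij(1,2,2)] ij(4) using ab ij(1,2) by (simp add: Q_smult)
    have "j \<otimes>\<^bsub>Q\<^esub> k = (j \<otimes>\<^bsub>Q\<^esub> i) \<otimes>\<^bsub>Q\<^esub> j" unfolding k_def using ij(1,2) by (simp add: Q.m_assoc)
    also have "\<dots> = \<ominus>\<^bsub>Q\<^esub> (k \<otimes>\<^bsub>Q\<^esub> j)" unfolding ij(5) k_def using ij(1,2) by (simp add: Q.l_minus)
    finally show t3: "j \<otimes>\<^bsub>Q\<^esub> k = \<ominus>\<^bsub>Q\<^esub> (b \<odot>\<^bsub>Q\<^esub> i)" unfolding t4 .
    have "k \<otimes>\<^bsub>Q\<^esub> k = i \<otimes>\<^bsub>Q\<^esub> (j \<otimes>\<^bsub>Q\<^esub> k)" unfolding k_def using ij(1,2) by (simp add: Q.m_assoc)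
    also have "\<dots> = \<ominus>\<^bsub>Q\<^esub> (b \<odot>\<^bsub>Q\<^esub> (a \<odot>\<^bsub>Q\<^esub> \<one>\<^bsub>Q\<^esub>))"
      unfolding t3 using ab ij(1,2,3) by (simp add: Q.r_minus Q_smult)
    also have "b \<odot>\<^bsub>Q\<^esub> (a \<odot>\<^bsub>Q\<^esub> \<one>\<^bsub>Q\<^esub>) = a \<odot>\<^bsub>Q\<^esub> (b \<odot>\<^bsub>Q\<^esub> \<one>\<^bsub>Q\<^esub>)"
      using Q_smult(4)[OF ab Q.one_closed] Q_smult(4)[OF ab(2,1) Q.one_closed]
        m_comm[OF K_carrier[OF ab(1)] K_carrier[OF ab(2)]] by simp
    finally show "k \<otimes>\<^bsub>Q\<^esub> k = \<ominus>\<^bsub>Q\<^esub> (a \<odot>\<^bsub>Q\<^esub> (b \<odot>\<^bsub>Q\<^esub> \<one>\<^bsub>Q\<^esub>))" .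
    show "i \<otimes>\<^bsub>Q\<^esub> j = k" "j \<otimes>\<^bsub>Q\<^esub> i = \<ominus>\<^bsub>Q\<^esub> k" unfolding k_def ij(5) by auto
  qed
  have comm: "c \<odot>\<^bsub>Q\<^esub> (d \<odot>\<^bsub>Q\<^esub> z) = d \<odot>\<^bsub>Q\<^esub> (c \<odot>\<^bsub>Q\<^esub> z)" if "c \<in> K" "d \<in> K" "z \<in> carrier Q" for c d z
    using Q_smult(4)[OF that] Q_smult(4)[OF that(2,1,3)] m_comm[OF K_carrier[OF that(1)] K_carrier[OF that(2)]]
    by simp
  show ?thesis
    unfolding x(1) y(1) quat_mult.simps quat_element_def prod.case table(6)
    using x(2-) y(2-) ij(1,2) kQ ab K_closed
    by (simp add: Q_smult Q_smult_minus Q.l_distr Q.r_distr Q.l_minus Q.r_minus table ij(3,4)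
        comm Q.a_ac)
qed

lemma elt_one: "elt (\<one>, \<zero>, \<zero>, \<zero>) = \<one>\<^bsub>Q\<^esub>"
  unfolding quat_element_def using ij(1,2) by (simp add: Q_smult Q_smult_zero)

definition coord :: "'q \<Rightarrow> 'a \<times> 'a \<times> 'a \<times> 'a"
  where "coord = inv_into (K \<times> K \<times> K \<times> K) elt"

lemma coord_closed: "x \<in> carrier Q \<Longrightarrow> coord x \<in> K \<times> K \<times> K \<times> K"
  unfolding coord_def using basis by (metis bij_betw_def inv_into_into)

lemma elt_coord: "x \<in> carrier Q \<Longrightarrow> elt (coord x) = x"
  unfolding coord_def using basis by (metis bij_betw_def f_inv_into_f)

lemma coord_elt: "x \<in> K \<times> K \<times> K \<times> K \<Longrightarrow> coord (elt x) = x"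
  unfolding coord_def using basis by (metis bij_betw_def inv_into_f_f)

lemma coord_mult:
  assumes "x \<in> carrier Q" "y \<in> carrier Q"
  shows "coord (x \<otimes>\<^bsub>Q\<^esub> y) = quat_mult a b (coord x) (coord y)"
  using coord_elt[OF quat_mult_closed[OF coord_closed[OF assms(1)] coord_closed[OF assms(2)]]]
    elt_mult[OF coord_closed[OF assms(1)] coord_closed[OF assms(2)]] assms by (simp add: elt_coord)

lemma coord_add:
  assumes "x \<in> carrier Q" "y \<in> carrier Q"
  shows "coord (x \<oplus>\<^bsub>Q\<^esub> y) = quat_add (coord x) (coord y)"
proof -
  note c = coord_closed[OF assms(1)] coord_closed[OF assms(2)]
  have "quat_add (coord x) (coord y) \<in> K \<times> K \<times> K \<times> K" using c K_closed by auto
  from coord_elt[OF this] show ?thesis using elt_add[OF c] assms by (simp add: elt_coord)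
qed

lemma coord_smult:
  assumes "x \<in> carrier Q" "k \<in> K"
  shows "coord (k \<odot>\<^bsub>Q\<^esub> x) = quat_smult k (coord x)"
proof -
  note c = coord_closed[OF assms(1)]
  have "quat_smult k (coord x) \<in> K \<times> K \<times> K \<times> K" using c K_closed assms(2) by auto
  from coord_elt[OF this] show ?thesis using elt_smult[OF c assms(2)] assms by (simp add: elt_coord)
qed

lemma coord_basis:
  "coord \<one>\<^bsub>Q\<^esub> = (\<one>, \<zero>, \<zero>, \<zero>)" "coord i = (\<zero>, \<one>, \<zero>, \<zero>)" "coord j = (\<zero>, \<zero>, \<one>, \<zero>)"
  "coord (i \<otimes>\<^bsub>Q\<^esub> j) = (\<zero>, \<zero>, \<zero>, \<one>)"
proof -
  have e: "elt (\<zero>, \<one>, \<zero>, \<zero>) = i" "elt (\<zero>, \<zero>, \<one>, \<zero>) = j" "elt (\<zero>, \<zero>, \<zero>, \<one>) = i \<otimes>\<^bsub>Q\<^esub> j"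
    unfolding quat_element_def using ij(1,2) by (simp_all add: Q_smult Q_smult_zero)
  show "coord \<one>\<^bsub>Q\<^esub> = (\<one>, \<zero>, \<zero>, \<zero>)" unfolding elt_one[symmetric] by (rule coord_elt) (simp add: K_closed)
  show "coord i = (\<zero>, \<one>, \<zero>, \<zero>)" using coord_elt[of "(\<zero>, \<one>, \<zero>, \<zero>)"] K_closed unfolding e by simp
  show "coord j = (\<zero>, \<zero>, \<one>, \<zero>)" using coord_elt[of "(\<zero>, \<zero>, \<one>, \<zero>)"] K_closed unfolding e by simp
  show "coord (i \<otimes>\<^bsub>Q\<^esub> j) = (\<zero>, \<zero>, \<zero>, \<one>)" using coord_elt[of "(\<zero>, \<zero>, \<zero>, \<one>)"] K_closed unfolding e by simp
qed

end

section \<open>The tensor product as a matrix algebra\<close>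

context based_quaternion_algebra
begin

abbreviation B where "B \<equiv> subfield_algebra R M"

abbreviation Z where "Z \<equiv> int_monoid_ring (Q \<times>\<times> B)"

abbreviation J where "J \<equiv> tensor_ideal (R\<lparr>carrier := K\<rparr>) Q B"

lemma B_simps [simp]:
  "carrier B = M" "x \<otimes>\<^bsub>B\<^esub> y = x \<otimes> y" "\<one>\<^bsub>B\<^esub> = \<one>" "\<zero>\<^bsub>B\<^esub> = \<zero>" "x \<oplus>\<^bsub>B\<^esub> y = x \<oplus> y" "x \<odot>\<^bsub>B\<^esub> y = x \<otimes> y"
  unfolding subfield_algebra_def by simp_all

lemma DirProd_monoid_QB: "monoid (Q \<times>\<times> B)"
proof (rule DirProd_monoid)
  show "monoid Q" by (rule Q.monoid_axioms)
  show "monoid B"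
    by (rule monoidI) (use M_closed M_carrier in \<open>auto simp: m_assoc\<close>)
qed

lemma DirProd_QB_simps [simp]:
  "carrier (Q \<times>\<times> B) = carrier Q \<times> M" "\<one>\<^bsub>Q \<times>\<times> B\<^esub> = (\<one>\<^bsub>Q\<^esub>, \<one>)"
  "(q, m) \<otimes>\<^bsub>Q \<times>\<times> B\<^esub> (q', m') = (q \<otimes>\<^bsub>Q\<^esub> q', m \<otimes> m')"
  by (auto simp: DirProd_def)

sublocale Z: ring Z by (rule int_monoid_ring_is_ring[OF DirProd_monoid_QB])

lemma tensor_relation_cases:
  assumes "t \<in> tensor_relations (R\<lparr>carrier := K\<rparr>) Q B"
  obtains (left) q q' m where "t = frag_of (q \<oplus>\<^bsub>Q\<^esub> q', m) - frag_of (q, m) - frag_of (q', m)"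
      "q \<in> carrier Q" "q' \<in> carrier Q" "m \<in> M"
  | (right) q m m' where "t = frag_of (q, m \<oplus> m') - frag_of (q, m) - frag_of (q, m')"
      "q \<in> carrier Q" "m \<in> M" "m' \<in> M"
  | (scalar) k q m where "t = frag_of (k \<odot>\<^bsub>Q\<^esub> q, m) - frag_of (q, k \<otimes> m)" "k \<in> K" "q \<in> carrier Q" "m \<in> M"
  using assms unfolding tensor_relations_def by auto

lemma relations_subset: "tensor_relations (R\<lparr>carrier := K\<rparr>) Q B \<subseteq> carrier Z"
proof -
  have k: "Poly_Mapping.keys (frag_of x) \<subseteq> carrier Q \<times> M" if "x \<in> carrier Q \<times> M" for x
    using that by simp
  have d: "Poly_Mapping.keys (p - q) \<subseteq> carrier Q \<times> M"
    if "Poly_Mapping.keys p \<subseteq> carrier Q \<times> M" "Poly_Mapping.keys q \<subseteq> carrier Q \<times> M" for p q :: "'q \<times> 'a \<Rightarrow>\<^sub>0 int"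
    using keys_diff[of p q] that by auto
  have KM: "x \<in> M" if "x \<in> K" for x using K(2) that by auto
  show ?thesis
  proof
    fix t assume "t \<in> tensor_relations (R\<lparr>carrier := K\<rparr>) Q B"
    then have "Poly_Mapping.keys t \<subseteq> carrier Q \<times> M"
    proof (cases rule: tensor_relation_cases)
      case left
      then show ?thesis unfolding left(1) by (intro d k) auto
    next
      case right
      then show ?thesis unfolding right(1) by (intro d k) (use M_closed in auto)
    next
      case scalar
      then show ?thesis unfolding scalar(1) by (intro d k) (use M_closed KM Q_smult(1) in auto)
    qed
    then show "t \<in> carrier Z" by simp
  qed
qed

lemma J_ideal: "ideal J Z"
  unfolding tensor_ideal_def by (rule Z.genideal_ideal[OF relations_subset])

lemma J_relations:
  assumes "q \<in> carrier Q" "m \<in> M"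
  shows "q' \<in> carrier Q \<Longrightarrow> frag_of (q \<oplus>\<^bsub>Q\<^esub> q', m) - frag_of (q, m) - frag_of (q', m) \<in> J"
    "m' \<in> M \<Longrightarrow> frag_of (q, m \<oplus> m') - frag_of (q, m) - frag_of (q, m') \<in> J"
    "k \<in> K \<Longrightarrow> frag_of (k \<odot>\<^bsub>Q\<^esub> q, m) - frag_of (q, k \<otimes> m) \<in> J"
proof -
  have s: "tensor_relations (R\<lparr>carrier := K\<rparr>) Q B \<subseteq> J"
    unfolding tensor_ideal_def by (rule Z.genideal_self[OF relations_subset])
  show "frag_of (q \<oplus>\<^bsub>Q\<^esub> q', m) - frag_of (q, m) - frag_of (q', m) \<in> J" if "q' \<in> carrier Q"
    by (rule subsetD[OF s]) (use that assms in \<open>auto simp: tensor_relations_def\<close>)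
  show "frag_of (q, m \<oplus> m') - frag_of (q, m) - frag_of (q, m') \<in> J" if "m' \<in> M"
    by (rule subsetD[OF s]) (use that assms in \<open>auto simp: tensor_relations_def\<close>)
  show "frag_of (k \<odot>\<^bsub>Q\<^esub> q, m) - frag_of (q, k \<otimes> m) \<in> J" if "k \<in> K"
    by (rule subsetD[OF s]) (use that assms in \<open>auto simp: tensor_relations_def\<close>)
qed

lemma J_closed:
  "0 \<in> J" "\<And>x y. \<lbrakk>x \<in> J; y \<in> J\<rbrakk> \<Longrightarrow> x + y \<in> J" "\<And>x y. \<lbrakk>x \<in> J; y \<in> J\<rbrakk> \<Longrightarrow> x - y \<in> J"
proof -
  interpret J: ideal J Z by (rule J_ideal)
  show z: "0 \<in> J" using J.zero_closed by simp
  show a: "x + y \<in> J" if "x \<in> J" "y \<in> J" for x y using J.a_closed[OF that] by simp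
  show "x - y \<in> J" if xy: "x \<in> J" "y \<in> J" for x y
  proof -
    have yZ: "y \<in> carrier Z" using J.Icarr[OF xy(2)] .
    then have "- y \<in> carrier Z" "- y \<oplus>\<^bsub>Z\<^esub> y = \<zero>\<^bsub>Z\<^esub>" by simp_all
    then have "\<ominus>\<^bsub>Z\<^esub> y = - y" using yZ by (metis Z.minus_equality)
    then have "- y \<in> J" using J.a_inv_closed[OF xy(2)] by simp
    then show ?thesis using a[OF xy(1)] by (metis uminus_add_conv_diff add.commute)
  qed
qed

text \<open>A lift to the monoid ring of the tensor with M-coordinates m0, m1, m2, m3 along 1, i, j,
  i j; it serves as a normal form modulo J.\<close>

definition basis_tensor :: "'a \<times> 'a \<times> 'a \<times> 'a \<Rightarrow> 'q \<times> 'a \<Rightarrow>\<^sub>0 int"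
  where "basis_tensor m = (case m of (m0, m1, m2, m3) \<Rightarrow>
    frag_of (\<one>\<^bsub>Q\<^esub>, m0) + frag_of (i, m1) + frag_of (j, m2) + frag_of (i \<otimes>\<^bsub>Q\<^esub> j, m3))"

lemma frag_zero_in_J: assumes "q \<in> carrier Q" shows "frag_of (q, \<zero>) \<in> J"
proof -
  have "frag_of (q, \<zero> \<oplus> \<zero>) - frag_of (q, \<zero>) - frag_of (q, \<zero>) \<in> J"
    by (rule J_relations(2)) (use assms M_closed in auto)
  from J_closed(3)[OF J_closed(1) this] show ?thesis by simp
qed

lemma frag_minus_in_J:
  assumes "q \<in> carrier Q" "m \<in> M" "n \<in> M"
  shows "frag_of (q, m) - frag_of (q, n) - frag_of (q, m \<ominus> n) \<in> J"
proof -
  have mn: "m \<ominus> n \<in> M" using assms M_closed unfolding a_minus_def by auto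
  have "frag_of (q, n \<oplus> (m \<ominus> n)) - frag_of (q, n) - frag_of (q, m \<ominus> n) \<in> J"
    by (rule J_relations(2)[OF assms(1,3) mn])
  moreover have "n \<oplus> (m \<ominus> n) = m" using assms(2,3)[THEN M_carrier] by algebra
  ultimately show ?thesis by simp
qed

text \<open>Three additivity relations split q along the basis, and four scalar relations move its
  coordinates across the tensor sign. The difference is the sum of these seven elements of
  J.\<close>

lemma basis_tensor_pure:
  assumes q: "q \<in> carrier Q" and m: "m \<in> M"
  shows "frag_of (q, m) - basis_tensor (quat_smult m (coord q)) \<in> J"
proof -
  obtain x0 x1 x2 x3 where x: "coord q = (x0, x1, x2, x3)" "x0 \<in> K" "x1 \<in> K" "x2 \<in> K" "x3 \<in> K"
    using coord_closed[OF q] by auto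
  let ?k = "i \<otimes>\<^bsub>Q\<^esub> j"
  have k: "?k \<in> carrier Q" using ij by simp
  let ?q0 = "x0 \<odot>\<^bsub>Q\<^esub> \<one>\<^bsub>Q\<^esub>" and ?q1 = "x1 \<odot>\<^bsub>Q\<^esub> i" and ?q2 = "x2 \<odot>\<^bsub>Q\<^esub> j" and ?q3 = "x3 \<odot>\<^bsub>Q\<^esub> ?k"
  have c: "?q0 \<in> carrier Q" "?q1 \<in> carrier Q" "?q2 \<in> carrier Q" "?q3 \<in> carrier Q"
    using x(2-) ij(1,2) k by (simp_all add: Q_smult)
  have qe: "q = ?q0 \<oplus>\<^bsub>Q\<^esub> (?q1 \<oplus>\<^bsub>Q\<^esub> (?q2 \<oplus>\<^bsub>Q\<^esub> ?q3))"
    using elt_coord[OF q] unfolding x(1) quat_element_def by simp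
  let ?f = "\<lambda>q. frag_of (q, m)"
  have r1: "?f q - ?f ?q0 - ?f (?q1 \<oplus>\<^bsub>Q\<^esub> (?q2 \<oplus>\<^bsub>Q\<^esub> ?q3)) \<in> J"
    unfolding qe by (rule J_relations(1)) (use c m in simp_all)
  have r2: "?f (?q1 \<oplus>\<^bsub>Q\<^esub> (?q2 \<oplus>\<^bsub>Q\<^esub> ?q3)) - ?f ?q1 - ?f (?q2 \<oplus>\<^bsub>Q\<^esub> ?q3) \<in> J"
    by (rule J_relations(1)) (use c m in simp_all)
  have r3: "?f (?q2 \<oplus>\<^bsub>Q\<^esub> ?q3) - ?f ?q2 - ?f ?q3 \<in> J"
    by (rule J_relations(1)) (use c m in simp_all)
  have s: "?f ?q0 - frag_of (\<one>\<^bsub>Q\<^esub>, x0 \<otimes> m) \<in> J" "?f ?q1 - frag_of (i, x1 \<otimes> m) \<in> J"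
    "?f ?q2 - frag_of (j, x2 \<otimes> m) \<in> J" "?f ?q3 - frag_of (?k, x3 \<otimes> m) \<in> J"
    by (rule J_relations(3); use x(2-) ij(1,2) k m in simp)+
  have "?f q - basis_tensor (x0 \<otimes> m, x1 \<otimes> m, x2 \<otimes> m, x3 \<otimes> m) =
    (?f q - ?f ?q0 - ?f (?q1 \<oplus>\<^bsub>Q\<^esub> (?q2 \<oplus>\<^bsub>Q\<^esub> ?q3))) +
    (?f (?q1 \<oplus>\<^bsub>Q\<^esub> (?q2 \<oplus>\<^bsub>Q\<^esub> ?q3)) - ?f ?q1 - ?f (?q2 \<oplus>\<^bsub>Q\<^esub> ?q3)) +
    (?f (?q2 \<oplus>\<^bsub>Q\<^esub> ?q3) - ?f ?q2 - ?f ?q3) +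
    (?f ?q0 - frag_of (\<one>\<^bsub>Q\<^esub>, x0 \<otimes> m)) + (?f ?q1 - frag_of (i, x1 \<otimes> m)) +
    (?f ?q2 - frag_of (j, x2 \<otimes> m)) + (?f ?q3 - frag_of (?k, x3 \<otimes> m))"
    unfolding basis_tensor_def by simp
  also have "\<dots> \<in> J" by (intro J_closed(2) r1 r2 r3 s)
  also have "(x0 \<otimes> m, x1 \<otimes> m, x2 \<otimes> m, x3 \<otimes> m) = quat_smult m (coord q)"
    unfolding x(1) using x(2-)[THEN K_carrier] M_carrier[OF m] by (simp add: m_comm)
  finally show ?thesis .
qed

text \<open>The generating half of the basis property: over M the tensors of 1, i, j and i j span.
  Uniqueness of the coordinates comes later, from injectivity of \<open>quat_matrix\<close>.\<close>

lemma basis_tensor_normal_form: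
  assumes "Poly_Mapping.keys f \<subseteq> carrier Q \<times> M"
  shows "\<exists>m \<in> M \<times> M \<times> M \<times> M. f - basis_tensor m \<in> J"
  using assms
proof (induction f rule: frag_induction)
  case zero
  have "basis_tensor (\<zero>, \<zero>, \<zero>, \<zero>) \<in> J"
    unfolding basis_tensor_def prod.case by (intro J_closed(2) frag_zero_in_J) (use ij in auto)
  then have "0 - basis_tensor (\<zero>, \<zero>, \<zero>, \<zero>) \<in> J" by (rule J_closed(3)[OF J_closed(1)])
  then show ?case by (rule bexI) (use M_closed in auto)
next
  case (one x)
  then obtain q m where x: "x = (q, m)" "q \<in> carrier Q" "m \<in> M" by auto
  have "quat_smult m (coord q) \<in> M \<times> M \<times> M \<times> M"
    using coord_closed[OF x(2)] x(3) M_closed(4) K(2) by (auto simp: subset_iff)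
  then show ?case unfolding x(1) using basis_tensor_pure[OF x(2,3)] by (rule bexI[rotated])
next
  case (diff f g)
  then obtain m n where m: "m \<in> M \<times> M \<times> M \<times> M" "f - basis_tensor m \<in> J"
    and n: "n \<in> M \<times> M \<times> M \<times> M" "g - basis_tensor n \<in> J" by blast
  obtain m0 m1 m2 m3 where me: "m = (m0, m1, m2, m3)" "m0 \<in> M" "m1 \<in> M" "m2 \<in> M" "m3 \<in> M" using m(1) by auto
  obtain n0 n1 n2 n3 where ne: "n = (n0, n1, n2, n3)" "n0 \<in> M" "n1 \<in> M" "n2 \<in> M" "n3 \<in> M" using n(1) by auto
  let ?d = "(m0 \<ominus> n0, m1 \<ominus> n1, m2 \<ominus> n2, m3 \<ominus> n3)"
  have dM: "?d \<in> M \<times> M \<times> M \<times> M" using me(2-) ne(2-) M_closed unfolding a_minus_def by auto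
  have k: "i \<otimes>\<^bsub>Q\<^esub> j \<in> carrier Q" using ij by simp
  have s: "frag_of (\<one>\<^bsub>Q\<^esub>, m0) - frag_of (\<one>\<^bsub>Q\<^esub>, n0) - frag_of (\<one>\<^bsub>Q\<^esub>, m0 \<ominus> n0) \<in> J"
    "frag_of (i, m1) - frag_of (i, n1) - frag_of (i, m1 \<ominus> n1) \<in> J"
    "frag_of (j, m2) - frag_of (j, n2) - frag_of (j, m2 \<ominus> n2) \<in> J"
    "frag_of (i \<otimes>\<^bsub>Q\<^esub> j, m3) - frag_of (i \<otimes>\<^bsub>Q\<^esub> j, n3) - frag_of (i \<otimes>\<^bsub>Q\<^esub> j, m3 \<ominus> n3) \<in> J"
    using frag_minus_in_J ij(1,2) k me(2-) ne(2-) by simp_all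
  have "f - g - basis_tensor ?d = (f - basis_tensor m) - (g - basis_tensor n) +
    (frag_of (\<one>\<^bsub>Q\<^esub>, m0) - frag_of (\<one>\<^bsub>Q\<^esub>, n0) - frag_of (\<one>\<^bsub>Q\<^esub>, m0 \<ominus> n0)) +
    (frag_of (i, m1) - frag_of (i, n1) - frag_of (i, m1 \<ominus> n1)) +
    (frag_of (j, m2) - frag_of (j, n2) - frag_of (j, m2 \<ominus> n2)) +
    (frag_of (i \<otimes>\<^bsub>Q\<^esub> j, m3) - frag_of (i \<otimes>\<^bsub>Q\<^esub> j, n3) - frag_of (i \<otimes>\<^bsub>Q\<^esub> j, m3 \<ominus> n3))"
    unfolding basis_tensor_def me(1) ne(1) by simp
  also have "\<dots> \<in> J" by (intro J_closed(2) s J_closed(3)[OF m(2) n(2)])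
  finally show ?case using dM by (rule bexI)
qed

text \<open>Sending (q, m) to m times the matrix of q extends to the monoid ring and kills the
  tensor relations. Conversely, an element of the kernel is congruent modulo J to some
  \<open>basis_tensor m\<close>, whose image is the matrix with coordinates m; as this image is
  zero, m is zero. So J is exactly the kernel, and the quotient is the full matrix algebra.\<close>

lemma split_scalar_extension:
  assumes uv: "u \<in> M" "v \<in> M" and b: "b = u \<otimes> u \<ominus> a \<otimes> (v \<otimes> v)"
    and n: "a \<noteq> \<zero>" "b \<noteq> \<zero>" "\<one> \<oplus> \<one> \<noteq> \<zero>"
  shows "split_quaternion_algebra (R\<lparr>carrier := M\<rparr>) (scalar_extension R K Q M)"
proof -
  have KM: "x \<in> M" if "x \<in> K" for x using K(2) that by auto
  have aM: "a \<in> M" using ab KM by auto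
  have b': "b = u \<otimes> u \<oplus> \<ominus> (a \<otimes> (v \<otimes> v))" using b unfolding a_minus_def .
  interpret Mat: ring Mat by (rule Mat_ring)
  let ?N = "quat_matrix a u v"
  have coordM: "coord q \<in> M \<times> M \<times> M \<times> M" if "q \<in> carrier Q" for q
    using coord_closed[OF that] KM by auto
  have smM: "quat_smult m x \<in> M \<times> M \<times> M \<times> M" if "m \<in> M" "x \<in> M \<times> M \<times> M \<times> M" for m x
    using that M_closed by auto
  define \<phi> where "\<phi> x = ?N (quat_smult (snd x) (coord (fst x)))" for x
  have "\<exists>h\<in>ring_hom Z Mat. \<forall>x\<in>carrier (Q \<times>\<times> B). h (frag_of x) = \<phi> x"
  proof (rule int_monoid_ring_hom[OF DirProd_monoid_QB Mat_ring])
    fix x assume "x \<in> carrier (Q \<times>\<times> B)"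
    then show "\<phi> x \<in> carrier Mat" unfolding \<phi>_def
      by (intro quat_matrix_closed[OF aM uv] smM coordM) auto
  next
    fix x y assume "x \<in> carrier (Q \<times>\<times> B)" "y \<in> carrier (Q \<times>\<times> B)"
    then obtain q m q' m' where e: "x = (q, m)" "q \<in> carrier Q" "m \<in> M" "y = (q', m')" "q' \<in> carrier Q" "m' \<in> M"
      by auto
    obtain x0 x1 x2 x3 where x: "coord q = (x0, x1, x2, x3)" "x0 \<in> M" "x1 \<in> M" "x2 \<in> M" "x3 \<in> M"
      using coordM[OF e(2)] by auto
    obtain y0 y1 y2 y3 where y: "coord q' = (y0, y1, y2, y3)" "y0 \<in> M" "y1 \<in> M" "y2 \<in> M" "y3 \<in> M"
      using coordM[OF e(5)] by auto
    have c: "a \<in> carrier R" "b \<in> carrier R" "m \<in> carrier R" "m' \<in> carrier R" "x0 \<in> carrier R" "x1 \<in> carrier R" "x2 \<in> carrier R"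
      "x3 \<in> carrier R" "y0 \<in> carrier R" "y1 \<in> carrier R" "y2 \<in> carrier R" "y3 \<in> carrier R"
      using ab K_carrier e x y M_carrier by auto
    \<comment> \<open>The product formula in coordinates is bilinear over M, so the scalars m and m'
      can be collected in front.\<close>
    have "quat_smult (m \<otimes> m') (quat_mult a b (coord q) (coord q'))
      = quat_mult a b (quat_smult m (coord q)) (quat_smult m' (coord q'))"
      unfolding x(1) y(1) quat_mult.simps quat_smult.simps prod.inject
      using c by (simp add: r_distr r_minus m_ac)
    then show "\<phi> (x \<otimes>\<^bsub>Q \<times>\<times> B\<^esub> y) = \<phi> x \<otimes>\<^bsub>Mat\<^esub> \<phi> y"
      unfolding \<phi>_def e(1,4) using coord_mult[OF e(2,5)]
        quat_matrix_mult[OF aM uv b' smM[OF e(3) coordM[OF e(2)]] smM[OF e(6) coordM[OF e(5)]]] by simp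
  next
    show "\<phi> \<one>\<^bsub>Q \<times>\<times> B\<^esub> = \<one>\<^bsub>Mat\<^esub>"
      unfolding \<phi>_def using quat_matrix_one[OF aM uv] coord_basis(1) by simp
  qed
  then obtain h where h: "h \<in> ring_hom Z Mat"
    and h_of: "\<And>q m. \<lbrakk>q \<in> carrier Q; m \<in> M\<rbrakk> \<Longrightarrow> h (frag_of (q, m)) = ?N (quat_smult m (coord q))"
    unfolding \<phi>_def by auto
  interpret h: ring_hom_ring Z Mat h
    using ring_hom_ringI2[OF Z.ring_axioms Mat.ring_axioms h] .
  have kq: "i \<otimes>\<^bsub>Q\<^esub> j \<in> carrier Q" using ij by simp
  have bt: "basis_tensor m \<in> carrier Z \<and> h (basis_tensor m) = ?N m" if m: "m \<in> M \<times> M \<times> M \<times> M" for m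
  proof -
    obtain m0 m1 m2 m3 where e: "m = (m0, m1, m2, m3)" "m0 \<in> M" "m1 \<in> M" "m2 \<in> M" "m3 \<in> M" using m by auto
    have fr: "frag_of (\<one>\<^bsub>Q\<^esub>, m0) \<in> carrier Z" "frag_of (i, m1) \<in> carrier Z" "frag_of (j, m2) \<in> carrier Z"
      "frag_of (i \<otimes>\<^bsub>Q\<^esub> j, m3) \<in> carrier Z" using e(2-) ij(1,2) by simp_all
    have be: "basis_tensor m = frag_of (\<one>\<^bsub>Q\<^esub>, m0) \<oplus>\<^bsub>Z\<^esub> frag_of (i, m1) \<oplus>\<^bsub>Z\<^esub> frag_of (j, m2) \<oplus>\<^bsub>Z\<^esub> frag_of (i \<otimes>\<^bsub>Q\<^esub> j, m3)"
      unfolding basis_tensor_def e(1) by simp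
    have mc: "m0 \<in> carrier R" "m1 \<in> carrier R" "m2 \<in> carrier R" "m3 \<in> carrier R" using e(2-) M_carrier by auto
    have "h (basis_tensor m) = ?N (m0, \<zero>, \<zero>, \<zero>) \<oplus>\<^bsub>Mat\<^esub> ?N (\<zero>, m1, \<zero>, \<zero>) \<oplus>\<^bsub>Mat\<^esub> ?N (\<zero>, \<zero>, m2, \<zero>) \<oplus>\<^bsub>Mat\<^esub> ?N (\<zero>, \<zero>, \<zero>, m3)"
      unfolding be using fr h_of[OF Q.one_closed e(2)] h_of[OF ij(1) e(3)] h_of[OF ij(2) e(4)] h_of[OF kq e(5)] mc
      by (simp add: coord_basis del: int_monoid_ring_simps)
    also have "\<dots> = ?N (quat_add (quat_add (quat_add (m0, \<zero>, \<zero>, \<zero>) (\<zero>, m1, \<zero>, \<zero>)) (\<zero>, \<zero>, m2, \<zero>)) (\<zero>, \<zero>, \<zero>, m3))"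
    proof -
      have t: "(m0, \<zero>, \<zero>, \<zero>) \<in> M \<times> M \<times> M \<times> M" "(\<zero>, m1, \<zero>, \<zero>) \<in> M \<times> M \<times> M \<times> M"
        "(\<zero>, \<zero>, m2, \<zero>) \<in> M \<times> M \<times> M \<times> M" "(\<zero>, \<zero>, \<zero>, m3) \<in> M \<times> M \<times> M \<times> M"
        using e(2-) M_closed(1) by auto
      have "quat_add x y \<in> M \<times> M \<times> M \<times> M" if "x \<in> M \<times> M \<times> M \<times> M" "y \<in> M \<times> M \<times> M \<times> M" for x y
        using that M_closed(5) by auto
      then show ?thesis using t by (simp only: quat_matrix_add[OF aM uv])
    qed
    also have "\<dots> = ?N m" unfolding e(1) using mc by simp
    finally show ?thesis using fr by (metis Z.a_closed be)
  qed
  note bij = quat_matrix_bij[OF aM uv b' n]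
  have img: "h ` carrier Z = carrier Mat"
  proof
    show "h ` carrier Z \<subseteq> carrier Mat" using h.hom_closed by blast
    show "carrier Mat \<subseteq> h ` carrier Z"
    proof
      fix A assume "A \<in> carrier Mat"
      then obtain m where "m \<in> M \<times> M \<times> M \<times> M" "A = ?N m" using bij unfolding bij_betw_def by blast
      then show "A \<in> h ` carrier Z" using bt[of m] by (metis imageI)
    qed
  qed
  let ?ker = "a_kernel Z Mat h"
  have hd: "h (x - y) = h x \<ominus>\<^bsub>Mat\<^esub> h y" if "x \<in> carrier Z" "y \<in> carrier Z" "x - y \<in> carrier Z" for x y
  proof -
    have "h x = h (x - y) \<oplus>\<^bsub>Mat\<^esub> h y" using h.hom_add[OF that(3,2)] by simp
    then show ?thesis using h.hom_closed[OF that(3)] h.hom_closed[OF that(2)]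
      by (simp add: a_minus_def Mat.a_assoc Mat.r_neg)
  qed
  have dz: "x - y \<in> carrier Z" if "x \<in> carrier Z" "y \<in> carrier Z" for x y
    using that keys_diff[of x y] by auto
  have ker: "x \<in> ?ker \<longleftrightarrow> x \<in> carrier Z \<and> h x = \<zero>\<^bsub>Mat\<^esub>" for x
    unfolding a_kernel_def' by simp
  have rel: "x - y - z \<in> ?ker" if xyz: "x \<in> carrier Z" "y \<in> carrier Z" "z \<in> carrier Z" and e: "h x = h y \<oplus>\<^bsub>Mat\<^esub> h z" for x y z
  proof -
    have "h (x - y - z) = h x \<ominus>\<^bsub>Mat\<^esub> h y \<ominus>\<^bsub>Mat\<^esub> h z" using hd dz xyz by simp
    moreover note hc = h.hom_closed[OF xyz(2)] h.hom_closed[OF xyz(3)]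
    have "h y \<oplus>\<^bsub>Mat\<^esub> h z \<ominus>\<^bsub>Mat\<^esub> h y = h z \<oplus>\<^bsub>Mat\<^esub> (h y \<oplus>\<^bsub>Mat\<^esub> \<ominus>\<^bsub>Mat\<^esub> h y)"
      unfolding a_minus_def Mat.a_comm[OF hc] by (rule Mat.a_assoc) (use hc in auto)
    then have "h y \<oplus>\<^bsub>Mat\<^esub> h z \<ominus>\<^bsub>Mat\<^esub> h y \<ominus>\<^bsub>Mat\<^esub> h z = \<zero>\<^bsub>Mat\<^esub>"
      using hc by (simp add: Mat.r_neg a_minus_def)
    ultimately have "h (x - y - z) = \<zero>\<^bsub>Mat\<^esub>" unfolding e by simp
    then show ?thesis unfolding ker using dz xyz by blast
  qed
  have rel2: "x - y \<in> ?ker" if xy: "x \<in> carrier Z" "y \<in> carrier Z" and e: "h x = h y" for x y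
    unfolding ker using dz[OF xy] hd[OF xy dz[OF xy]] e h.hom_closed[OF xy(2)] by (simp add: a_minus_def Mat.r_neg)
  have relker: "tensor_relations (R\<lparr>carrier := K\<rparr>) Q B \<subseteq> ?ker"
  proof
    fix t assume "t \<in> tensor_relations (R\<lparr>carrier := K\<rparr>) Q B"
    then show "t \<in> ?ker"
    proof (cases rule: tensor_relation_cases)
      case (left q q' m)
      obtain x0 x1 x2 x3 where x: "coord q = (x0, x1, x2, x3)" "x0 \<in> M" "x1 \<in> M" "x2 \<in> M" "x3 \<in> M"
        using coordM[OF left(2)] by auto
      obtain y0 y1 y2 y3 where y: "coord q' = (y0, y1, y2, y3)" "y0 \<in> M" "y1 \<in> M" "y2 \<in> M" "y3 \<in> M"
        using coordM[OF left(3)] by auto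
      have "quat_smult m (quat_add (coord q) (coord q')) = quat_add (quat_smult m (coord q)) (quat_smult m (coord q'))"
        unfolding x(1) y(1) using x(2-)[THEN M_carrier] y(2-)[THEN M_carrier] M_carrier[OF left(4)] by (simp add: r_distr)
      then have e: "h (frag_of (q \<oplus>\<^bsub>Q\<^esub> q', m)) = h (frag_of (q, m)) \<oplus>\<^bsub>Mat\<^esub> h (frag_of (q', m))"
        using h_of[OF Q.a_closed[OF left(2,3)] left(4)] h_of[OF left(2,4)] h_of[OF left(3,4)] coord_add[OF left(2,3)]
          quat_matrix_add[OF aM uv smM[OF left(4) coordM[OF left(2)]] smM[OF left(4) coordM[OF left(3)]]] by simp
      show ?thesis unfolding left(1) by (rule rel[OF _ _ _ e]) (use left(2-) in simp_all)
    next
      case (right q m m')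
      obtain x0 x1 x2 x3 where x: "coord q = (x0, x1, x2, x3)" "x0 \<in> M" "x1 \<in> M" "x2 \<in> M" "x3 \<in> M"
        using coordM[OF right(2)] by auto
      have "quat_smult (m \<oplus> m') (coord q) = quat_add (quat_smult m (coord q)) (quat_smult m' (coord q))"
        unfolding x(1) using x(2-)[THEN M_carrier] right(3,4)[THEN M_carrier] by (simp add: l_distr)
      then have e: "h (frag_of (q, m \<oplus> m')) = h (frag_of (q, m)) \<oplus>\<^bsub>Mat\<^esub> h (frag_of (q, m'))"
        using h_of[OF right(2) M_closed(5)[OF right(3,4)]] h_of[OF right(2,3)] h_of[OF right(2,4)]
          quat_matrix_add[OF aM uv smM[OF right(3) coordM[OF right(2)]] smM[OF right(4) coordM[OF right(2)]]] by simp
      show ?thesis unfolding right(1) by (rule rel[OF _ _ _ e]) (use right(2-) M_closed in simp_all)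
    next
      case (scalar k q m)
      obtain x0 x1 x2 x3 where x: "coord q = (x0, x1, x2, x3)" "x0 \<in> M" "x1 \<in> M" "x2 \<in> M" "x3 \<in> M"
        using coordM[OF scalar(3)] by auto
      have "quat_smult m (quat_smult k (coord q)) = quat_smult (k \<otimes> m) (coord q)"
        unfolding x(1) using x(2-)[THEN M_carrier] scalar(4)[THEN M_carrier] scalar(2)[THEN K_carrier] by (simp add: m_ac)
      then have e: "h (frag_of (k \<odot>\<^bsub>Q\<^esub> q, m)) = h (frag_of (q, k \<otimes> m))"
        using h_of[OF Q_smult(1)[OF scalar(2,3)] scalar(4)] h_of[OF scalar(3) M_closed(4)[OF KM[OF scalar(2)] scalar(4)]]
          coord_smult[OF scalar(3,2)] by simp
      show ?thesis unfolding scalar(1) by (rule rel2[OF _ _ e]) (use scalar(2-) M_closed KM in \<open>simp_all add: Q_smult\<close>)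
    qed
  qed
  have Jker: "J = ?ker"
  proof
    show JK: "J \<subseteq> ?ker"
      unfolding tensor_ideal_def by (rule Z.genideal_minimal[OF h.kernel_is_ideal relker])
    show "?ker \<subseteq> J"
    proof
      fix f assume f: "f \<in> ?ker"
      then have fZ: "f \<in> carrier Z" and f0: "h f = \<zero>\<^bsub>Mat\<^esub>" unfolding ker by auto
      obtain m where m: "m \<in> M \<times> M \<times> M \<times> M" "f - basis_tensor m \<in> J"
        using basis_tensor_normal_form[of f] fZ by auto
      have bZ: "basis_tensor m \<in> carrier Z" "h (basis_tensor m) = ?N m" using bt[OF m(1)] by auto
      have "h (f - basis_tensor m) = \<zero>\<^bsub>Mat\<^esub>" using m(2) JK unfolding ker by auto
      then have "\<zero>\<^bsub>Mat\<^esub> \<ominus>\<^bsub>Mat\<^esub> ?N m = \<zero>\<^bsub>Mat\<^esub>" using hd[OF fZ bZ(1) dz[OF fZ bZ(1)]] f0 bZ(2) by simp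
      then have Nm: "?N m = \<zero>\<^bsub>Mat\<^esub>" using h.hom_closed[OF bZ(1)] unfolding bZ(2) by simp
      have z4: "(\<zero>, \<zero>, \<zero>, \<zero>) \<in> M \<times> M \<times> M \<times> M" using M_closed by auto
      have "?N (\<zero>, \<zero>, \<zero>, \<zero>) = \<zero>\<^bsub>Mat\<^esub>"
        unfolding quat_matrix.simps Mat_zero mat2_eq_iff using aM uv M_carrier by simp
      then have m0: "m = (\<zero>, \<zero>, \<zero>, \<zero>)" using bij Nm m(1) z4 unfolding bij_betw_def inj_on_def by metis
      have "basis_tensor m \<in> J"
        unfolding m0 basis_tensor_def prod.case by (intro J_closed(2) frag_zero_in_J) (use ij in auto)
      from J_closed(2)[OF m(2) this] show "f \<in> J" by simp
    qed
  qed
  let ?T = "tensor_product (R\<lparr>carrier := K\<rparr>) Q B" and ?S = "scalar_extension R K Q M"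
  have T: "?T = Z Quot ?ker" unfolding tensor_product_def Jker ..
  let ?H = "\<lambda>U. the_elem (h ` U)"
  have iso: "?H \<in> ring_iso ?T Mat" unfolding T using h.FactRing_iso_set[OF img] .
  then have "?H \<in> ring_iso ?S Mat"
    unfolding scalar_extension_def Let_def ring_iso_def ring_hom_def by simp
  moreover have "?H (m \<odot>\<^bsub>?S\<^esub> t) = m \<odot>\<^bsub>Mat\<^esub> ?H t" if m: "m \<in> M" and t: "t \<in> carrier ?S" for m t
  proof -
    have tT: "t \<in> carrier ?T" using t unfolding scalar_extension_def Let_def by simp
    \<comment> \<open>Scalars act on the extension as multiplication by 1 \<otimes> m, whose image
      is m times the identity matrix. This makes the ring isomorphism linear over M.\<close>
    let ?p = "pure_tensor (R\<lparr>carrier := K\<rparr>) Q B \<one>\<^bsub>Q\<^esub> m"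
    have fZ: "frag_of (\<one>\<^bsub>Q\<^esub>, m) \<in> carrier Z" using m by simp
    have pe: "?p = ?ker +>\<^bsub>Z\<^esub> frag_of (\<one>\<^bsub>Q\<^esub>, m)" unfolding pure_tensor_def Jker ..
    have pT: "?p \<in> carrier ?T" unfolding T pe FactRing_def A_RCOSETS_def' using fZ by auto
    have "m \<odot>\<^bsub>?S\<^esub> t = ?p \<otimes>\<^bsub>?T\<^esub> t" unfolding scalar_extension_def Let_def by simp
    then have e: "?H (m \<odot>\<^bsub>?S\<^esub> t) = ?H ?p \<otimes>\<^bsub>Mat\<^esub> ?H t"
      using iso pT tT unfolding ring_iso_def ring_hom_def by auto
    have mc: "m \<in> carrier R" using m M_carrier by auto
    have "?H ?p = h (frag_of (\<one>\<^bsub>Q\<^esub>, m))" unfolding pe by (rule h.the_elem_simp[OF fZ])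
    also have "\<dots> = mat2 m \<zero> \<zero> m"
      using h_of[OF Q.one_closed m] mc aM uv M_carrier by (simp add: coord_basis)
    finally have p: "?H ?p = mat2 m \<zero> \<zero> m" .
    have "?H t \<in> carrier Mat" using iso tT unfolding ring_iso_def ring_hom_def by auto
    then obtain p q r s where A: "?H t = mat2 p q r s" "p \<in> M" "q \<in> M" "r \<in> M" "s \<in> M"
      unfolding Mat_carrier by auto
    show ?thesis
      unfolding e p A(1) Mat_smult Mat_mult[OF m M_closed(1,1) m A(2-)] mat2_eq_iff
      using mc A(2-)[THEN M_carrier] by simp
  qed
  ultimately have "?H \<in> algebra_iso (R\<lparr>carrier := M\<rparr>) ?S Mat" unfolding algebra_iso_def by simp
  then show ?thesis unfolding split_quaternion_algebra_def by auto
qed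

end

section \<open>From a central simple algebra to quaternion coordinates\<close>

lemma algebra_scalars:
  assumes K: "field K" and Q: "assoc_algebra K Q" and one: "\<one>\<^bsub>Q\<^esub> \<noteq> \<zero>\<^bsub>Q\<^esub>"
  shows "subfield (scalars K Q) Q" "inj_on (\<lambda>k. k \<odot>\<^bsub>Q\<^esub> \<one>\<^bsub>Q\<^esub>) (carrier K)"
    "(\<lambda>k. k \<odot>\<^bsub>Q\<^esub> \<one>\<^bsub>Q\<^esub>) \<in> ring_hom K Q"
proof -
  interpret K: field K by (rule K)
  interpret Q: assoc_algebra K Q by (rule Q)
  let ?h = "\<lambda>k. k \<odot>\<^bsub>Q\<^esub> \<one>\<^bsub>Q\<^esub>"
  show h: "?h \<in> ring_hom K Q"
  proof (rule ring_hom_memI)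
    fix x y assume xy: "x \<in> carrier K" "y \<in> carrier K"
    show "(x \<otimes>\<^bsub>K\<^esub> y) \<odot>\<^bsub>Q\<^esub> \<one>\<^bsub>Q\<^esub> = x \<odot>\<^bsub>Q\<^esub> \<one>\<^bsub>Q\<^esub> \<otimes>\<^bsub>Q\<^esub> (y \<odot>\<^bsub>Q\<^esub> \<one>\<^bsub>Q\<^esub>)"
      using xy by (simp add: Q.smult_assoc_left Q.smult_assoc1)
    show "(x \<oplus>\<^bsub>K\<^esub> y) \<odot>\<^bsub>Q\<^esub> \<one>\<^bsub>Q\<^esub> = x \<odot>\<^bsub>Q\<^esub> \<one>\<^bsub>Q\<^esub> \<oplus>\<^bsub>Q\<^esub> y \<odot>\<^bsub>Q\<^esub> \<one>\<^bsub>Q\<^esub>"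
      using xy by (simp add: Q.smult_l_distr)
  qed (use Q.smult_one in auto)
  interpret h: ring_hom_ring K Q ?h
    using ring_hom_ringI2[OF K.ring_axioms Q.ring_axioms h] .
  have "subfield (?h ` carrier K) Q"
    using h.img_is_subfield(2)[OF K.carrier_is_subfield one] .
  then show "subfield (scalars K Q) Q" unfolding scalars_def .
  show "inj_on ?h (carrier K)"
    using h.img_is_subfield(1)[OF K.carrier_is_subfield one] .
qed

text \<open>The basis found over the copy of K in the algebra is pulled back along the injection k
  |-> k 1. Spanning and independence of 1, i, j, i j become surjectivity and injectivity of the
  coordinate map.\<close>

lemma (in field) quaternion_algebra_basis:
  assumes K: "subfield K R" and Q: "quaternion_algebra (R\<lparr>carrier := K\<rparr>) Q" and two: "\<one> \<oplus> \<one> \<noteq> \<zero>"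
  shows "\<exists>a\<in>K. \<exists>b\<in>K. \<exists>i\<in>carrier Q. \<exists>j\<in>carrier Q. a \<noteq> \<zero> \<and> b \<noteq> \<zero> \<and>
    i \<otimes>\<^bsub>Q\<^esub> i = a \<odot>\<^bsub>Q\<^esub> \<one>\<^bsub>Q\<^esub> \<and> j \<otimes>\<^bsub>Q\<^esub> j = b \<odot>\<^bsub>Q\<^esub> \<one>\<^bsub>Q\<^esub> \<and> j \<otimes>\<^bsub>Q\<^esub> i = \<ominus>\<^bsub>Q\<^esub> (i \<otimes>\<^bsub>Q\<^esub> j) \<and>
    bij_betw (quat_element Q i j) (K \<times> K \<times> K \<times> K) (carrier Q)"
proof -
  let ?K = "R\<lparr>carrier := K\<rparr>"
  let ?S = "scalars ?K Q"
  let ?h = "\<lambda>k. k \<odot>\<^bsub>Q\<^esub> \<one>\<^bsub>Q\<^esub>"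
  have csa: "field ?K" "assoc_algebra ?K Q" "simple_ring Q" "ring_center Q = ?S"
    and dim4: "ring.dimension Q 4 ?S (carrier Q)"
    using Q unfolding quaternion_algebra_def central_simple_algebra_def by auto
  interpret Q: assoc_algebra ?K Q by (rule csa(2))
  have one: "\<one>\<^bsub>Q\<^esub> \<noteq> \<zero>\<^bsub>Q\<^esub>" using csa(3) Q.one_zeroD unfolding simple_ring_def by auto
  note sc = algebra_scalars[OF csa(1,2) one]
  have hom: "?h \<one> = \<one>\<^bsub>Q\<^esub>" "?h \<zero> = \<zero>\<^bsub>Q\<^esub>" "?h (\<one> \<oplus> \<one>) = \<one>\<^bsub>Q\<^esub> \<oplus>\<^bsub>Q\<^esub> \<one>\<^bsub>Q\<^esub>"
  proof -
    have Kr: "\<one> \<in> K" "\<zero> \<in> K" using subringE(2,3)[OF subfieldE(1)[OF K]] by auto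
    show h1: "?h \<one> = \<one>\<^bsub>Q\<^esub>" using ring_hom_memE(4)[OF sc(3)] by simp
    show "?h (\<one> \<oplus> \<one>) = \<one>\<^bsub>Q\<^esub> \<oplus>\<^bsub>Q\<^esub> \<one>\<^bsub>Q\<^esub>" using ring_hom_memE(3)[OF sc(3), of \<one> \<one>] Kr h1 by simp
    show "?h \<zero> = \<zero>\<^bsub>Q\<^esub>"
      using ring_hom_zero[OF sc(3) subring_is_ring[OF subfieldE(1)[OF K]] Q.ring_axioms] by simp
  qed
  have inj: "x = y" if "?h x = ?h y" "x \<in> K" "y \<in> K" for x y
    using sc(2) that unfolding inj_on_def by simp
  have Kcl: "\<one> \<in> K" "\<zero> \<in> K" "\<one> \<oplus> \<one> \<in> K" using subringE(2,3,7)[OF subfieldE(1)[OF K]] by auto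
  have twoQ: "\<one>\<^bsub>Q\<^esub> \<oplus>\<^bsub>Q\<^esub> \<one>\<^bsub>Q\<^esub> \<noteq> \<zero>\<^bsub>Q\<^esub>"
    using inj[of "\<one> \<oplus> \<one>" \<zero>] two Kcl hom(2,3) by metis
  interpret D: degree_two_algebra Q ?S
    by (intro degree_two_algebra.intro degree_two_algebra_axioms.intro Q.ring_axioms sc(1) csa(3,4)
        dim4 twoQ)
  obtain a' b' i j where D: "D.quaternion_basis a' b' i j" using D.exists_quaternion_basis by blast
  have ij: "i \<in> carrier Q" "j \<in> carrier Q" "j \<otimes>\<^bsub>Q\<^esub> i = \<ominus>\<^bsub>Q\<^esub> (i \<otimes>\<^bsub>Q\<^esub> j)"
    and ind: "Q.independent ?S [\<one>\<^bsub>Q\<^esub>, i, j, i \<otimes>\<^bsub>Q\<^esub> j]"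
    using D unfolding D.quaternion_basis_def by auto
  have a': "a' \<in> ?S" "a' \<noteq> \<zero>\<^bsub>Q\<^esub>" "i \<otimes>\<^bsub>Q\<^esub> i = a'"
    and b': "b' \<in> ?S" "b' \<noteq> \<zero>\<^bsub>Q\<^esub>" "j \<otimes>\<^bsub>Q\<^esub> j = b'"
    using D unfolding D.quaternion_basis_def by auto
  obtain a where a: "a \<in> K" "i \<otimes>\<^bsub>Q\<^esub> i = ?h a" "?h a \<noteq> \<zero>\<^bsub>Q\<^esub>"
    using a' unfolding scalars_def by auto
  obtain b where b: "b \<in> K" "j \<otimes>\<^bsub>Q\<^esub> j = ?h b" "?h b \<noteq> \<zero>\<^bsub>Q\<^esub>"
    using b' unfolding scalars_def by auto
  let ?k = "i \<otimes>\<^bsub>Q\<^esub> j"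
  let ?Us = "[\<one>\<^bsub>Q\<^esub>, i, j, ?k]"
  have k: "?k \<in> carrier Q" using ij by simp
  have smult: "c \<odot>\<^bsub>Q\<^esub> x = ?h c \<otimes>\<^bsub>Q\<^esub> x" "c \<odot>\<^bsub>Q\<^esub> x \<in> carrier Q" if "c \<in> K" "x \<in> carrier Q" for c x
    using Q.smult_assoc_left[of c "\<one>\<^bsub>Q\<^esub>" x] Q.smult_closed[of c x] that by simp_all
  have elt: "quat_element Q i j (c0, c1, c2, c3) = Q.combine (map ?h [c0, c1, c2, c3]) ?Us"
    if "c0 \<in> K" "c1 \<in> K" "c2 \<in> K" "c3 \<in> K" for c0 c1 c2 c3
    unfolding quat_element_def prod.case
    using smult[OF that(1) Q.one_closed] smult[OF that(2) ij(1)] smult[OF that(3) ij(2)] smult[OF that(4) k]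
    by simp
  have span: "Q.Span ?S ?Us = carrier Q" by (rule D.independent_four_spans[OF ind])
  have hS: "?h c \<in> ?S" if "c \<in> K" for c unfolding scalars_def using that by simp
  have "bij_betw (quat_element Q i j) (K \<times> K \<times> K \<times> K) (carrier Q)"
    unfolding bij_betw_def
  proof
    show "inj_on (quat_element Q i j) (K \<times> K \<times> K \<times> K)"
    proof (rule inj_onI)
      fix x y assume "x \<in> K \<times> K \<times> K \<times> K" "y \<in> K \<times> K \<times> K \<times> K"
        and eq: "quat_element Q i j x = quat_element Q i j y"
      then obtain x0 x1 x2 x3 y0 y1 y2 y3 where x: "x = (x0, x1, x2, x3)" "x0 \<in> K" "x1 \<in> K" "x2 \<in> K" "x3 \<in> K"
        and y: "y = (y0, y1, y2, y3)" "y0 \<in> K" "y1 \<in> K" "y2 \<in> K" "y3 \<in> K" by auto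
      have ex: "quat_element Q i j x = Q.combine (map ?h [x0, x1, x2, x3]) ?Us"
        and ey: "quat_element Q i j x = Q.combine (map ?h [y0, y1, y2, y3]) ?Us"
        using elt[OF x(2-)] elt[OF y(2-)] eq x(1) y(1) by simp_all
      have mem: "set (map ?h [x0, x1, x2, x3]) \<subseteq> ?S" "set (map ?h [y0, y1, y2, y3]) \<subseteq> ?S"
        using hS x(2-) y(2-) by auto
      have "quat_element Q i j x \<in> Q.Span ?S ?Us"
        unfolding span x(1) quat_element_def prod.case
        using smult(2)[OF x(2) Q.one_closed] smult(2)[OF x(3) ij(1)] smult(2)[OF x(4) ij(2)] smult(2)[OF x(5) k]
        by simp
      from Q.unique_decomposition[OF sc(1) ind this]
      have "map ?h [x0, x1, x2, x3] = map ?h [y0, y1, y2, y3]"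
        using ex ey mem by (metis length_map list.size(3,4))
      then show "x = y" unfolding x(1) y(1) using inj x(2-) y(2-) by simp
    qed
    show "quat_element Q i j ` (K \<times> K \<times> K \<times> K) = carrier Q"
    proof
      show "quat_element Q i j ` (K \<times> K \<times> K \<times> K) \<subseteq> carrier Q"
      proof (rule image_subsetI)
        fix x assume "x \<in> K \<times> K \<times> K \<times> K"
        then obtain x0 x1 x2 x3 where x: "x = (x0, x1, x2, x3)" "x0 \<in> K" "x1 \<in> K" "x2 \<in> K" "x3 \<in> K" by auto
        show "quat_element Q i j x \<in> carrier Q"
          unfolding x(1) quat_element_def prod.case
          using smult(2)[OF x(2) Q.one_closed] smult(2)[OF x(3) ij(1)] smult(2)[OF x(4) ij(2)] smult(2)[OF x(5) k]
          by simp
      qed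
      show "carrier Q \<subseteq> quat_element Q i j ` (K \<times> K \<times> K \<times> K)"
      proof
        fix x assume "x \<in> carrier Q"
        then have "x \<in> Q.Span ?S ?Us" using span by simp
        moreover have "set ?Us \<subseteq> carrier Q" using ij k by simp
        ultimately obtain s0 s1 s2 s3 where s: "s0 \<in> ?S" "s1 \<in> ?S" "s2 \<in> ?S" "s3 \<in> ?S"
          and xs: "x = s0 \<otimes>\<^bsub>Q\<^esub> \<one>\<^bsub>Q\<^esub> \<oplus>\<^bsub>Q\<^esub> (s1 \<otimes>\<^bsub>Q\<^esub> i \<oplus>\<^bsub>Q\<^esub> (s2 \<otimes>\<^bsub>Q\<^esub> j \<oplus>\<^bsub>Q\<^esub> s3 \<otimes>\<^bsub>Q\<^esub> ?k))"
          using D.span_four by blast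
        obtain c0 c1 c2 c3 where c: "c0 \<in> K" "c1 \<in> K" "c2 \<in> K" "c3 \<in> K"
          "s0 = ?h c0" "s1 = ?h c1" "s2 = ?h c2" "s3 = ?h c3"
          using s unfolding scalars_def by auto
        have "x = quat_element Q i j (c0, c1, c2, c3)"
          unfolding xs c(5-8) quat_element_def prod.case
          using smult(1)[OF c(1) Q.one_closed] smult(1)[OF c(2) ij(1)] smult(1)[OF c(3) ij(2)] smult(1)[OF c(4) k]
          by simp
        then show "x \<in> quat_element Q i j ` (K \<times> K \<times> K \<times> K)" using c(1-4) by auto
      qed
    qed
  qed
  moreover have "a \<noteq> \<zero>" "b \<noteq> \<zero>" using a(3) b(3) hom(2) by auto
  ultimately show ?thesis using a(1,2) b(1,2) ij by blast
qed

lemma (in field) two_not_zero: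
  assumes F: "subfield F R" and char: "ring_char (R\<lparr>carrier := F\<rparr>) \<noteq> 2"
  shows "\<one> \<oplus> \<one> \<noteq> \<zero>"
proof
  assume two: "\<one> \<oplus> \<one> = \<zero>"
  let ?F = "R\<lparr>carrier := F\<rparr>"
  let ?P = "\<lambda>n::nat. 0 < n \<and> [n] \<cdot>\<^bsub>?F\<^esub> \<one>\<^bsub>?F\<^esub> = \<zero>\<^bsub>?F\<^esub>"
  \<comment> \<open>Multiples are computed from the operations alone, so restricting the carrier to
    F does not change them.\<close>
  have mult: "[n] \<cdot>\<^bsub>?F\<^esub> \<one> = [n] \<cdot> \<one>" for n :: nat
    unfolding add_pow_def nat_pow_def by simp
  have P2: "?P 2" using two by (simp add: mult numeral_2_eq_2)
  have "\<not> ?P 1" by (simp add: mult)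
  have "Least ?P = 2"
  proof (rule Least_equality)
    show "?P 2" by (rule P2)
  next
    fix n assume n: "?P n"
    then have "n \<noteq> 1" using \<open>\<not> ?P 1\<close> by metis
    then show "2 \<le> n" using n by simp
  qed
  then have "ring_char ?F = 2" unfolding ring_char_def using P2 by (metis (mono_tags, lifting))
  then show False using char by simp
qed

theorem theorem3p2:
  fixes L :: "('a, 'm) ring_scheme"
    and F K :: "'a set"
    and Q :: "('a, 'b, 'n) module_scheme"
  assumes "algebraic_closure L K"
    and "finite_field_extension L F K"
    and "ring_char (L\<lparr>carrier := F\<rparr>) \<noteq> 2"
    and "ring.dim L F K \<le> 8"
    and "quaternion_algebra (L\<lparr>carrier := K\<rparr>) Q"
  shows "\<exists>F'. two_extension L F F' \<and>
           ring.dim L F F' \<le> 2 ^ ring.dim L F K \<and>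
           (let KF' = generate_field L (K \<union> F')
            in split_quaternion_algebra (L\<lparr>carrier := KF'\<rparr>) (scalar_extension L K Q KF'))"
proof -
  interpret algebraic_closure L K by (rule assms(1))
  have F: "subfield F L" and K: "subfield K L" "F \<subseteq> K" and fin: "finite_dimension F K"
    using assms(2) unfolding finite_field_extension_def by auto
  let ?n = "dim F K"
  have dimK: "dimension ?n F K" using finite_dimensionE[OF F fin] unfolding over_def .
  have two: "\<one>\<^bsub>L\<^esub> \<oplus>\<^bsub>L\<^esub> \<one>\<^bsub>L\<^esub> \<noteq> \<zero>\<^bsub>L\<^esub>" by (rule two_not_zero[OF F assms(3)])
  obtain a b i j where ab: "a \<in> K" "b \<in> K" "a \<noteq> \<zero>\<^bsub>L\<^esub>" "b \<noteq> \<zero>\<^bsub>L\<^esub>"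
    and ij: "i \<in> carrier Q" "j \<in> carrier Q" "i \<otimes>\<^bsub>Q\<^esub> i = a \<odot>\<^bsub>Q\<^esub> \<one>\<^bsub>Q\<^esub>" "j \<otimes>\<^bsub>Q\<^esub> j = b \<odot>\<^bsub>Q\<^esub> \<one>\<^bsub>Q\<^esub>"
      "j \<otimes>\<^bsub>Q\<^esub> i = \<ominus>\<^bsub>Q\<^esub> (i \<otimes>\<^bsub>Q\<^esub> j)"
    and bij: "bij_betw (quat_element Q i j) (K \<times> K \<times> K \<times> K) (carrier Q)"
    using quaternion_algebra_basis[OF K(1) assms(5) two] by blast
  \<comment> \<open>Both the independent and the dependent case of 1/a, a, 1 produce a tower of at
    most [K : F] roots over which b becomes a norm.\<close>
  have "\<exists>m\<le>?n. \<exists>E. quadratic_tower F m E \<and> (\<forall>M. subfield M L \<longrightarrow> K \<union> E \<subseteq> M \<longrightarrow>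
      (\<exists>u\<in>M. \<exists>v\<in>M. b = u \<otimes>\<^bsub>L\<^esub> u \<ominus>\<^bsub>L\<^esub> a \<otimes>\<^bsub>L\<^esub> (v \<otimes>\<^bsub>L\<^esub> v)))"
    using norm_form_independent[OF F K dimK assms(4) two ab(1-3)]
      norm_form_dependent[OF F K dimK two ab(1-3)] by blast
  then obtain m E where m: "m \<le> ?n" and E: "quadratic_tower F m E"
    and norm: "\<And>M. \<lbrakk>subfield M L; K \<union> E \<subseteq> M\<rbrakk> \<Longrightarrow>
      \<exists>u\<in>M. \<exists>v\<in>M. b = u \<otimes>\<^bsub>L\<^esub> u \<ominus>\<^bsub>L\<^esub> a \<otimes>\<^bsub>L\<^esub> (v \<otimes>\<^bsub>L\<^esub> v)" by blast
  define M where "M = generate_field L (K \<union> E)"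
  have KEc: "K \<union> E \<subseteq> carrier L"
    using subfieldE(3)[OF K(1)] subfieldE(3)[OF quadratic_tower_subfield(1)[OF E F]] by auto
  have M: "subfield M L" "K \<union> E \<subseteq> M"
    using generate_fieldE(1,2)[OF KEc M_def] by auto
  obtain u v where uv: "u \<in> M" "v \<in> M" "b = u \<otimes>\<^bsub>L\<^esub> u \<ominus>\<^bsub>L\<^esub> a \<otimes>\<^bsub>L\<^esub> (v \<otimes>\<^bsub>L\<^esub> v)"
    using norm[OF M] by blast
  have alg: "assoc_algebra (L\<lparr>carrier := K\<rparr>) Q"
    using assms(5) unfolding quaternion_algebra_def central_simple_algebra_def by simp
  have KM: "K \<subseteq> M" using M(2) by blast
  have "based_quaternion_algebra L M K Q i j a b"
    by (intro based_quaternion_algebra.intro field_with_subfield.intro field_axioms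
        field_with_subfield_axioms.intro based_quaternion_algebra_axioms.intro
        M(1) K(1) KM alg ab(1,2) ij bij)
  then have "split_quaternion_algebra (L\<lparr>carrier := M\<rparr>) (scalar_extension L K Q M)"
    by (rule based_quaternion_algebra.split_scalar_extension[OF _ uv ab(3,4) two])
  moreover have "two_extension L F E" by (rule quadratic_tower_two_extension[OF E F two])
  moreover have "dim F E \<le> 2 ^ ?n" by (rule quadratic_tower_dim[OF E F m])
  ultimately show ?thesis unfolding Let_def M_def by blast
qed

end
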